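(* Let $b\in(0,1]$, $\delta\in(0,1)$ and $C_0>0$ be constants. There is a constant $C>0$ depending only on $b,\delta,C_0$ (and not on $n$) such that the following holds for every $n\ge 1$ and every probability distribution $\mu$ fully supported on $\{\pm1\}^n$ satisfying: (i) (Marginal boundedness) for every $i\in[n]$ and $x\in\{\pm1\}^n$, $\; b\le \sqrt{\mu(x^i)/\mu(x)}\le 1/b$; (ii) (Dobrushin condition) the Dobrushin influence matrix $R$ of $\mu$ satisfies $\|R\|_1\le C_0$ and $\|R\|_2\le 1-\delta$. For every $f:\{\pm1\}^n\to\{\pm1\}$, all of the following inequalities hold: (1) (KKL) $\displaystyle \max_{i\in[n]}\mathsf{Inf}_{\mu,i}(f)\ge C\,\frac{\log n}{n}\,\mathrm{Var}_\mu(f)$; (2) (Talagrand's $L^1$–$L^2$) $\displaystyle C\,\mathrm{Var}_\mu(f)\le\sum_{i=1}^n\frac{\mathsf{Inf}_{\mu,i}(f)}{1+\log(1/\mathsf{Inf}_{\mu,i}(f))}$; (3) (Talagrand's variance–surface-area) $\displaystyle \mathsf{SA}_\mu(f)\ge C\,\mathrm{Var}_\mu(f)\sqrt{\log\left(\frac{e}{\mathrm{Var}_\mu(f)}\right)}$; (4) (Eldan–Gross) $\displaystyle \mathsf{SA}_\mu(f)\ge C\,\mathrm{Var}_\mu(f)\sqrt{\log\left(1+\frac{e}{\mathsf{SqInf}_\mu(f)}\right)}$.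
   Context: Notation: $[n]=\{1,\dots,n\}$; for $x\in\{\pm1\}^n$, $x^i$ is $x$ with its $i$-th coordinate flipped; $x_{-i}$ is $x$ with coordinate $i$ removed; $\log$ is the natural logarithm. For $f:\{\pm1\}^n\to\{\pm1\}$, the sensitivity is $s(f)(x)=\#\{i\in[n]: f(x^i)\ne f(x)\}$, and $\mathsf{Inf}_{\mu,i}(f)=\Pr_{x\sim\mu}[f(x^i)\neq f(x)]$, $\;\mathsf{SA}_\mu(f)=\mathbb{E}_\mu[\sqrt{s(f)}]$, $\;\mathsf{SqInf}_\mu(f)=\sum_{i=1}^n\mathsf{Inf}_{\mu,i}(f)^2$, $\;\mathrm{Var}_\mu(f)=\mathbb{E}_\mu[f^2]-(\mathbb{E}_\mu f)^2$. The Dobrushin influence matrix $R\in[0,1]^{n\times n}$ of $\mu$ is: $R_{ii}=0$ and, for $i\ne j$, $R_{ij}=\max_{x\in\{\pm1\}^n} d_{\mathrm{TV}}\big(\mu_i(\cdot\mid X_{-i}=x_{-i}),\,\mu_i(\cdot\mid X_{-i}=(x^j)_{-i})\big)$, where $X\sim\mu$ and $\mu_i(\cdot\mid X_{-i}=y)$ is the conditional law of $X_i$ given that all the other coordinates equal $y$. $\|\cdot\|_1$ is the induced $\ell^1$ operator norm (maximum absolute column sum), $\|\cdot\|_2$ the spectral norm. Conventions: a summand in (2) is $0$ if $\mathsf{Inf}_{\mu,i}(f)=0$; the right-hand sides of (3) and (4) are $0$ if $\mathrm{Var}_\mu(f)=0$. *)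

theory Defs
  imports "HOL-Probability.Probability"
begin

text \<open>Points of the cube are extensional functions on \<open>{1..n}\<close> with values \<open>\<plusminus>1\<close>, so that the
  dimension can be quantified over. A probability distribution fully supported on the cube is
  a \<open>pmf\<close> with \<open>set_pmf \<mu> = cube n\<close>, and a Boolean function is some \<open>f \<in> cube n \<rightarrow> {-1, 1}\<close>, whose
  values off the cube do not matter.\<close>

definition cube :: "nat \<Rightarrow> (nat \<Rightarrow> real) set" where
  "cube n = {1..n} \<rightarrow>\<^sub>E {-1, 1}"

definition flip :: "nat \<Rightarrow> (nat \<Rightarrow> real) \<Rightarrow> nat \<Rightarrow> real" where
  "flip i x = x(i := - x i)"

definition sensitivity :: "nat \<Rightarrow> ((nat \<Rightarrow> real) \<Rightarrow> real) \<Rightarrow> (nat \<Rightarrow> real) \<Rightarrow> nat" where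
  "sensitivity n f x = card {i \<in> {1..n}. f (flip i x) \<noteq> f x}"

definition Infl :: "(nat \<Rightarrow> real) pmf \<Rightarrow> nat \<Rightarrow> ((nat \<Rightarrow> real) \<Rightarrow> real) \<Rightarrow> real" where
  "Infl \<mu> i f = measure_pmf.prob \<mu> {x. f (flip i x) \<noteq> f x}"

definition SA :: "nat \<Rightarrow> (nat \<Rightarrow> real) pmf \<Rightarrow> ((nat \<Rightarrow> real) \<Rightarrow> real) \<Rightarrow> real" where
  "SA n \<mu> f = measure_pmf.expectation \<mu> (\<lambda>x. sqrt (real (sensitivity n f x)))"

definition SqInf :: "nat \<Rightarrow> (nat \<Rightarrow> real) pmf \<Rightarrow> ((nat \<Rightarrow> real) \<Rightarrow> real) \<Rightarrow> real" where
  "SqInf n \<mu> f = (\<Sum>i=1..n. (Infl \<mu> i f)\<^sup>2)"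

definition Vari :: "(nat \<Rightarrow> real) pmf \<Rightarrow> ((nat \<Rightarrow> real) \<Rightarrow> real) \<Rightarrow> real" where
  "Vari \<mu> f = measure_pmf.expectation \<mu> (\<lambda>x. (f x)\<^sup>2) - (measure_pmf.expectation \<mu> f)\<^sup>2"

definition d_TV :: "'a pmf \<Rightarrow> 'a pmf \<Rightarrow> real" where
  "d_TV p q = (SUP A. \<bar>measure_pmf.prob p A - measure_pmf.prob q A\<bar>)"

definition drop_coord :: "nat \<Rightarrow> nat \<Rightarrow> (nat \<Rightarrow> real) \<Rightarrow> nat \<Rightarrow> real" where
  "drop_coord n i x = restrict x ({1..n} - {i})"

text \<open>The conditional law of \<open>X\<^sub>i\<close> given \<open>X\<^sub>-\<^sub>i = y\<close>. It is meaningful only if the event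
  has positive probability, as it does for every \<open>y = drop_coord n i x\<close> with \<open>x \<in> cube n\<close> when \<open>\<mu>\<close>
  is fully supported.\<close>

definition cond_law :: "nat \<Rightarrow> (nat \<Rightarrow> real) pmf \<Rightarrow> nat \<Rightarrow> (nat \<Rightarrow> real) \<Rightarrow> real pmf" where
  "cond_law n \<mu> i y = map_pmf (\<lambda>z. z i) (cond_pmf \<mu> {z. drop_coord n i z = y})"

definition dobrushin :: "nat \<Rightarrow> (nat \<Rightarrow> real) pmf \<Rightarrow> nat \<Rightarrow> nat \<Rightarrow> real" where
  "dobrushin n \<mu> i j = (if i = j then 0 else
     (MAX x\<in>cube n. d_TV (cond_law n \<mu> i (drop_coord n i x))
                         (cond_law n \<mu> i (drop_coord n i (flip j x)))))"

text \<open>Norms of an \<open>n \<times> n\<close> matrix, given as a function of its row and column indices in \<open>{1..n}\<close>: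
  the operator norms induced by the \<open>\<ell>\<^sup>1\<close> and \<open>\<ell>\<^sup>2\<close> norms on vectors indexed by \<open>{1..n}\<close>.\<close>

definition mat_vec :: "nat \<Rightarrow> (nat \<Rightarrow> nat \<Rightarrow> real) \<Rightarrow> (nat \<Rightarrow> real) \<Rightarrow> nat \<Rightarrow> real" where
  "mat_vec n A v i = (\<Sum>j=1..n. A i j * v j)"

definition op_norm_1 :: "nat \<Rightarrow> (nat \<Rightarrow> nat \<Rightarrow> real) \<Rightarrow> real" where
  "op_norm_1 n A = (SUP v\<in>{v. (\<Sum>j=1..n. \<bar>v j\<bar>) \<le> 1}. \<Sum>i=1..n. \<bar>mat_vec n A v i\<bar>)"

definition op_norm_2 :: "nat \<Rightarrow> (nat \<Rightarrow> nat \<Rightarrow> real) \<Rightarrow> real" where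
  "op_norm_2 n A = (SUP v\<in>{v. L2_set v {1..n} \<le> 1}. L2_set (mat_vec n A v) {1..n})"

lemma op_norm_1_eq_max_column_sum:
  assumes "n \<ge> 1"
  shows "op_norm_1 n A = (MAX j\<in>{1..n}. \<Sum>i=1..n. \<bar>A i j\<bar>)"
proof -
  let ?c = "\<lambda>j. \<Sum>i=1..n. \<bar>A i j\<bar>"
  let ?M = "MAX j\<in>{1..n}. ?c j"
  let ?V = "{v::nat \<Rightarrow> real. (\<Sum>j=1..n. \<bar>v j\<bar>) \<le> 1}"
  have le: "(\<Sum>i=1..n. \<bar>mat_vec n A v i\<bar>) \<le> ?M" if v: "v \<in> ?V" for v
  proof -
    have M0: "0 \<le> ?M"
    proof -
      have "0 \<le> ?c 1" by (simp add: sum_nonneg)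
      also have "?c 1 \<le> ?M" using assms by (intro Max_ge) auto
      finally show ?thesis .
    qed
    have "(\<Sum>i=1..n. \<bar>mat_vec n A v i\<bar>) \<le> (\<Sum>i=1..n. \<Sum>j=1..n. \<bar>A i j\<bar> * \<bar>v j\<bar>)"
      unfolding mat_vec_def
      by (intro sum_mono order_trans[OF sum_abs]) (simp add: abs_mult)
    also have "\<dots> = (\<Sum>j=1..n. ?c j * \<bar>v j\<bar>)"
      by (subst sum.swap) (simp add: sum_distrib_right)
    also have "\<dots> \<le> (\<Sum>j=1..n. ?M * \<bar>v j\<bar>)"
      by (intro sum_mono mult_right_mono Max_ge) auto
    also have "\<dots> = ?M * (\<Sum>j=1..n. \<bar>v j\<bar>)"
      by (simp add: sum_distrib_left)
    also have "\<dots> \<le> ?M * 1"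
      using v M0 by (intro mult_left_mono) auto
    finally show ?thesis by simp
  qed
  have "?M \<in> ?c ` {1..n}"
    using assms by (intro Max_in) auto
  then obtain k where k: "k \<in> {1..n}" "?M = ?c k" by blast
  define e where "e = (\<lambda>j. if j = k then 1 else 0 :: real)"
  have abs_e: "\<bar>e j\<bar> = e j" for j by (simp add: e_def)
  have e: "e \<in> ?V"
    unfolding mem_Collect_eq abs_e using k by (simp add: e_def)
  have "mat_vec n A e i = A i k" for i
    using k by (simp add: mat_vec_def e_def if_distrib cong: if_cong)
  hence e_val: "(\<Sum>i=1..n. \<bar>mat_vec n A e i\<bar>) = ?M" using k by simp
  show ?thesis
    unfolding op_norm_1_def
  proof (rule cSup_eq_maximum)
    show "?M \<in> (\<lambda>v. \<Sum>i=1..n. \<bar>mat_vec n A v i\<bar>) ` ?V"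
      using e e_val by (metis (no_types, lifting) image_eqI)
  qed (use le in auto)
qed

end

theory Submission
  imports Defs
begin

text \<open>
  All four inequalities come from the Glauber dynamics of \<open>\<mu>\<close>, the process that flips the coordinate
  \<open>i\<close> of \<open>x\<close> at the rate \<open>c i x\<close> given by the conditional law of that coordinate. Let \<open>u t\<close> be its heat
  flow started from \<open>g\<close>, the centred version of the Boolean function \<open>f\<close>, and let \<open>corr t\<close> be the mean
  of \<open>g\<close> times \<open>u t\<close>; by reversibility this is the variance of \<open>u (t/2)\<close>. Three facts about the flow,
  with constants that depend only on \<open>b\<close> and \<open>\<delta>\<close>, carry the proof.

  The Poincare and logarithmic Sobolev inequalities (\<open>poincare\<close>, \<open>log_sobolev\<close>) hold by induction over
  subcubes. Splitting off one coordinate \<open>i\<close> costs a quadratic term in the covariance of the function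
  with \<open>x i\<close>. Averaged over the choice of \<open>i\<close>, the costs add up to a sum of squares of covariances,
  and Dobrushin's comparison argument in its \<open>\<ell>\<^sup>2\<close> form (\<open>cov_comparison\<close>) bounds this sum by local
  quantities, with the factor \<open>1/\<delta>\<^sup>2\<close>.

  The curvature of the dynamics is bounded from below (\<open>bochner\<close>), because the rate at \<open>i\<close> depends on the
  coordinate \<open>j\<close> by at most \<open>R i j\<close>. By the maximum principle, the flow started from a bounded function
  has a gradient of order \<open>1 / sqrt t\<close> in sup norm for \<open>t \<le> 1\<close> (\<open>gradient_bound\<close>).

  The components of the gradient solve the heat equation up to a source that is linear in the other
  components, with coefficients from \<open>R\<close>. So Gross's derivation of hypercontractivity from the
  logarithmic Sobolev inequality applies to the whole gradient at once
  (\<open>gradient_hypercontractivity\<close>): the sum of its squared \<open>L\<^sup>2\<close> norms at time \<open>t\<close> is at most a constant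
  times the sum of the squared \<open>L\<^sup>p\<close> norms at time \<open>0\<close>, for some \<open>p < 2\<close> that depends on \<open>t\<close>.

  For the surface area, the derivative of \<open>corr\<close> pairs the gradient of \<open>f\<close>, whose \<open>L\<^sup>1\<close> norm is twice the
  surface area, with the gradient of \<open>u t\<close>. Hence at most \<open>sqrt t\<close> times the surface area, up to a
  constant, is lost by a time \<open>t \<le> 1\<close> (\<open>corr_drop\<close>). On the other hand \<open>corr\<close> is log-convex, so if \<open>corr 1\<close> is
  at most \<open>exp (- l)\<close> times the variance with \<open>l \<ge> 1\<close>, then a fixed fraction of the variance is lost by
  a time of order \<open>1/l\<close>;
  together, \<open>surface\<close> is at least a multiple of \<open>var * sqrt l\<close> (\<open>surface_from_smoothing\<close>). It
  remains to bound \<open>corr 1\<close>: by a power of the variance larger than \<open>1\<close>, from hypercontractivity for \<open>u\<close>,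
  which gives Talagrand's inequality; and by a power of the sum of the squared influences, from
  hypercontractivity for the gradient, which together with Talagrand's inequality gives that of Eldan
  and Gross.

  The \<open>L\<^sup>1\<close>-\<open>L\<^sup>2\<close> inequality results from integrating hypercontractivity for the gradient over \<open>t\<close> in
  \<open>[0, 1]\<close>, a time in which the spectral gap dissipates a fixed fraction of the variance. The KKL
  inequality is a consequence.
\<close>

section \<open>Flips, subcubes and Glauber rates\<close>

definition grad :: "nat \<Rightarrow> ((nat \<Rightarrow> real) \<Rightarrow> real) \<Rightarrow> (nat \<Rightarrow> real) \<Rightarrow> real" where
  "grad i u x = u (flip i x) - u x"

text \<open>The rate at which heat-bath dynamics flips the coordinate \<open>i\<close> of \<open>x\<close>: the probability of the value
  \<open>- x i\<close> under the conditional law of that coordinate given the others.\<close>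
definition flip_rate :: "((nat \<Rightarrow> real) \<Rightarrow> real) \<Rightarrow> nat \<Rightarrow> (nat \<Rightarrow> real) \<Rightarrow> real" where
  "flip_rate m i x = m (flip i x) / (m x + m (flip i x))"

lemma finite_cube [simp]: "finite (cube n)"
  by (simp add: cube_def finite_PiE)

lemma cube_nonempty: "cube n \<noteq> {}"
  by (auto simp: cube_def PiE_eq_empty_iff)

lemma cube_value: "x \<in> cube n \<Longrightarrow> i \<in> {1..n} \<Longrightarrow> x i = 1 \<or> x i = -1"
  by (auto simp: cube_def PiE_def Pi_def)

lemma cube_eqI:
  assumes "x \<in> cube n" "y \<in> cube n" "\<And>i. i \<in> {1..n} \<Longrightarrow> x i = y i"
  shows "x = y"
  using assms unfolding cube_def by (rule PiE_ext)

lemma flip_in_cube [simp]: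
  assumes "x \<in> cube n" "i \<in> {1..n}" shows "flip i x \<in> cube n"
  using assms by (auto simp: cube_def flip_def PiE_def Pi_def extensional_def)

lemma flip_flip [simp]: "flip i (flip i x) = x"
  by (auto simp: flip_def)

lemma flip_commute: "flip i (flip j x) = flip j (flip i x)"
  by (auto simp: flip_def)

lemma flip_apply: "flip i x j = (if j = i then - x j else x j)"
  by (auto simp: flip_def)

lemma grad_flip: "grad i u (flip i x) = - grad i u x"
  by (simp add: grad_def)

lemma grad_grad_commute: "grad i (grad j u) x = grad j (grad i u) x"
  by (simp add: grad_def flip_commute)

lemma grad_grad_same: "grad i (grad i u) x = - 2 * grad i u x"
  by (simp add: grad_def)

text \<open>The coordinates in \<open>S\<close> are free, the others are pinned to those of \<open>x\<close>. Keeping the pinned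
  coordinates in the points means that a function and its gradients restrict to a subcube without
  any change.\<close>
definition subcube :: "nat \<Rightarrow> nat set \<Rightarrow> (nat \<Rightarrow> real) \<Rightarrow> (nat \<Rightarrow> real) set" where
  "subcube n S x = {y \<in> cube n. \<forall>i\<in>{1..n} - S. y i = x i}"

lemma finite_subcube [simp]: "finite (subcube n S x)"
  by (simp add: subcube_def)

lemma subcube_subset: "subcube n S x \<subseteq> cube n"
  by (auto simp: subcube_def)

lemma subcube_self: "x \<in> cube n \<Longrightarrow> x \<in> subcube n S x"
  by (simp add: subcube_def)

lemma subcube_empty: "x \<in> cube n \<Longrightarrow> subcube n {} x = {x}"
  by (auto simp: subcube_def intro: cube_eqI)

lemma subcube_full: "subcube n {1..n} x = cube n"
  by (auto simp: subcube_def)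

lemma flip_in_subcube: "y \<in> subcube n S x \<Longrightarrow> i \<in> S \<Longrightarrow> i \<in> {1..n} \<Longrightarrow> flip i y \<in> subcube n S x"
  by (auto simp: subcube_def flip_apply)

lemma sum_flip:
  assumes "\<And>y. y \<in> B \<Longrightarrow> flip i y \<in> B"
  shows "(\<Sum>y\<in>B. h (flip i y)) = (\<Sum>y\<in>B. h y)"
  by (rule sum.reindex_bij_witness[of _ "flip i" "flip i"]) (simp_all add: assms)

lemma sum_subcube_flip:
  assumes "i \<in> S" "i \<in> {1..n}"
  shows "(\<Sum>y\<in>subcube n S x. h (flip i y)) = (\<Sum>y\<in>subcube n S x. h y)"
  by (rule sum_flip) (rule flip_in_subcube[OF _ assms])

text \<open>The half of a subcube on which the free coordinate \<open>i\<close> has the value \<open>s\<close>.\<close>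
definition face :: "nat \<Rightarrow> nat set \<Rightarrow> (nat \<Rightarrow> real) \<Rightarrow> nat \<Rightarrow> real \<Rightarrow> (nat \<Rightarrow> real) set" where
  "face n S x i s = subcube n (S - {i}) (x(i := s))"

lemma face_eq:
  assumes "i \<in> S" "i \<in> {1..n}"
  shows "face n S x i s = {y \<in> subcube n S x. y i = s}"
proof -
  have "(\<forall>j\<in>{1..n} - (S - {i}). y j = (x(i := s)) j) \<longleftrightarrow> (\<forall>j\<in>{1..n} - S. y j = x j) \<and> y i = s" for y
  proof -
    have "{1..n} - (S - {i}) = insert i ({1..n} - S)" "i \<notin> {1..n} - S"
      using assms by blast+
    then show ?thesis by auto
  qed
  then show ?thesis unfolding face_def subcube_def by blast
qed

lemma subcube_split:
  assumes "i \<in> S" "i \<in> {1..n}"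
  shows "subcube n S x = face n S x i 1 \<union> face n S x i (-1)" 
    and "face n S x i 1 \<inter> face n S x i (-1) = {}"
proof -
  have "y i = 1 \<or> y i = -1" if "y \<in> subcube n S x" for y
    using that assms(2) cube_value[of y n i] by (simp add: subcube_def)
  then show "subcube n S x = face n S x i 1 \<union> face n S x i (-1)"
    unfolding face_eq[OF assms] by blast
  show "face n S x i 1 \<inter> face n S x i (-1) = {}"
    unfolding face_eq[OF assms] by force
qed

lemma sum_subcube_split:
  assumes "i \<in> S" "i \<in> {1..n}"
  shows "(\<Sum>y\<in>subcube n S x. h y) = (\<Sum>y\<in>face n S x i 1. h y) + (\<Sum>y\<in>face n S x i (-1). h (y::nat\<Rightarrow>real) :: real)"
  unfolding subcube_split(1)[OF assms]
  by (rule sum.union_disjoint) (use subcube_split(2)[OF assms] in \<open>auto simp: face_def\<close>)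

lemma sum_face_flip:
  assumes "i \<in> S" "i \<in> {1..n}"
  shows "(\<Sum>y\<in>face n S x i (-s). h (flip i y)) = (\<Sum>y\<in>face n S x i s. h (y::nat\<Rightarrow>real) :: real)"
proof -
  have "flip i y \<in> face n S x i (-s)" if "y \<in> face n S x i s" for y s
    using that flip_in_subcube[OF _ assms, of y x] by (simp add: face_eq[OF assms] flip_apply)
  from this[of _ s] this[of _ "-s"] show ?thesis
    by (intro sum.reindex_bij_witness[of _ "flip i" "flip i"]) simp_all
qed

text \<open>What the analytic part of the proof knows about the measure \<open>m\<close>: flip rates in
  \<open>[\<beta>, 1 - \<beta>]\<close>, and a matrix \<open>R\<close> of \<open>\<ell>\<^sup>2\<close> operator norm at most \<open>1 - \<delta>\<close> whose entry \<open>R i j\<close>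
  bounds the change of the rate at \<open>i\<close> caused by a flip of \<open>j\<close>.\<close>
locale weakly_dependent =
  fixes n :: nat and m :: "(nat \<Rightarrow> real) \<Rightarrow> real" and R :: "nat \<Rightarrow> nat \<Rightarrow> real" and \<beta> \<delta> :: real
  assumes n_pos: "1 \<le> n"
    and m_pos: "x \<in> cube n \<Longrightarrow> 0 < m x"
    and m_sum: "(\<Sum>x\<in>cube n. m x) = 1"
    and \<beta>_pos: "0 < \<beta>"
    and \<delta>_pos: "0 < \<delta>"
    and \<delta>_less: "\<delta> < 1"
    and m_ge: "i \<in> {1..n} \<Longrightarrow> x \<in> cube n \<Longrightarrow> \<beta> * (m x + m (flip i x)) \<le> m x"
    and R_nonneg: "0 \<le> R i j"
    and R_diag: "R i i = 0"
    and R_rate: "i \<in> {1..n} \<Longrightarrow> j \<in> {1..n} \<Longrightarrow> i \<noteq> j \<Longrightarrow> x \<in> cube n \<Longrightarrow>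
      \<bar>grad j (flip_rate m i) x\<bar> \<le> R i j"
    and R_norm: "(\<Sum>i=1..n. (\<Sum>j=1..n. R i j * v j)\<^sup>2) \<le> (1 - \<delta>)\<^sup>2 * (\<Sum>j=1..n. (v j)\<^sup>2)"
begin

abbreviation "c \<equiv> flip_rate m"

lemma m_nonneg: "x \<in> cube n \<Longrightarrow> 0 \<le> m x"
  using m_pos[of x] by simp

lemma pair_pos: "x \<in> cube n \<Longrightarrow> i \<in> {1..n} \<Longrightarrow> 0 < m x + m (flip i x)"
  using m_pos[of x] m_pos[of "flip i x"] by simp

lemma rate_flip:
  assumes "x \<in> cube n" "i \<in> {1..n}" shows "c i (flip i x) = 1 - c i x"
  using pair_pos[OF assms] by (simp add: flip_rate_def field_simps)

lemma rate_ge: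
  assumes "x \<in> cube n" "i \<in> {1..n}" shows "\<beta> \<le> c i x"
  using m_ge[of i "flip i x"] assms pair_pos[OF assms]
  by (simp add: flip_rate_def field_simps)

lemma rate_le: "x \<in> cube n \<Longrightarrow> i \<in> {1..n} \<Longrightarrow> c i x \<le> 1 - \<beta>"
  using rate_ge[of "flip i x" i] rate_flip[of x i] by simp

lemma rate_pos: "x \<in> cube n \<Longrightarrow> i \<in> {1..n} \<Longrightarrow> 0 < c i x"
  using rate_ge \<beta>_pos by force

lemma rate_less_1: "x \<in> cube n \<Longrightarrow> i \<in> {1..n} \<Longrightarrow> c i x < 1"
  using rate_le \<beta>_pos by force

lemma \<beta>_le_half: "\<beta> \<le> 1/2"
proof -
  obtain x where "x \<in> cube n" using cube_nonempty by blast
  then show ?thesis using rate_ge[of x 1] rate_le[of x 1] n_pos by simp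
qed

text \<open>Detailed balance: the conductance \<open>m x * c i x\<close> of the edge between \<open>x\<close> and \<open>flip i x\<close>
  does not depend on the end point.\<close>
lemma reversible: "x \<in> cube n \<Longrightarrow> i \<in> {1..n} \<Longrightarrow> m (flip i x) * c i (flip i x) = m x * c i x"
  by (simp add: flip_rate_def add.commute mult.commute)

lemma m_flip_le: "x \<in> cube n \<Longrightarrow> i \<in> {1..n} \<Longrightarrow> m (flip i x) \<le> (1/\<beta>) * m x"
proof -
  assume a: "x \<in> cube n" "i \<in> {1..n}"
  have "\<beta> * m (flip i x) \<le> \<beta> * (m x + m (flip i x))"
    using a m_pos[of x] \<beta>_pos by simp
  also have "\<dots> \<le> m x" using m_ge a by simp
  finally show ?thesis using \<beta>_pos by (simp add: field_simps)
qed

text \<open>Resampling the coordinate \<open>i\<close> from its conditional law, that is, averaging out \<open>i\<close>.\<close>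
definition resample :: "nat \<Rightarrow> ((nat \<Rightarrow> real) \<Rightarrow> real) \<Rightarrow> (nat \<Rightarrow> real) \<Rightarrow> real" where
  "resample i h x = h x + c i x * grad i h x"

lemma grad_resample_same:
  assumes "x \<in> cube n" "i \<in> {1..n}" shows "grad i (resample i h) x = 0"
  unfolding resample_def grad_def rate_flip[OF assms] flip_flip by algebra

text \<open>Averaging out \<open>i\<close> spreads the dependence of \<open>h\<close> on \<open>i\<close> to the coordinates \<open>j\<close> that influence \<open>i\<close>;
  the last term measures this.\<close>
lemma grad_resample:
  "grad j (resample i h) x = (1 - c i x) * grad j h x + c i x * grad j h (flip i x)
     + grad j (c i) x * grad i h (flip j x)"
  unfolding resample_def grad_def flip_commute[of i j x] by algebra

text \<open>Summation by parts: the conductance is symmetric and the gradient of \<open>h\<close> antisymmetric under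
  the flip.\<close>
lemma edge_sum:
  assumes "i \<in> S" "i \<in> {1..n}" "S \<subseteq> {1..n}"
  shows "(\<Sum>y\<in>subcube n S x. m y * c i y * (F y * grad i h y))
       = - (1/2) * (\<Sum>y\<in>subcube n S x. m y * c i y * (grad i F y * grad i h y))"
proof -
  have "(\<Sum>y\<in>subcube n S x. m y * c i y * (F y * grad i h y))
      = (\<Sum>y\<in>subcube n S x. m (flip i y) * c i (flip i y) * (F (flip i y) * grad i h (flip i y)))"
    using sum_subcube_flip[OF assms(1,2), of "\<lambda>y. m y * c i y * (F y * grad i h y)" x] by simp
  also have "\<dots> = (\<Sum>y\<in>subcube n S x. - (m y * c i y * (F (flip i y) * grad i h y)))"
  proof (rule sum.cong[OF refl])
    fix y assume "y \<in> subcube n S x"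
    then have "y \<in> cube n" using subcube_subset by blast
    then show "m (flip i y) * c i (flip i y) * (F (flip i y) * grad i h (flip i y))
      = - (m y * c i y * (F (flip i y) * grad i h y))"
      unfolding reversible[OF \<open>y \<in> cube n\<close> assms(2)] grad_flip by simp
  qed
  finally have eq: "(\<Sum>y\<in>subcube n S x. m y * c i y * (F y * grad i h y))
    = - (\<Sum>y\<in>subcube n S x. m y * c i y * (F (flip i y) * grad i h y))" by (simp add: sum_negf)
  have "(\<Sum>y\<in>subcube n S x. m y * c i y * (grad i F y * grad i h y))
    = (\<Sum>y\<in>subcube n S x. m y * c i y * (F (flip i y) * grad i h y))
     - (\<Sum>y\<in>subcube n S x. m y * c i y * (F y * grad i h y))"
    unfolding sum_subtractf[symmetric]
    by (intro sum.cong refl) (simp add: grad_def algebra_simps)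
  then show ?thesis using eq by simp
qed

end

section \<open>Dobrushin comparison for covariances\<close>

lemma weighted_Cauchy_Schwarz:
  fixes p a b :: "'a \<Rightarrow> real"
  assumes "\<And>y. y \<in> B \<Longrightarrow> 0 \<le> p y"
  shows "(\<Sum>y\<in>B. p y * (a y * b y))\<^sup>2 \<le> (\<Sum>y\<in>B. p y * (a y)\<^sup>2) * (\<Sum>y\<in>B. p y * (b y)\<^sup>2)"
proof -
  have e1: "(\<Sum>y\<in>B. p y * (a y * b y)) = (\<Sum>y\<in>B. (sqrt (p y) * a y) * (sqrt (p y) * b y))"
    by (intro sum.cong refl) (simp add: assms algebra_simps flip: power2_eq_square)
  have e2: "(\<Sum>y\<in>B. p y * (h y)\<^sup>2) = (\<Sum>y\<in>B. (sqrt (p y) * h y)\<^sup>2)" for h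
    by (intro sum.cong refl) (simp add: assms power_mult_distrib)
  show ?thesis unfolding e1 e2 by (rule Cauchy_Schwarz_ineq_sum)
qed

context weakly_dependent
begin

text \<open>The covariance on a subcube, with respect to the unnormalized restriction of \<open>m\<close>. Without
  normalization, edge sums over a subcube are the sums of those over its two faces, which makes the
  later induction over subcubes exact.\<close>
definition cov :: "nat set \<Rightarrow> (nat \<Rightarrow> real) \<Rightarrow> ((nat \<Rightarrow> real) \<Rightarrow> real) \<Rightarrow> ((nat \<Rightarrow> real) \<Rightarrow> real) \<Rightarrow> real" where
  "cov S x F h = (\<Sum>y\<in>subcube n S x. m y * (F y * h y))
     - (\<Sum>y\<in>subcube n S x. m y * F y) * (\<Sum>y\<in>subcube n S x. m y * h y) / (\<Sum>y\<in>subcube n S x. m y)"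

text \<open>The discrepancy that \<open>F\<close> creates at the coordinate \<open>j\<close>: for a density \<open>F\<close>, the mean under
  \<open>F m\<close> of the total variation distance between the conditional laws at \<open>j\<close> of \<open>F m\<close> and of \<open>m\<close>.\<close>
definition edge_var :: "nat set \<Rightarrow> (nat \<Rightarrow> real) \<Rightarrow> ((nat \<Rightarrow> real) \<Rightarrow> real) \<Rightarrow> nat \<Rightarrow> real" where
  "edge_var S x F j = (1/2) * (\<Sum>y\<in>subcube n S x. m y * c j y * \<bar>grad j F y\<bar>)"

text \<open>Dobrushin's notion of an estimate: covariances with \<open>F\<close> are controlled by the oscillations
  \<open>d j\<close> of the other function along the coordinates, with weights \<open>w j\<close>.\<close>
definition cov_estimate ::
  "nat set \<Rightarrow> (nat \<Rightarrow> real) \<Rightarrow> ((nat \<Rightarrow> real) \<Rightarrow> real) \<Rightarrow> (nat \<Rightarrow> real) \<Rightarrow> bool" where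
  "cov_estimate S x F w \<longleftrightarrow> (\<forall>h d. (\<forall>j\<in>S. \<forall>y\<in>subcube n S x. \<bar>grad j h y\<bar> \<le> d j) \<longrightarrow>
     \<bar>cov S x F h\<bar> \<le> (\<Sum>j\<in>S. w j * d j))"

lemma subcube_mass_pos: "x \<in> cube n \<Longrightarrow> 0 < (\<Sum>y\<in>subcube n S x. m y)"
  by (rule sum_pos) (use subcube_self subcube_subset m_pos in fastforce)+

lemma mass_resample:
  assumes "i \<in> S" "S \<subseteq> {1..n}"
  shows "(\<Sum>y\<in>subcube n S x. m y * resample i h y) = (\<Sum>y\<in>subcube n S x. m y * h y)"
proof -
  have "(\<Sum>y\<in>subcube n S x. m y * c i y * (1 * grad i h y)) = 0"
    using edge_sum[where i=i and S=S and F="\<lambda>_. 1" and h=h and x=x] assms by (auto simp: grad_def)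
  then show ?thesis by (simp add: resample_def algebra_simps sum.distrib)
qed

text \<open>Resampling keeps the integral, and changes the covariance by a term supported on the edges in
  direction \<open>i\<close>.\<close>
lemma cov_resample_le:
  assumes "i \<in> S" "S \<subseteq> {1..n}" and d: "\<And>y. y \<in> subcube n S x \<Longrightarrow> \<bar>grad i h y\<bar> \<le> d"
  shows "\<bar>cov S x F h\<bar> \<le> \<bar>cov S x F (resample i h)\<bar> + edge_var S x F i * d"
proof -
  let ?B = "subcube n S x"
  let ?E = "\<Sum>y\<in>?B. m y * c i y * (F y * grad i h y)"
  have i: "i \<in> {1..n}" using assms by auto
  have "(\<Sum>y\<in>?B. m y * (F y * resample i h y)) = (\<Sum>y\<in>?B. m y * (F y * h y)) + ?E"
    unfolding sum.distrib[symmetric]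
    by (intro sum.cong refl) (simp add: resample_def algebra_simps)
  then have "cov S x F (resample i h) = cov S x F h + ?E"
    using mass_resample[OF assms(1,2), where x=x and h=h] by (simp add: cov_def)
  moreover have "\<bar>?E\<bar> \<le> edge_var S x F i * d"
  proof -
    have "\<bar>?E\<bar> = (1/2) * \<bar>\<Sum>y\<in>?B. m y * c i y * (grad i F y * grad i h y)\<bar>"
      using edge_sum[OF assms(1) i assms(2), where F=F and h=h and x=x] by simp
    also have "\<dots> \<le> (1/2) * (\<Sum>y\<in>?B. m y * c i y * \<bar>grad i F y\<bar> * d)"
    proof (intro mult_left_mono order_trans[OF sum_abs] sum_mono)
      fix y assume y: "y \<in> ?B"
      then have y': "y \<in> cube n" using subcube_subset by blast
      have "\<bar>m y * c i y * (grad i F y * grad i h y)\<bar> = m y * c i y * \<bar>grad i F y\<bar> * \<bar>grad i h y\<bar>"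
        using m_pos[OF y'] rate_pos[OF y' i] by (simp add: abs_mult)
      also have "\<dots> \<le> m y * c i y * \<bar>grad i F y\<bar> * d"
        using m_pos[OF y'] rate_pos[OF y' i] d[OF y] by (intro mult_left_mono) auto
      finally show "\<bar>m y * c i y * (grad i F y * grad i h y)\<bar> \<le> m y * c i y * \<bar>grad i F y\<bar> * d" .
    qed auto
    also have "\<dots> = edge_var S x F i * d"
      by (simp add: edge_var_def sum_distrib_right)
    finally show ?thesis .
  qed
  ultimately show ?thesis by linarith
qed

lemma grad_resample_le:
  assumes ij: "i \<in> {1..n}" "j \<in> {1..n}" "i \<noteq> j" and y: "y \<in> cube n"
    and d: "\<bar>grad j h y\<bar> \<le> dj" "\<bar>grad j h (flip i y)\<bar> \<le> dj" "\<bar>grad i h (flip j y)\<bar> \<le> di"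
  shows "\<bar>grad j (resample i h) y\<bar> \<le> dj + R i j * di"
proof -
  have c: "0 < c i y" "c i y < 1" using y ij rate_pos rate_less_1 by auto
  have "\<bar>grad j (resample i h) y\<bar> \<le> (1 - c i y) * \<bar>grad j h y\<bar> + c i y * \<bar>grad j h (flip i y)\<bar>
      + \<bar>grad j (c i) y\<bar> * \<bar>grad i h (flip j y)\<bar>"
    unfolding grad_resample using c
    by (intro order_trans[OF abs_triangle_ineq] add_mono) (auto simp: abs_mult)
  also have "\<dots> \<le> (1 - c i y) * dj + c i y * dj + R i j * di"
    using c d R_rate[OF ij y] R_nonneg[of i j] by (intro add_mono mult_left_mono mult_mono) auto
  finally show ?thesis by (simp add: algebra_simps)
qed

text \<open>One step of Dobrushin's comparison argument: resampling the coordinate \<open>i\<close> replaces the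
  entry \<open>w i\<close> of an estimate by the local discrepancy at \<open>i\<close> plus what the other entries transmit
  to \<open>i\<close> through \<open>R\<close>.\<close>
lemma cov_estimate_step:
  assumes S: "S \<subseteq> {1..n}" "i \<in> S" and w: "cov_estimate S x F w"
  shows "cov_estimate S x F (w(i := edge_var S x F i + (\<Sum>j\<in>S. R i j * w j)))"
  unfolding cov_estimate_def
proof (intro allI impI)
  fix h d assume d: "\<forall>j\<in>S. \<forall>y\<in>subcube n S x. \<bar>grad j h y\<bar> \<le> d j"
  have fin: "finite S" using S finite_subset by auto
  define d' where "d' j = (if j = i then 0 else d j + R i j * d i)" for j
  have "\<bar>grad j (resample i h) y\<bar> \<le> d' j" if j: "j \<in> S" and y: "y \<in> subcube n S x" for j y
  proof -
    have y': "y \<in> cube n" using y subcube_subset by blast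
    have fl: "flip i y \<in> subcube n S x" "flip j y \<in> subcube n S x"
      using flip_in_subcube[OF y] S j by auto
    show ?thesis
    proof (cases "j = i")
      case True then show ?thesis using grad_resample_same[OF y'] S by (auto simp: d'_def)
    next
      case False then show ?thesis unfolding d'_def
        using grad_resample_le[of i j y h "d j" "d i"] subsetD[OF S(1) S(2)] subsetD[OF S(1) j] S(2) j y y' d fl
        by (simp del: atLeastAtMost_iff)
    qed
  qed
  then have "\<bar>cov S x F (resample i h)\<bar> \<le> (\<Sum>j\<in>S. w j * d' j)"
    using w unfolding cov_estimate_def by blast
  also have "\<dots> = (\<Sum>j\<in>S-{i}. w j * d' j)"
    using S by (subst sum.remove[OF fin, of i]) (auto simp: d'_def)
  also have "\<dots> = (\<Sum>j\<in>S-{i}. w j * d j) + (\<Sum>j\<in>S-{i}. R i j * w j) * d i"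
    unfolding sum_distrib_right sum.distrib[symmetric]
    by (intro sum.cong refl) (auto simp: d'_def algebra_simps)
  also have "(\<Sum>j\<in>S-{i}. R i j * w j) = (\<Sum>j\<in>S. R i j * w j)"
    using S by (subst sum.remove[OF fin, of i]) (auto simp: R_diag)
  finally have "\<bar>cov S x F h\<bar> \<le> (\<Sum>j\<in>S-{i}. w j * d j) + (\<Sum>j\<in>S. R i j * w j) * d i + edge_var S x F i * d i"
    using cov_resample_le[of i S x h "d i" F] S d by force
  also have "\<dots> = (\<Sum>j\<in>S. (w(i := edge_var S x F i + (\<Sum>j\<in>S. R i j * w j))) j * d j)"
    using S by (subst sum.remove[OF fin, of i]) (auto simp: algebra_simps)
  finally show "\<bar>cov S x F h\<bar> \<le> (\<Sum>j\<in>S. (w(i := edge_var S x F i + (\<Sum>j\<in>S. R i j * w j))) j * d j)" .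
qed

text \<open>Averaging the step over all coordinates gives an affine map \<open>w \<mapsto> (1 - 1/s) w + (a + R w)/s\<close>,
  with \<open>s = card S\<close> and \<open>a = edge_var\<close>, whose linear part has \<open>\<ell>\<^sup>2\<close> norm at most
  \<open>1 - \<delta>/s\<close>.\<close>
lemma cov_estimate_average:
  assumes S: "S \<subseteq> {1..n}" "S \<noteq> {}" and w: "cov_estimate S x F w"
  shows "cov_estimate S x F (\<lambda>j. (1 - 1 / card S) * w j
     + (1 / card S) * (edge_var S x F j + (\<Sum>k\<in>S. R j k * w k)))"
  unfolding cov_estimate_def
proof (intro allI impI)
  fix h d assume d: "\<forall>j\<in>S. \<forall>y\<in>subcube n S x. \<bar>grad j h y\<bar> \<le> d j"
  have fin: "finite S" using S finite_subset by auto
  define s where "s = real (card S)"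
  have s: "s > 0" using S fin by (simp add: s_def card_gt_0_iff)
  define T where "T j = edge_var S x F j + (\<Sum>k\<in>S. R j k * w k)" for j
  have "\<bar>cov S x F h\<bar> \<le> (\<Sum>j\<in>S. (w(i := T i)) j * d j)" if "i \<in> S" for i
    using cov_estimate_step[OF S(1) that w] d unfolding cov_estimate_def T_def by blast
  then have "(\<Sum>i\<in>S. \<bar>cov S x F h\<bar>) \<le> (\<Sum>i\<in>S. \<Sum>j\<in>S. (w(i := T i)) j * d j)"
    by (rule sum_mono)
  also have "\<dots> = (\<Sum>i\<in>S. (\<Sum>j\<in>S. w j * d j) + (T i - w i) * d i)"
  proof (rule sum.cong[OF refl])
    fix i assume i: "i \<in> S"
    have "(\<Sum>j\<in>S-{i}. (w(i := T i)) j * d j) = (\<Sum>j\<in>S-{i}. w j * d j)"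
      by (rule sum.cong) auto
    then show "(\<Sum>j\<in>S. (w(i := T i)) j * d j) = (\<Sum>j\<in>S. w j * d j) + (T i - w i) * d i"
      using sum.remove[OF fin i, of "\<lambda>j. (w(i := T i)) j * d j"] sum.remove[OF fin i, of "\<lambda>j. w j * d j"]
      by (simp add: algebra_simps)
  qed
  also have "\<dots> = s * (\<Sum>j\<in>S. w j * d j) + (\<Sum>i\<in>S. (T i - w i) * d i)"
    by (simp add: sum.distrib s_def)
  also have "\<dots> = s * (\<Sum>j\<in>S. ((1 - 1 / s) * w j + (1 / s) * T j) * d j)"
    unfolding sum_distrib_left sum.distrib[symmetric]
    using s by (intro sum.cong refl) (simp add: field_simps)
  finally show "\<bar>cov S x F h\<bar> \<le> (\<Sum>j\<in>S. ((1 - 1 / card S) * w j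
     + (1 / card S) * (edge_var S x F j + (\<Sum>k\<in>S. R j k * w k))) * d j)"
    using s unfolding T_def s_def by simp
qed

text \<open>Walk from \<open>z\<close> to \<open>y\<close>, flipping one coordinate at a time.\<close>
lemma subcube_oscillation:
  assumes S: "S \<subseteq> {1..n}" and d: "\<forall>j\<in>S. \<forall>y\<in>subcube n S x. \<bar>grad j h y\<bar> \<le> d j"
    and yz: "y \<in> subcube n S x" "z \<in> subcube n S x"
  shows "\<bar>h y - h z\<bar> \<le> (\<Sum>j\<in>S. d j)"
proof -
  have fin: "finite S" using S finite_subset by auto
  have "\<bar>h y - h z\<bar> \<le> (\<Sum>j\<in>T. d j)"
    if "finite T" "T \<subseteq> S" "y \<in> subcube n S x" "{j\<in>S. y j \<noteq> z j} \<subseteq> T" for T y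
    using that
  proof (induction T arbitrary: y rule: finite_induct)
    case empty
    have "y = z"
    proof (rule cube_eqI[of _ n])
      fix i assume "i \<in> {1..n}"
      then show "y i = z i" using empty yz(2) by (cases "i \<in> S") (auto simp: subcube_def)
    qed (use empty yz in \<open>auto simp: subcube_def\<close>)
    then show ?case by simp
  next
    case (insert j T)
    have j: "j \<in> S" "j \<in> {1..n}" using insert.prems S by auto
    have d0: "0 \<le> d j" using d j insert.prems(2) abs_ge_zero order_trans by blast
    show ?case
    proof (cases "y j = z j")
      case True
      then have "\<bar>h y - h z\<bar> \<le> (\<Sum>j\<in>T. d j)" using insert by auto
      then show ?thesis using insert d0 by simp
    next
      case False
      let ?y = "flip j y"
      have y': "?y \<in> subcube n S x" using flip_in_subcube insert.prems j by blast
      have eq: "?y j = z j"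
        using False cube_value[of y n j] cube_value[of z n j] insert.prems(2) yz(2) j
        by (auto simp: flip_apply subcube_def)
      have "{k\<in>S. ?y k \<noteq> z k} \<subseteq> T"
        using insert.prems(3) eq by (auto simp: flip_apply split: if_splits)
      then have "\<bar>h ?y - h z\<bar> \<le> (\<Sum>j\<in>T. d j)" using insert y' by auto
      moreover have "\<bar>h ?y - h y\<bar> \<le> d j" using d j insert.prems(2) by (simp add: grad_def)
      ultimately show ?thesis using insert(1,2) by simp
    qed
  qed
  from this[OF fin order_refl yz(1)] show ?thesis by auto
qed

text \<open>Some crude estimate exists, which starts the iteration.\<close>
lemma cov_estimate_initial:
  assumes S: "S \<subseteq> {1..n}" and x: "x \<in> cube n"
  shows "cov_estimate S x F (\<lambda>_. 2 * (\<Sum>y\<in>subcube n S x. m y * \<bar>F y\<bar>))"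
  unfolding cov_estimate_def
proof (intro allI impI)
  fix h d assume d: "\<forall>j\<in>S. \<forall>y\<in>subcube n S x. \<bar>grad j h y\<bar> \<le> d j"
  let ?B = "subcube n S x"
  let ?M = "\<Sum>y\<in>?B. m y" and ?N = "\<Sum>y\<in>?B. m y * \<bar>F y\<bar>" and ?D = "\<Sum>j\<in>S. d j"
  have M: "?M > 0" using subcube_mass_pos x by simp
  have m0: "0 \<le> m y" if "y \<in> ?B" for y using m_nonneg subcube_subset that by blast
  define g where "g y = h y - h x" for y
  have g: "\<bar>g y\<bar> \<le> ?D" if "y \<in> ?B" for y
    using subcube_oscillation[OF S d that subcube_self[OF x]] by (simp add: g_def)
  have D: "0 \<le> ?D" using g[OF subcube_self[OF x]] by auto
  have shift: "cov S x F h = cov S x F g"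
  proof -
    have e1: "(\<Sum>y\<in>?B. m y * (F y * g y)) = (\<Sum>y\<in>?B. m y * (F y * h y)) - (\<Sum>y\<in>?B. m y * F y) * h x"
      unfolding sum_distrib_right sum_subtractf[symmetric]
      by (intro sum.cong refl) (simp add: g_def algebra_simps)
    have e2: "(\<Sum>y\<in>?B. m y * g y) = (\<Sum>y\<in>?B. m y * h y) - ?M * h x"
      unfolding sum_distrib_right sum_subtractf[symmetric]
      by (intro sum.cong refl) (simp add: g_def algebra_simps)
    show ?thesis unfolding cov_def e1 e2 using M by (simp add: field_simps)
  qed
  have "\<bar>cov S x F g\<bar> \<le> \<bar>\<Sum>y\<in>?B. m y * (F y * g y)\<bar> + \<bar>\<Sum>y\<in>?B. m y * F y\<bar> * \<bar>\<Sum>y\<in>?B. m y * g y\<bar> / ?M"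
    unfolding cov_def using M by (intro order_trans[OF abs_triangle_ineq4]) (simp add: abs_mult)
  also have "\<dots> \<le> ?N * ?D + ?N * (?M * ?D) / ?M"
  proof (intro add_mono divide_right_mono mult_mono)
    show "\<bar>\<Sum>y\<in>?B. m y * (F y * g y)\<bar> \<le> ?N * ?D"
      unfolding sum_distrib_right
    proof (intro order_trans[OF sum_abs] sum_mono)
      fix y assume y: "y \<in> ?B"
      show "\<bar>m y * (F y * g y)\<bar> \<le> m y * \<bar>F y\<bar> * ?D"
        using mult_left_mono[OF g[OF y], of "m y * \<bar>F y\<bar>"] m0[OF y] by (simp add: abs_mult mult.assoc)
    qed
    show "\<bar>\<Sum>y\<in>?B. m y * F y\<bar> \<le> ?N"
      by (intro order_trans[OF sum_abs] sum_mono) (simp add: abs_mult m0)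
    show "\<bar>\<Sum>y\<in>?B. m y * g y\<bar> \<le> ?M * ?D"
      unfolding sum_distrib_right
      by (intro order_trans[OF sum_abs] sum_mono) (simp add: abs_mult m0 g mult_left_mono)
    show "0 \<le> ?N" by (intro sum_nonneg mult_nonneg_nonneg m0) auto
  qed (use M in auto)
  also have "\<dots> = (\<Sum>j\<in>S. 2 * ?N * d j)"
    using M by (simp add: sum_distrib_left[symmetric])
  finally show "\<bar>cov S x F h\<bar> \<le> (\<Sum>j\<in>S. 2 * ?N * d j)" unfolding shift .
qed

lemma R_L2_set:
  assumes "S \<subseteq> {1..n}"
  shows "L2_set (\<lambda>j. \<Sum>k\<in>S. R j k * w k) S \<le> (1 - \<delta>) * L2_set w S"
proof -
  define v where "v k = (if k \<in> S then w k else 0)" for k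
  have fin: "finite S" using assms finite_subset by auto
  have Rv: "(\<Sum>k=1..n. R j k * v k) = (\<Sum>k\<in>S. R j k * w k)" for j
    using assms by (intro sum.mono_neutral_cong_right) (auto simp: v_def)
  have vv: "(\<Sum>k=1..n. (v k)\<^sup>2) = (\<Sum>k\<in>S. (w k)\<^sup>2)"
    using assms by (intro sum.mono_neutral_cong_right) (auto simp: v_def)
  have "(\<Sum>j\<in>S. (\<Sum>k\<in>S. R j k * w k)\<^sup>2) \<le> (\<Sum>j=1..n. (\<Sum>k\<in>S. R j k * w k)\<^sup>2)"
    using assms by (intro sum_mono2) auto
  also have "\<dots> \<le> (1 - \<delta>)\<^sup>2 * (\<Sum>k\<in>S. (w k)\<^sup>2)"
    using R_norm[of v] unfolding Rv vv .
  finally have "L2_set (\<lambda>j. \<Sum>k\<in>S. R j k * w k) S \<le> sqrt ((1 - \<delta>)\<^sup>2 * (\<Sum>k\<in>S. (w k)\<^sup>2))"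
    unfolding L2_set_def by (rule real_sqrt_le_mono)
  then show ?thesis using \<delta>_less by (simp add: real_sqrt_mult L2_set_def)
qed

definition up :: "nat \<Rightarrow> (nat \<Rightarrow> real) \<Rightarrow> real" where
  "up i y = (if y i = 1 then 1 else 0)"

lemma grad_up: "y \<in> cube n \<Longrightarrow> i \<in> {1..n} \<Longrightarrow> \<bar>grad j (up i) y\<bar> \<le> (if j = i then 1 else 0)"
  using cube_value[of y n i] by (auto simp: grad_def up_def flip_apply)

text \<open>The iterated estimates have norm at most that of the solution of \<open>w = a + R w\<close>, which is at most
  the norm of \<open>a\<close> over \<open>\<delta>\<close>, up to an error that tends to \<open>0\<close>. Testing them against the indicators
  \<open>up i\<close>, each of which oscillates in one direction only, bounds all the one-point marginals at once.\<close>
lemma cov_comparison: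
  assumes S: "S \<subseteq> {1..n}" and x: "x \<in> cube n"
  shows "(\<Sum>i\<in>S. (cov S x F (up i))\<^sup>2) \<le> (1/\<delta>\<^sup>2) * (\<Sum>j\<in>S. (edge_var S x F j)\<^sup>2)"
proof (cases "S = {}")
  case False
  have fin: "finite S" using S finite_subset by auto
  define s where "s = real (card S)"
  have s: "s \<ge> 1" using False fin by (simp add: s_def Suc_le_eq card_gt_0_iff)
  define a where "a = edge_var S x F"
  define step where "step w = (\<lambda>j. (1 - 1 / s) * w j + (1 / s) * (a j + (\<Sum>k\<in>S. R j k * w k)))" for w
  define w where "w k = (step ^^ k) (\<lambda>_. 2 * (\<Sum>y\<in>subcube n S x. m y * \<bar>F y\<bar>))" for k
  \<comment> \<open>the contraction factor of one averaged step\<close>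
  define r where "r = 1 - \<delta> / s"
  have r: "0 \<le> r" "r < 1" using \<delta>_pos \<delta>_less s by (auto simp: r_def field_simps)
  have est: "cov_estimate S x F (w k)" for k
  proof (induction k)
    case 0 show ?case using cov_estimate_initial[OF S x] by (simp add: w_def)
  next
    case (Suc k)
    have "w (Suc k) = step (w k)" by (simp add: w_def)
    then show ?case using cov_estimate_average[OF S False Suc] by (simp add: step_def s_def a_def)
  qed
  have contr: "L2_set (step v) S \<le> r * L2_set v S + L2_set a S / s" for v
  proof -
    have "L2_set (step v) S \<le> L2_set (\<lambda>j. (1 - 1 / s) * v j) S
       + L2_set (\<lambda>j. (1 / s) * (a j + (\<Sum>k\<in>S. R j k * v k))) S"
      unfolding step_def by (rule L2_set_triangle_ineq)
    also have "\<dots> \<le> (1 - 1 / s) * L2_set v S + (1 / s) * (L2_set a S + (1 - \<delta>) * L2_set v S)"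
      using s L2_set_triangle_ineq[of a "\<lambda>j. \<Sum>k\<in>S. R j k * v k" S] R_L2_set[OF S, of v]
      by (subst (1 2) L2_set_right_distrib[symmetric])
         (auto intro!: add_mono mult_left_mono divide_right_mono)
    also have "\<dots> = r * L2_set v S + L2_set a S / s"
      using s by (simp add: r_def field_simps)
    finally show ?thesis .
  qed
  have bound: "L2_set (w k) S \<le> L2_set a S / \<delta> + r ^ k * L2_set (w 0) S" for k
  proof (induction k)
    case 0 show ?case using \<delta>_pos by simp
  next
    case (Suc k)
    have "L2_set (w (Suc k)) S \<le> r * L2_set (w k) S + L2_set a S / s"
      using contr[of "w k"] by (simp add: w_def)
    also have "\<dots> \<le> r * (L2_set a S / \<delta> + r ^ k * L2_set (w 0) S) + L2_set a S / s"
      using Suc r by (intro add_right_mono mult_left_mono) auto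
    also have "\<dots> = L2_set a S / \<delta> + r ^ Suc k * L2_set (w 0) S"
      using s \<delta>_pos by (simp add: r_def field_simps)
    finally show ?case .
  qed
  have cov_le: "L2_set (\<lambda>i. cov S x F (up i)) S \<le> L2_set (w k) S" for k
  proof -
    have "\<bar>cov S x F (up i)\<bar> \<le> w k i" if i: "i \<in> S" for i
    proof -
      have i': "i \<in> {1..n}" using i S by auto
      have "\<forall>j\<in>S. \<forall>y\<in>subcube n S x. \<bar>grad j (up i) y\<bar> \<le> (if j = i then 1 else 0)"
        using grad_up[OF _ i'] subcube_subset by blast
      then have "\<bar>cov S x F (up i)\<bar> \<le> (\<Sum>j\<in>S. w k j * (if j = i then 1 else 0))"
        using est[of k, unfolded cov_estimate_def, rule_format, of "up i" "\<lambda>j. if j = i then 1 else 0"] by blast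
      also have "\<dots> = w k i" using i fin by (simp add: if_distrib cong: if_cong)
      finally show ?thesis .
    qed
    then have "(cov S x F (up i))\<^sup>2 \<le> (w k i)\<^sup>2" if "i \<in> S" for i
      using that abs_le_square_iff[of "cov S x F (up i)" "w k i"] by fastforce
    then show ?thesis unfolding L2_set_def by (intro real_sqrt_le_mono sum_mono)
  qed
  have "(\<lambda>k. L2_set a S / \<delta> + r ^ k * L2_set (w 0) S) \<longlonglongrightarrow> L2_set a S / \<delta> + 0 * L2_set (w 0) S"
    using r by (intro tendsto_intros LIMSEQ_realpow_zero)
  then have "L2_set (\<lambda>i. cov S x F (up i)) S \<le> L2_set a S / \<delta> + 0 * L2_set (w 0) S"
    by (rule LIMSEQ_le_const) (use order_trans[OF cov_le bound] in blast)
  then have "(L2_set (\<lambda>i. cov S x F (up i)) S)\<^sup>2 \<le> (L2_set a S / \<delta>)\<^sup>2"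
    by (intro power_mono) auto
  then show ?thesis
    by (simp add: L2_set_def a_def power_divide sum_nonneg)
qed simp

end

section \<open>Poincare and logarithmic Sobolev inequalities\<close>

lemma face_subcube: "face n S x i s = subcube n (S - {i}) (x(i := s))"
  by (simp add: face_def)

lemma upd_in_cube: "x \<in> cube n \<Longrightarrow> i \<in> {1..n} \<Longrightarrow> s = 1 \<or> s = -1 \<Longrightarrow> x(i := s) \<in> cube n"
  by (auto simp: cube_def PiE_def Pi_def extensional_def)

text \<open>Tensorization by averaging over the coordinate that is split off: a functional of subcubes is
  bounded by an edge sum as soon as its total defect over all the \<open>card S\<close> ways to halve the subcube
  is. Indeed, the induction hypothesis on the two halves lacks the direction that is split off, so on
  average over \<open>i\<close> it gives \<open>1 - 1 / card S\<close> times the edge sum, and the defects supply the rest.\<close>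
lemma tensorization:
  fixes \<Phi> :: "(nat \<Rightarrow> real) set \<Rightarrow> real" and e :: "nat \<Rightarrow> (nat \<Rightarrow> real) \<Rightarrow> real"
  assumes point: "\<And>x. x \<in> cube n \<Longrightarrow> \<Phi> {x} \<le> 0"
    and split: "\<And>S x. S \<subseteq> {1..n} \<Longrightarrow> x \<in> cube n \<Longrightarrow>
      (\<Sum>i\<in>S. \<Phi> (subcube n S x) - \<Phi> (face n S x i 1) - \<Phi> (face n S x i (-1)))
      \<le> (\<Sum>j\<in>S. \<Sum>y\<in>subcube n S x. e j y)"
    and S: "S \<subseteq> {1..n}" and x: "x \<in> cube n"
  shows "\<Phi> (subcube n S x) \<le> (\<Sum>j\<in>S. \<Sum>y\<in>subcube n S x. e j y)"
  using S x
proof (induction "card S" arbitrary: S x)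
  case 0
  then have "S = {}" using finite_subset[of S "{1..n}"] by auto
  then show ?case using 0 point by (simp add: subcube_empty)
next
  case (Suc k)
  have fin: "finite S" using Suc finite_subset[of S "{1..n}"] by auto
  let ?e = "\<lambda>j. \<Sum>y\<in>subcube n S x. e j y"
  have ne: "card S > 0" using Suc by simp
  have face: "\<Phi> (face n S x i 1) + \<Phi> (face n S x i (-1)) \<le> (\<Sum>j\<in>S-{i}. ?e j)" if i: "i \<in> S" for i
  proof -
    have i': "i \<in> {1..n}" using i Suc by auto
    have "\<Phi> (face n S x i s) \<le> (\<Sum>j\<in>S-{i}. \<Sum>y\<in>face n S x i s. e j y)" if "s = 1 \<or> s = -1" for s
      unfolding face_subcube
      by (rule Suc.hyps(1)) (use Suc i fin i' that upd_in_cube in auto)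
    from this[of 1] this[of "-1"] show ?thesis
      by (simp add: sum_subcube_split[OF i i', of _ x] sum.distrib)
  qed
  have "card S * \<Phi> (subcube n S x) =
      (\<Sum>i\<in>S. \<Phi> (subcube n S x) - \<Phi> (face n S x i 1) - \<Phi> (face n S x i (-1)))
      + (\<Sum>i\<in>S. \<Phi> (face n S x i 1) + \<Phi> (face n S x i (-1)))"
    by (simp add: sum.distrib[symmetric])
  also have "\<dots> \<le> (\<Sum>j\<in>S. ?e j) + (\<Sum>i\<in>S. \<Sum>j\<in>S-{i}. ?e j)"
    by (rule add_mono[OF split[OF Suc.prems] sum_mono[OF face]])
  also have "(\<Sum>i\<in>S. \<Sum>j\<in>S-{i}. ?e j) = (\<Sum>i\<in>S. (\<Sum>j\<in>S. ?e j) - ?e i)"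
    using fin by (intro sum.cong refl) (simp add: sum_diff1)
  also have "(\<Sum>j\<in>S. ?e j) + \<dots> = card S * (\<Sum>j\<in>S. ?e j)"
    by (simp add: sum_subtractf)
  finally show ?case using ne by simp
qed

text \<open>The defects for entropy and variance: two halves of masses \<open>M\<close>, \<open>N\<close> with integrals \<open>a\<close>, \<open>b\<close>
  are merged. Both are quadratic in \<open>a N - b M\<close>, for the entropy because \<open>ln x \<le> x - 1\<close>.\<close>
lemma two_point_entropy:
  fixes a b M N :: real
  assumes "a > 0" "b > 0" "M > 0" "N > 0"
  shows "a * ln (a / M) + b * ln (b / N) - (a + b) * ln ((a + b) / (M + N))
    \<le> (a * N - b * M)\<^sup>2 / ((a + b) * M * N)"
proof -
  define t where "t = (M + N) / (a + b)"
  have t: "t > 0" using assms by (simp add: t_def)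
  have "ln ((a + b) / (M + N)) = - ln t" using assms by (simp add: t_def ln_div)
  then have "a * ln (a / M) + b * ln (b / N) - (a + b) * ln ((a + b) / (M + N))
      = a * ln (a / M * t) + b * ln (b / N * t)"
    using assms t ln_mult[of "a / M" t] ln_mult[of "b / N" t] by (simp add: algebra_simps)
  also have "\<dots> \<le> a * (a / M * t - 1) + b * (b / N * t - 1)"
    using assms t by (intro add_mono mult_left_mono ln_le_minus_one) auto
  also have "\<dots> = (a * N - b * M)\<^sup>2 / ((a + b) * M * N)"
  proof -
    have "(a\<^sup>2 * N + b\<^sup>2 * M) * (M + N) - (a + b)\<^sup>2 * M * N = (a * N - b * M)\<^sup>2"
      by (simp add: power2_eq_square algebra_simps)
    moreover have "a * (a / M * t - 1) + b * (b / N * t - 1)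
       = ((a\<^sup>2 * N + b\<^sup>2 * M) * (M + N) - (a + b)\<^sup>2 * M * N) / ((a + b) * M * N)"
    proof -
      obtain u where u: "u = a + b" "u > 0" using assms by simp
      have "a * (a / M * ((M + N) / u) - 1) + b * (b / N * ((M + N) / u) - 1)
          = (a\<^sup>2 * N + b\<^sup>2 * M) * (M + N) / (u * M * N) - (a + b)"
        using assms u(2) by (simp add: power2_eq_square field_simps)
      also have "\<dots> = (a\<^sup>2 * N + b\<^sup>2 * M) * (M + N) / (u * M * N) - u\<^sup>2 * M * N / (u * M * N)"
        using assms u by (simp add: power2_eq_square)
      finally show ?thesis unfolding t_def u(1)[symmetric] diff_divide_distrib .
    qed
    ultimately show ?thesis by simp
  qed
  finally show ?thesis .
qed

lemma two_point_variance:
  fixes a b M N :: real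
  assumes "M > 0" "N > 0"
  shows "a\<^sup>2 / M + b\<^sup>2 / N - (a + b)\<^sup>2 / (M + N) = (a * N - b * M)\<^sup>2 / ((M + N) * M * N)"
proof -
  have "M + N > 0" using assms by simp
  then have "a\<^sup>2 / M + b\<^sup>2 / N - (a + b)\<^sup>2 / (M + N)
     = ((a\<^sup>2 * N + b\<^sup>2 * M) * (M + N) - (a + b)\<^sup>2 * M * N) / ((M + N) * M * N)"
    using assms by (simp add: field_simps)
  also have "(a\<^sup>2 * N + b\<^sup>2 * M) * (M + N) - (a + b)\<^sup>2 * M * N = (a * N - b * M)\<^sup>2"
    by (simp add: power2_eq_square algebra_simps)
  finally show ?thesis .
qed

definition log_sobolev_const :: "real \<Rightarrow> real \<Rightarrow> real" where
  "log_sobolev_const \<beta> \<delta> = 1 / (\<beta>\<^sup>2 * \<delta>\<^sup>2)"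

lemma log_sobolev_const_pos: "0 < \<beta> \<Longrightarrow> 0 < \<delta> \<Longrightarrow> 0 < log_sobolev_const \<beta> \<delta>"
  by (simp add: log_sobolev_const_def)

context weakly_dependent
begin

lemma face_mass_ge:
  assumes "i \<in> S" "i \<in> {1..n}" "s = 1 \<or> s = -1"
  shows "\<beta> * (\<Sum>y\<in>subcube n S x. m y) \<le> (\<Sum>y\<in>face n S x i s. m y)"
proof -
  have "(\<Sum>y\<in>face n S x i (- s). m y) = (\<Sum>y\<in>face n S x i s. m (flip i y))"
    using sum_face_flip[OF assms(1,2), of m x "- s"] by simp
  moreover have "(\<Sum>y\<in>subcube n S x. m y) = (\<Sum>y\<in>face n S x i s. m y) + (\<Sum>y\<in>face n S x i (- s). m y)"
    using assms(3) sum_subcube_split[OF assms(1,2), of m x] by auto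
  ultimately have "\<beta> * (\<Sum>y\<in>subcube n S x. m y) = (\<Sum>y\<in>face n S x i s. \<beta> * (m y + m (flip i y)))"
    by (simp add: sum.distrib sum_distrib_left distrib_left)
  also have "\<dots> \<le> (\<Sum>y\<in>face n S x i s. m y)"
    by (intro sum_mono m_ge) (use assms in \<open>auto simp: face_subcube subcube_def\<close>)
  finally show ?thesis .
qed

lemma face_mass_prod:
  assumes "i \<in> S" "i \<in> {1..n}" "x \<in> cube n"
  defines "M s \<equiv> \<Sum>y\<in>face n S x i s. m y"
  shows "M 1 > 0" "M (-1) > 0" "\<beta>\<^sup>2 * (M 1 + M (-1))\<^sup>2 \<le> M 1 * M (-1)"
proof -
  have tot: "M 1 + M (-1) = (\<Sum>y\<in>subcube n S x. m y)"
    unfolding M_def using sum_subcube_split[OF assms(1,2)] by simp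
  have pos: "M 1 + M (-1) > 0" unfolding tot using subcube_mass_pos assms by simp
  have ge: "\<beta> * (M 1 + M (-1)) \<le> M s" if "s = 1 \<or> s = -1" for s
    unfolding tot unfolding M_def by (rule face_mass_ge[OF assms(1,2) that])
  have p: "0 < \<beta> * (M 1 + M (-1))" using pos \<beta>_pos by simp
  show "M 1 > 0" "M (-1) > 0" using ge[of 1] ge[of "-1"] p by auto
  have "(\<beta> * (M 1 + M (-1))) * (\<beta> * (M 1 + M (-1))) \<le> M 1 * M (-1)"
    using ge[of 1] ge[of "-1"] p by (intro mult_mono) auto
  then show "\<beta>\<^sup>2 * (M 1 + M (-1))\<^sup>2 \<le> M 1 * M (-1)"
    by (simp add: power2_eq_square algebra_simps)
qed

text \<open>The covariance with \<open>up i\<close> is the quantity on which the cost of merging the two faces depends.\<close>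
lemma cov_up:
  fixes F :: "(nat \<Rightarrow> real) \<Rightarrow> real"
  assumes "i \<in> S" "i \<in> {1..n}" "x \<in> cube n"
  defines "M s \<equiv> \<Sum>y\<in>face n S x i s. m y" and "A s \<equiv> \<Sum>y\<in>face n S x i s. m y * F y"
  shows "cov S x F (up i) = (A 1 * M (-1) - A (-1) * M 1) / (M 1 + M (-1))"
proof -
  have up: "(\<Sum>y\<in>subcube n S x. h y * up i y) = (\<Sum>y\<in>face n S x i 1. h y)" for h
    unfolding sum_subcube_split[OF assms(1,2)] by (simp add: up_def face_eq[OF assms(1,2)])
  have "cov S x F (up i) = A 1 - (A 1 + A (-1)) * M 1 / (M 1 + M (-1))"
    using up[of "\<lambda>y. m y * F y"] up[of m]
    by (simp add: cov_def A_def M_def sum_subcube_split[OF assms(1,2)] mult.assoc)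
  also have "\<dots> = (A 1 * M (-1) - A (-1) * M 1) / (M 1 + M (-1))"
    using face_mass_prod(1,2)[OF assms(1-3)] add_pos_pos[OF face_mass_prod(1,2)[OF assms(1-3)]]
    by (simp add: M_def[symmetric] field_simps)
  finally show ?thesis .
qed

lemma merge_cost:
  fixes F :: "(nat \<Rightarrow> real) \<Rightarrow> real"
  assumes "i \<in> S" "i \<in> {1..n}" "x \<in> cube n" "Z > 0"
  defines "M s \<equiv> \<Sum>y\<in>face n S x i s. m y" and "A s \<equiv> \<Sum>y\<in>face n S x i s. m y * F y"
  shows "(A 1 * M (-1) - A (-1) * M 1)\<^sup>2 / (Z * M 1 * M (-1))
    \<le> (1 / (\<beta>\<^sup>2 * Z)) * (cov S x F (up i))\<^sup>2"
proof -
  note M = face_mass_prod[OF assms(1-3), folded M_def]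
  let ?K = "A 1 * M (-1) - A (-1) * M 1" and ?T = "M 1 + M (-1)"
  have T: "?T > 0" using M by simp
  have "?K\<^sup>2 / (Z * M 1 * M (-1)) \<le> ?K\<^sup>2 / (Z * (\<beta>\<^sup>2 * ?T\<^sup>2))"
    using M T assms(4) \<beta>_pos by (intro divide_left_mono) (auto intro!: mult_pos_pos)
  also have "\<dots> = (1 / (\<beta>\<^sup>2 * Z)) * (cov S x F (up i))\<^sup>2"
    unfolding cov_up[OF assms(1-3), where F=F, folded M_def A_def] by (simp add: power_divide mult_ac)
  finally show ?thesis by (simp add: mult_ac)
qed

lemma edge_var_le:
  assumes S: "S \<subseteq> {1..n}" "j \<in> S"
  shows "(edge_var S x g j)\<^sup>2 \<le> (\<Sum>y\<in>subcube n S x. m y) * (\<Sum>y\<in>subcube n S x. m y * (grad j g y)\<^sup>2)"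
proof -
  let ?B = "subcube n S x"
  have j: "j \<in> {1..n}" using S by auto
  have m0: "y \<in> ?B \<Longrightarrow> 0 \<le> m y" for y using subcube_subset m_nonneg by blast
  have "(1/2) * (m y * c j y * \<bar>grad j g y\<bar>) \<le> m y * (1 * \<bar>grad j g y\<bar>)" if "y \<in> ?B" for y
  proof -
    have y: "y \<in> cube n" using that subcube_subset by blast
    have "(1/2) * c j y \<le> 1" using rate_less_1[OF y j] by simp
    then have "((1/2) * c j y) * (m y * \<bar>grad j g y\<bar>) \<le> 1 * (m y * \<bar>grad j g y\<bar>)"
      using m0[OF that] by (intro mult_right_mono) auto
    then show ?thesis by (simp add: mult_ac)
  qed
  then have "edge_var S x g j \<le> (\<Sum>y\<in>?B. m y * (1 * \<bar>grad j g y\<bar>))"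
    unfolding edge_var_def sum_distrib_left by (rule sum_mono)
  moreover have "0 \<le> edge_var S x g j"
    unfolding edge_var_def using subcube_subset[of n S x] m_nonneg rate_pos[OF _ j]
    by (intro mult_nonneg_nonneg sum_nonneg) (auto intro: less_imp_le simp: subset_iff)
  ultimately have "(edge_var S x g j)\<^sup>2 \<le> (\<Sum>y\<in>?B. m y * (1 * \<bar>grad j g y\<bar>))\<^sup>2"
    by (rule power_mono)
  also have "\<dots> \<le> (\<Sum>y\<in>?B. m y * 1\<^sup>2) * (\<Sum>y\<in>?B. m y * \<bar>grad j g y\<bar>\<^sup>2)"
    by (rule weighted_Cauchy_Schwarz) (rule m0)
  finally show ?thesis by simp
qed

text \<open>For a square \<open>g\<^sup>2\<close> the gradient factors as \<open>grad g\<close> times a sum of two values of \<open>g\<close>, so that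
  the first factor of the Cauchy-Schwarz bound is the integral of \<open>g\<^sup>2\<close> instead of the mass. This is
  what turns the variance bound into an entropy bound.\<close>
lemma edge_var_square_le:
  assumes S: "S \<subseteq> {1..n}" "j \<in> S"
  shows "(edge_var S x (\<lambda>y. (g y)\<^sup>2) j)\<^sup>2
    \<le> (\<Sum>y\<in>subcube n S x. m y * (g y)\<^sup>2) * (\<Sum>y\<in>subcube n S x. m y * (grad j g y)\<^sup>2)"
proof -
  let ?B = "subcube n S x"
  have j: "j \<in> {1..n}" using S by auto
  have k0: "0 \<le> m y * c j y" "m y * c j y \<le> m y" if "y \<in> ?B" for y
  proof -
    have y: "y \<in> cube n" using that subcube_subset by blast
    show "0 \<le> m y * c j y" "m y * c j y \<le> m y"
      using m_pos[OF y] rate_pos[OF y j] rate_less_1[OF y j] by (auto simp: mult_le_cancel_left1)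
  qed
  have m0: "y \<in> ?B \<Longrightarrow> 0 \<le> m y" for y using k0[of y] by linarith
  define p where "p y = \<bar>grad j g y\<bar>" for y
  define s where "s y = \<bar>g (flip j y) + g y\<bar>" for y
  have eq: "edge_var S x (\<lambda>y. (g y)\<^sup>2) j = (1/2) * (\<Sum>y\<in>?B. m y * c j y * (p y * s y))"
    unfolding edge_var_def p_def s_def abs_mult[symmetric]
    by (simp add: grad_def power2_eq_square algebra_simps)
  have A: "(\<Sum>y\<in>?B. m y * c j y * (p y)\<^sup>2) \<le> (\<Sum>y\<in>?B. m y * (grad j g y)\<^sup>2)"
    unfolding p_def power2_abs by (intro sum_mono mult_right_mono k0) auto
  have fl: "(\<Sum>y\<in>?B. m y * c j y * (g (flip j y))\<^sup>2) = (\<Sum>y\<in>?B. m y * c j y * (g y)\<^sup>2)"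
  proof -
    have "(\<Sum>y\<in>?B. m y * c j y * (g (flip j y))\<^sup>2) = (\<Sum>y\<in>?B. m (flip j y) * c j (flip j y) * (g (flip j y))\<^sup>2)"
      by (intro sum.cong refl) (use reversible[OF _ j] subcube_subset in fastforce)
    also have "\<dots> = (\<Sum>y\<in>?B. m y * c j y * (g y)\<^sup>2)"
      by (rule sum_subcube_flip[OF S(2) j, of "\<lambda>y. m y * c j y * (g y)\<^sup>2"])
    finally show ?thesis .
  qed
  have "(\<Sum>y\<in>?B. m y * c j y * (s y)\<^sup>2) \<le> (\<Sum>y\<in>?B. m y * c j y * (2 * (g (flip j y))\<^sup>2 + 2 * (g y)\<^sup>2))"
  proof (intro sum_mono mult_left_mono k0)
    fix y
    have "0 \<le> (g (flip j y) - g y)\<^sup>2" by simp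
    then show "(s y)\<^sup>2 \<le> 2 * (g (flip j y))\<^sup>2 + 2 * (g y)\<^sup>2"
      unfolding s_def power2_abs by (simp add: power2_eq_square algebra_simps)
  qed auto
  also have "\<dots> = 4 * (\<Sum>y\<in>?B. m y * c j y * (g y)\<^sup>2)"
  proof -
    have "(\<Sum>y\<in>?B. m y * c j y * (2 * (g (flip j y))\<^sup>2 + 2 * (g y)\<^sup>2))
      = 2 * (\<Sum>y\<in>?B. m y * c j y * (g (flip j y))\<^sup>2) + 2 * (\<Sum>y\<in>?B. m y * c j y * (g y)\<^sup>2)"
      unfolding sum_distrib_left sum.distrib[symmetric] by (intro sum.cong refl) (simp add: algebra_simps)
    then show ?thesis unfolding fl by simp
  qed
  also have "\<dots> \<le> 4 * (\<Sum>y\<in>?B. m y * (g y)\<^sup>2)"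
    by (intro mult_left_mono sum_mono mult_right_mono k0) auto
  finally have B: "(\<Sum>y\<in>?B. m y * c j y * (s y)\<^sup>2) \<le> 4 * (\<Sum>y\<in>?B. m y * (g y)\<^sup>2)" .
  have "(edge_var S x (\<lambda>y. (g y)\<^sup>2) j)\<^sup>2 = (1/4) * (\<Sum>y\<in>?B. m y * c j y * (p y * s y))\<^sup>2"
    unfolding eq by (simp add: power_mult_distrib power2_eq_square)
  also have "\<dots> \<le> (1/4) * ((\<Sum>y\<in>?B. m y * c j y * (p y)\<^sup>2) * (\<Sum>y\<in>?B. m y * c j y * (s y)\<^sup>2))"
    by (intro mult_left_mono weighted_Cauchy_Schwarz k0) auto
  also have "\<dots> \<le> (1/4) * ((\<Sum>y\<in>?B. m y * (grad j g y)\<^sup>2) * (4 * (\<Sum>y\<in>?B. m y * (g y)\<^sup>2)))"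
    by (intro mult_left_mono mult_mono A B sum_nonneg mult_nonneg_nonneg[OF k0(1)]
          mult_nonneg_nonneg[OF m0]) auto
  finally show ?thesis by (simp add: mult_ac)
qed

abbreviation "\<kappa> \<equiv> log_sobolev_const \<beta> \<delta>"

text \<open>The comparison theorem closes the induction step: the total cost of merging is a sum of squared
  covariances, hence bounded by the squared discrepancies. The number \<open>Z\<close> is the mass for the
  variance, and the integral of the square for the entropy.\<close>
lemma total_merge_cost:
  fixes F g :: "(nat \<Rightarrow> real) \<Rightarrow> real"
  defines "M x S i s \<equiv> \<Sum>y\<in>face n S x i s. m y" and "A x S i s \<equiv> \<Sum>y\<in>face n S x i s. m y * F y"
  assumes S: "S \<subseteq> {1..n}" and x: "x \<in> cube n" and Z: "Z > 0"
    and cost: "\<And>i. i \<in> S \<Longrightarrow> d i \<le> (A x S i 1 * M x S i (-1) - A x S i (-1) * M x S i 1)\<^sup>2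
       / (Z * M x S i 1 * M x S i (-1))"
    and edge: "\<And>j. j \<in> S \<Longrightarrow>
      (edge_var S x F j)\<^sup>2 \<le> Z * (\<Sum>y\<in>subcube n S x. m y * (grad j g y)\<^sup>2)"
  shows "(\<Sum>i\<in>S. d i) \<le> (\<Sum>j\<in>S. \<Sum>y\<in>subcube n S x. \<kappa> * (m y * (grad j g y)\<^sup>2))"
proof -
  have "(\<Sum>i\<in>S. d i) \<le> (\<Sum>i\<in>S. (1 / (\<beta>\<^sup>2 * Z)) * (cov S x F (up i))\<^sup>2)"
  proof (rule sum_mono)
    fix i assume i: "i \<in> S"
    then have "i \<in> {1..n}" using S by auto
    from merge_cost[OF i this x Z, of F] cost[OF i]
    show "d i \<le> (1 / (\<beta>\<^sup>2 * Z)) * (cov S x F (up i))\<^sup>2" unfolding M_def A_def by linarith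
  qed
  also have "\<dots> \<le> (1 / (\<beta>\<^sup>2 * Z)) * ((1/\<delta>\<^sup>2) * (\<Sum>j\<in>S. (edge_var S x F j)\<^sup>2))"
    unfolding sum_distrib_left[symmetric] using Z by (intro mult_left_mono cov_comparison S x) auto
  also have "\<dots> \<le> (1 / (\<beta>\<^sup>2 * Z)) * ((1/\<delta>\<^sup>2) * (\<Sum>j\<in>S. Z * (\<Sum>y\<in>subcube n S x. m y * (grad j g y)\<^sup>2)))"
    using Z by (intro mult_left_mono sum_mono edge) auto
  also have "\<dots> = (\<Sum>j\<in>S. \<Sum>y\<in>subcube n S x. \<kappa> * (m y * (grad j g y)\<^sup>2))"
    unfolding sum_distrib_left[symmetric] using Z by (simp add: log_sobolev_const_def)
  finally show ?thesis .
qed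

lemma poincare_subcube:
  assumes S: "S \<subseteq> {1..n}" and x: "x \<in> cube n"
  shows "(\<Sum>y\<in>subcube n S x. m y * (g y)\<^sup>2)
      - (\<Sum>y\<in>subcube n S x. m y * g y)\<^sup>2 / (\<Sum>y\<in>subcube n S x. m y)
    \<le> (\<Sum>j\<in>S. \<Sum>y\<in>subcube n S x. \<kappa> * (m y * (grad j g y)\<^sup>2))"
proof -
  define \<Phi> where "\<Phi> B = (\<Sum>y\<in>B. m y * (g y)\<^sup>2) - (\<Sum>y\<in>B. m y * g y)\<^sup>2 / (\<Sum>y\<in>B. m y)" for B
  have "\<Phi> (subcube n S x) \<le> (\<Sum>j\<in>S. \<Sum>y\<in>subcube n S x. \<kappa> * (m y * (grad j g y)\<^sup>2))"
  proof (rule tensorization[OF _ _ S x])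
    fix x assume "x \<in> cube n"
    then show "\<Phi> {x} \<le> 0" using m_pos[of x] by (simp add: \<Phi>_def power2_eq_square)
  next
    fix S x assume S: "S \<subseteq> {1..n}" and x: "x \<in> cube n"
    let ?M = "\<Sum>y\<in>subcube n S x. m y"
    have M: "?M > 0" using subcube_mass_pos[OF x] .
    show "(\<Sum>i\<in>S. \<Phi> (subcube n S x) - \<Phi> (face n S x i 1) - \<Phi> (face n S x i (-1)))
      \<le> (\<Sum>j\<in>S. \<Sum>y\<in>subcube n S x. \<kappa> * (m y * (grad j g y)\<^sup>2))"
    proof (rule total_merge_cost[OF S x M _ edge_var_le[OF S]])
      fix i assume i: "i \<in> S"
      then have i': "i \<in> {1..n}" using S by auto
      note sp = sum_subcube_split[OF i i', of _ x]
      show "\<Phi> (subcube n S x) - \<Phi> (face n S x i 1) - \<Phi> (face n S x i (-1))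
        \<le> ((\<Sum>y\<in>face n S x i 1. m y * g y) * (\<Sum>y\<in>face n S x i (-1). m y)
            - (\<Sum>y\<in>face n S x i (-1). m y * g y) * (\<Sum>y\<in>face n S x i 1. m y))\<^sup>2
          / (?M * (\<Sum>y\<in>face n S x i 1. m y) * (\<Sum>y\<in>face n S x i (-1). m y))"
        using two_point_variance[OF face_mass_prod(1,2)[OF i i' x],
            of "\<Sum>y\<in>face n S x i 1. m y * g y" "\<Sum>y\<in>face n S x i (-1). m y * g y"]
        unfolding \<Phi>_def sp by linarith
    qed
  qed
  then show ?thesis unfolding \<Phi>_def .
qed

lemma log_sobolev_subcube:
  assumes S: "S \<subseteq> {1..n}" and x: "x \<in> cube n" and g: "\<And>y. y \<in> cube n \<Longrightarrow> 0 < g y"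
  shows "(\<Sum>y\<in>subcube n S x. m y * ((g y)\<^sup>2 * ln ((g y)\<^sup>2)))
      - (\<Sum>y\<in>subcube n S x. m y * (g y)\<^sup>2)
        * ln ((\<Sum>y\<in>subcube n S x. m y * (g y)\<^sup>2) / (\<Sum>y\<in>subcube n S x. m y))
    \<le> (\<Sum>j\<in>S. \<Sum>y\<in>subcube n S x. \<kappa> * (m y * (grad j g y)\<^sup>2))"
proof -
  define \<Phi> where "\<Phi> B = (\<Sum>y\<in>B. m y * ((g y)\<^sup>2 * ln ((g y)\<^sup>2)))
    - (\<Sum>y\<in>B. m y * (g y)\<^sup>2) * ln ((\<Sum>y\<in>B. m y * (g y)\<^sup>2) / (\<Sum>y\<in>B. m y))" for B
  have "\<Phi> (subcube n S x) \<le> (\<Sum>j\<in>S. \<Sum>y\<in>subcube n S x. \<kappa> * (m y * (grad j g y)\<^sup>2))"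
  proof (rule tensorization[OF _ _ S x])
    fix x assume "x \<in> cube n"
    then show "\<Phi> {x} \<le> 0" using m_pos[of x] by (simp add: \<Phi>_def)
  next
    fix S x assume S: "S \<subseteq> {1..n}" and x: "x \<in> cube n"
    let ?A = "\<Sum>y\<in>subcube n S x. m y * (g y)\<^sup>2"
    have pos: "0 < (\<Sum>y\<in>subcube n S x. m y * (g y)\<^sup>2)" if "x \<in> cube n" for S x
    proof (rule sum_pos)
      show "subcube n S x \<noteq> {}" using subcube_self[OF that] by blast
      fix y assume "y \<in> subcube n S x"
      then have "y \<in> cube n" using subcube_subset by blast
      then show "0 < m y * (g y)\<^sup>2" using m_pos g by (simp add: less_imp_neq[symmetric])
    qed simp
    have A: "?A > 0" using pos[OF x] .
    show "(\<Sum>i\<in>S. \<Phi> (subcube n S x) - \<Phi> (face n S x i 1) - \<Phi> (face n S x i (-1)))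
      \<le> (\<Sum>j\<in>S. \<Sum>y\<in>subcube n S x. \<kappa> * (m y * (grad j g y)\<^sup>2))"
    proof (rule total_merge_cost[OF S x A _ edge_var_square_le[OF S]])
      fix i assume i: "i \<in> S"
      then have i': "i \<in> {1..n}" using S by auto
      note sp = sum_subcube_split[OF i i', of _ x]
      have fp: "0 < (\<Sum>y\<in>face n S x i s. m y * (g y)\<^sup>2)" if "s = 1 \<or> s = -1" for s
        unfolding face_subcube by (rule pos) (rule upd_in_cube[OF x i' that])
      have "(\<Sum>y\<in>subcube n S x. m y * ((g y)\<^sup>2 * ln ((g y)\<^sup>2)))
         = (\<Sum>y\<in>face n S x i 1. m y * ((g y)\<^sup>2 * ln ((g y)\<^sup>2)))
         + (\<Sum>y\<in>face n S x i (-1). m y * ((g y)\<^sup>2 * ln ((g y)\<^sup>2)))" by (rule sp)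
      then show "\<Phi> (subcube n S x) - \<Phi> (face n S x i 1) - \<Phi> (face n S x i (-1))
        \<le> ((\<Sum>y\<in>face n S x i 1. m y * (g y)\<^sup>2) * (\<Sum>y\<in>face n S x i (-1). m y)
            - (\<Sum>y\<in>face n S x i (-1). m y * (g y)\<^sup>2) * (\<Sum>y\<in>face n S x i 1. m y))\<^sup>2
          / (?A * (\<Sum>y\<in>face n S x i 1. m y) * (\<Sum>y\<in>face n S x i (-1). m y))"
        using two_point_entropy[OF fp fp face_mass_prod(1,2)[OF i i' x], of 1 "-1"]
        unfolding \<Phi>_def sp[of m] sp[of "\<lambda>y. m y * (g y)\<^sup>2"] by simp
    qed
  qed
  then show ?thesis unfolding \<Phi>_def .
qed

definition mean :: "((nat \<Rightarrow> real) \<Rightarrow> real) \<Rightarrow> real" where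
  "mean h = (\<Sum>x\<in>cube n. m x * h x)"

theorem poincare: "mean (\<lambda>x. (g x)\<^sup>2) - (mean g)\<^sup>2 \<le> \<kappa> * (\<Sum>j=1..n. mean (\<lambda>x. (grad j g x)\<^sup>2))"
proof -
  obtain x where "x \<in> cube n" using cube_nonempty by blast
  from poincare_subcube[OF order_refl this, of g] show ?thesis
    unfolding subcube_full m_sum mean_def sum_distrib_left by simp
qed

theorem log_sobolev:
  assumes "\<And>y. y \<in> cube n \<Longrightarrow> 0 < g y"
  shows "mean (\<lambda>x. (g x)\<^sup>2 * ln ((g x)\<^sup>2)) - mean (\<lambda>x. (g x)\<^sup>2) * ln (mean (\<lambda>x. (g x)\<^sup>2))
    \<le> \<kappa> * (\<Sum>j=1..n. mean (\<lambda>x. (grad j g x)\<^sup>2))"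
proof -
  obtain x where "x \<in> cube n" using cube_nonempty by blast
  from log_sobolev_subcube[OF order_refl this, of g, OF assms] show ?thesis
    unfolding subcube_full m_sum mean_def sum_distrib_left by simp
qed

end

section \<open>Heat flow and curvature\<close>

text \<open>The square of the positive part is differentiable everywhere, unlike the positive part.\<close>
lemma positive_part_square_deriv:
  "((\<lambda>k. (max 0 k)\<^sup>2) has_real_derivative 2 * max 0 x) (at (x::real))"
proof -
  have bound: "\<bar>(max 0 (x + h))\<^sup>2 - (max 0 x)\<^sup>2 - 2 * max 0 x * h\<bar> \<le> h\<^sup>2" for h
  proof -
    consider "x \<ge> 0" "x + h \<ge> 0" | "x \<ge> 0" "x + h < 0" | "x < 0" "x + h \<ge> 0" | "x < 0" "x + h < 0"
      by linarith
    then show ?thesis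
    proof cases
      case 1 then show ?thesis by (simp add: power2_eq_square algebra_simps)
    next
      case 2
      have "(x + h)\<^sup>2 \<ge> 0" "x * (x + h) \<le> 0" "x * h \<le> 0"
        using 2 by (auto simp: mult_le_0_iff)
      then have "\<bar>- x\<^sup>2 - 2 * x * h\<bar> \<le> h\<^sup>2"
        by (intro abs_leI) (auto simp: power2_eq_square algebra_simps)
      then show ?thesis using 2 by simp
    next
      case 3
      then have "(x + h)\<^sup>2 \<le> h\<^sup>2" by (intro power_mono) auto
      then show ?thesis using 3 by simp
    next
      case 4 then show ?thesis by simp
    qed
  qed
  have "((\<lambda>h. ((max 0 (x + h))\<^sup>2 - (max 0 x)\<^sup>2) / h - 2 * max 0 x) \<longlongrightarrow> 0) (at 0)"
  proof (rule Lim_null_comparison)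
    show "\<forall>\<^sub>F h in at 0. norm (((max 0 (x + h))\<^sup>2 - (max 0 x)\<^sup>2) / h - 2 * max 0 x) \<le> \<bar>h\<bar>"
      unfolding eventually_at_topological
    proof (intro exI[of _ UNIV] conjI ballI impI)
      fix h :: real assume h: "h \<noteq> 0"
      have "((max 0 (x + h))\<^sup>2 - (max 0 x)\<^sup>2) / h - 2 * max 0 x
          = ((max 0 (x + h))\<^sup>2 - (max 0 x)\<^sup>2 - 2 * max 0 x * h) / h"
        using h by (simp add: field_simps)
      also have "\<bar>\<dots>\<bar> \<le> h\<^sup>2 / \<bar>h\<bar>"
        using bound[of h] by (simp add: abs_divide divide_right_mono)
      also have "\<dots> = \<bar>h\<bar>" using h by (simp add: power2_eq_square field_simps)
      finally show "norm (((max 0 (x + h))\<^sup>2 - (max 0 x)\<^sup>2) / h - 2 * max 0 x) \<le> \<bar>h\<bar>" by simp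
    qed auto
    show "((\<lambda>h::real. \<bar>h\<bar>) \<longlongrightarrow> 0) (at 0)" by (intro tendsto_rabs_zero tendsto_ident_at)
  qed
  then show ?thesis unfolding DERIV_def by (simp add: LIM_zero_iff)
qed

text \<open>The factor in the gradient bound for the flow; it is small enough to absorb the curvature term
  of the Bochner inequality over a unit of time.\<close>
definition gradient_const :: "real \<Rightarrow> real" where
  "gradient_const \<beta> = \<beta> / (3 + 1/\<beta>)"

lemma gradient_const_pos: "0 < \<beta> \<Longrightarrow> 0 < gradient_const \<beta>"
  by (simp add: gradient_const_def add_pos_pos)

context weakly_dependent
begin

text \<open>The generator of the Glauber dynamics.\<close>
definition gen :: "((nat \<Rightarrow> real) \<Rightarrow> real) \<Rightarrow> (nat \<Rightarrow> real) \<Rightarrow> real" where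
  "gen u x = (\<Sum>i=1..n. c i x * grad i u x)"

text \<open>The Glauber semigroup enters through its differential equation, for all real times; positivity
  and symmetry are derived from the equation.\<close>
definition heat :: "(real \<Rightarrow> (nat \<Rightarrow> real) \<Rightarrow> real) \<Rightarrow> bool" where
  "heat u \<longleftrightarrow> (\<forall>t. \<forall>x\<in>cube n. ((\<lambda>t. u t x) has_real_derivative gen (u t) x) (at t))"

definition energy :: "((nat \<Rightarrow> real) \<Rightarrow> real) \<Rightarrow> ((nat \<Rightarrow> real) \<Rightarrow> real) \<Rightarrow> real" where
  "energy F h = (1/2) * (\<Sum>i=1..n. mean (\<lambda>x. c i x * (grad i F x * grad i h x)))"

definition grad_sq :: "((nat \<Rightarrow> real) \<Rightarrow> real) \<Rightarrow> (nat \<Rightarrow> real) \<Rightarrow> real" where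
  "grad_sq u x = (\<Sum>i=1..n. (grad i u x)\<^sup>2)"

lemma gen_pow_bound:
  assumes "x \<in> cube n"
  shows "\<bar>(gen ^^ k) f x\<bar> \<le> (\<Sum>y\<in>cube n. \<bar>f y\<bar>) * (2 * n) ^ k"
  using assms
proof (induction k arbitrary: x)
  case 0 then show ?case by (auto intro: member_le_sum[of x "cube n" "\<lambda>y. \<bar>f y\<bar>"])
next
  case (Suc k)
  let ?K = "(\<Sum>y\<in>cube n. \<bar>f y\<bar>) * (2 * n) ^ k"
  have "\<bar>gen ((gen ^^ k) f) x\<bar> \<le> (\<Sum>i=1..n. 2 * ?K)"
    unfolding gen_def[of "(gen ^^ k) f" x]
  proof (intro order_trans[OF sum_abs] sum_mono)
    fix i assume i: "i \<in> {1..n}"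
    have "\<bar>grad i ((gen ^^ k) f) x\<bar> \<le> 2 * ?K"
      unfolding grad_def using Suc.IH[OF Suc.prems] Suc.IH[OF flip_in_cube[OF Suc.prems i]] by linarith
    then have "c i x * \<bar>grad i ((gen ^^ k) f) x\<bar> \<le> 1 * (2 * ?K)"
      using rate_pos[OF Suc.prems i] rate_less_1[OF Suc.prems i] by (intro mult_mono) auto
    then show "\<bar>c i x * grad i ((gen ^^ k) f) x\<bar> \<le> 2 * ?K"
      using rate_pos[OF Suc.prems i] by (simp add: abs_mult)
  qed
  then show ?case by (simp add: algebra_simps)
qed

text \<open>The exponential series of the generator, taken pointwise: at each point it is a power series in
  the time, which can be differentiated term by term.\<close>
definition flow :: "((nat \<Rightarrow> real) \<Rightarrow> real) \<Rightarrow> real \<Rightarrow> (nat \<Rightarrow> real) \<Rightarrow> real" where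
  "flow f t x = (\<Sum>k. (gen ^^ k) f x / fact k * t ^ k)"

lemma flow_summable:
  assumes "x \<in> cube n"
  shows "summable (\<lambda>k. (gen ^^ k) f x / fact k * t ^ k)"
proof (rule summable_comparison_test')
  let ?K = "\<Sum>y\<in>cube n. \<bar>f y\<bar>"
  show "summable (\<lambda>k. ?K * ((2 * n * \<bar>t\<bar>) ^ k /\<^sub>R fact k))"
    by (intro summable_mult summable_exp_generic)
  fix k
  have "norm ((gen ^^ k) f x / fact k * t ^ k) = \<bar>(gen ^^ k) f x\<bar> * (\<bar>t\<bar> ^ k / fact k)"
    by (simp add: abs_mult power_abs)
  also have "\<dots> \<le> (?K * (2 * n) ^ k) * (\<bar>t\<bar> ^ k / fact k)"
    by (intro mult_right_mono gen_pow_bound assms) auto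
  also have "\<dots> = ?K * ((2 * n * \<bar>t\<bar>) ^ k /\<^sub>R fact k)"
    by (simp add: power_mult_distrib divide_inverse mult_ac)
  finally show "norm ((gen ^^ k) f x / fact k * t ^ k) \<le> ?K * ((2 * n * \<bar>t\<bar>) ^ k /\<^sub>R fact k)" .
qed

lemma flow_0: "flow f 0 x = f x"
  unfolding flow_def by (subst powser_zero) simp

lemma heat_flow: "heat (flow f)"
  unfolding heat_def
proof (intro allI ballI)
  fix t x assume x: "x \<in> cube n"
  define a where "a y k = (gen ^^ k) f y / fact k" for y k
  have sums: "(\<lambda>k. a y k * t ^ k) sums flow f t y" if "y \<in> cube n" for y
    unfolding flow_def a_def by (rule summable_sums[OF flow_summable[OF that]])
  have s1: "(\<lambda>k. \<Sum>i=1..n. c i x * (a (flip i x) k * t ^ k - a x k * t ^ k)) sums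
      (\<Sum>i=1..n. c i x * (flow f t (flip i x) - flow f t x))"
    by (intro sums_sum sums_mult sums_diff sums flip_in_cube x)
  have s2: "(\<lambda>k. \<Sum>i=1..n. c i x * (a (flip i x) k * t ^ k - a x k * t ^ k)) = (\<lambda>k. diffs (a x) k * t ^ k)"
  proof
    fix k
    have d: "diffs (a x) k = gen ((gen ^^ k) f) x / fact k"
      by (simp add: diffs_def a_def fact_Suc field_simps del: of_nat_Suc)
    show "(\<Sum>i=1..n. c i x * (a (flip i x) k * t ^ k - a x k * t ^ k)) = diffs (a x) k * t ^ k"
      unfolding d gen_def[of "(gen ^^ k) f" x] sum_divide_distrib sum_distrib_right
      by (intro sum.cong refl) (simp add: a_def grad_def algebra_simps diff_divide_distrib)
  qed
  have eq: "gen (flow f t) x = (\<Sum>k. diffs (a x) k * t ^ k)"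
    using sums_unique[OF s1[unfolded s2]] by (simp add: gen_def grad_def)
  have "((\<lambda>t. \<Sum>k. a x k * t ^ k) has_real_derivative (\<Sum>k. diffs (a x) k * t ^ k)) (at t)"
    by (rule termdiffs_strong_converges_everywhere) (unfold a_def, rule flow_summable[OF x])
  then show "((\<lambda>t. flow f t x) has_real_derivative gen (flow f t) x) (at t)"
    unfolding eq by (simp add: flow_def a_def)
qed

lemma heatD: "heat u \<Longrightarrow> x \<in> cube n \<Longrightarrow> ((\<lambda>t. u t x) has_real_derivative gen (u t) x) (at t)"
  by (simp add: heat_def)

lemma heat_grad:
  assumes "heat u" "x \<in> cube n" "i \<in> {1..n}"
  shows "((\<lambda>t. grad i (u t) x) has_real_derivative grad i (gen (u t)) x) (at t)"
  unfolding grad_def by (intro DERIV_diff heatD assms flip_in_cube)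

lemma heat_shift:
  assumes "heat u" shows "heat (\<lambda>t. u (s + t))"
  unfolding heat_def
proof (intro allI ballI)
  fix t x assume "x \<in> cube n"
  from heatD[OF assms this, of "t + s"]
  show "((\<lambda>t. u (s + t) x) has_real_derivative gen (u (s + t)) x) (at t)"
    unfolding DERIV_shift by (simp add: add.commute)
qed

lemma mean_cong: "(\<And>x. x \<in> cube n \<Longrightarrow> g x = h x) \<Longrightarrow> mean g = mean h"
  by (simp add: mean_def)

lemma mean_mono: "(\<And>x. x \<in> cube n \<Longrightarrow> g x \<le> h x) \<Longrightarrow> mean g \<le> mean h"
  unfolding mean_def by (intro sum_mono mult_left_mono m_nonneg)

lemma mean_nonneg: "(\<And>x. x \<in> cube n \<Longrightarrow> 0 \<le> g x) \<Longrightarrow> 0 \<le> mean g"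
  unfolding mean_def by (intro sum_nonneg mult_nonneg_nonneg m_nonneg)

lemma mean_pos: "(\<And>x. x \<in> cube n \<Longrightarrow> 0 < g x) \<Longrightarrow> 0 < mean g"
  unfolding mean_def using cube_nonempty m_pos by (intro sum_pos) auto

lemma mean_const [simp]: "mean (\<lambda>_. a) = a"
  by (simp add: mean_def m_sum sum_distrib_right[symmetric])

lemma mean_add: "mean (\<lambda>x. g x + h x) = mean g + mean h"
  by (simp add: mean_def sum.distrib distrib_left)

lemma mean_diff: "mean (\<lambda>x. g x - h x) = mean g - mean h"
  by (simp add: mean_def sum_subtractf right_diff_distrib)

lemma mean_mult: "mean (\<lambda>x. a * g x) = a * mean g"
  by (simp add: mean_def sum_distrib_left mult_ac)

lemma mean_sum: "mean (\<lambda>x. \<Sum>i\<in>A. g i x) = (\<Sum>i\<in>A. mean (g i))"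
  unfolding mean_def sum_distrib_left by (rule sum.swap)

lemma mean_abs: "\<bar>mean g\<bar> \<le> mean (\<lambda>x. \<bar>g x\<bar>)"
  unfolding mean_def by (intro order_trans[OF sum_abs] sum_mono) (simp add: abs_mult m_nonneg)

lemma mean_deriv:
  assumes "\<And>x. x \<in> cube n \<Longrightarrow> ((\<lambda>t. H t x) has_real_derivative D x) (at t)"
  shows "((\<lambda>t. mean (H t)) has_real_derivative mean D) (at t)"
  unfolding mean_def by (intro DERIV_sum DERIV_cmult assms)

text \<open>The generator is symmetric, with the energy as its Dirichlet form.\<close>
lemma mean_gen: "mean (\<lambda>x. F x * gen h x) = - energy F h"
proof -
  have "mean (\<lambda>x. F x * gen h x) = (\<Sum>i=1..n. mean (\<lambda>x. c i x * (F x * grad i h x)))"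
    unfolding mean_sum[symmetric] gen_def sum_distrib_left by (simp add: mult_ac)
  also have "\<dots> = (\<Sum>i=1..n. - (1/2) * mean (\<lambda>x. c i x * (grad i F x * grad i h x)))"
  proof (rule sum.cong[OF refl])
    fix i assume i: "i \<in> {1..n}"
    obtain x where "x \<in> cube n" using cube_nonempty by blast
    show "mean (\<lambda>x. c i x * (F x * grad i h x)) = - (1/2) * mean (\<lambda>x. c i x * (grad i F x * grad i h x))"
      using edge_sum[OF i i order_refl, where F=F and h=h and x=x] unfolding subcube_full mean_def
      by (simp add: mult_ac)
  qed
  finally show ?thesis by (simp add: energy_def sum_distrib_left sum_negf)
qed

lemma energy_commute: "energy F h = energy h F"
  by (simp add: energy_def mult_ac)

text \<open>A subsolution of the heat equation stays below any constant \<open>M\<close> that bounds it initially: the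
  integral of the squared positive part of \<open>H - M\<close> cannot increase, because truncation and the
  function have gradients of the same sign.\<close>
lemma max_principle:
  assumes T: "0 \<le> T"
    and deriv: "\<And>t x. 0 \<le> t \<Longrightarrow> t \<le> T \<Longrightarrow> x \<in> cube n \<Longrightarrow> ((\<lambda>t. H t x) has_real_derivative D t x) (at t)"
    and sub: "\<And>t x. 0 \<le> t \<Longrightarrow> t \<le> T \<Longrightarrow> x \<in> cube n \<Longrightarrow> D t x \<le> gen (H t) x"
    and init: "\<And>x. x \<in> cube n \<Longrightarrow> H 0 x \<le> M"
    and x: "x \<in> cube n"
  shows "H T x \<le> M"
proof -
  define Z where "Z t = mean (\<lambda>x. (max 0 (H t x - M))\<^sup>2)" for t
  have "\<exists>y. (Z has_real_derivative y) (at t) \<and> y \<le> 0" if t: "0 \<le> t" "t \<le> T" for t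
  proof (intro exI conjI)
    show "(Z has_real_derivative mean (\<lambda>x. 2 * max 0 (H t x - M) * D t x)) (at t)"
      unfolding Z_def
    proof (rule mean_deriv)
      fix x assume x: "x \<in> cube n"
      have "((\<lambda>t. H t x - M) has_real_derivative D t x) (at t)"
        using DERIV_diff[OF deriv[OF t x] DERIV_const[of M]] by simp
      from DERIV_chain2[OF positive_part_square_deriv this]
      show "((\<lambda>t. (max 0 (H t x - M))\<^sup>2) has_real_derivative 2 * max 0 (H t x - M) * D t x) (at t)" .
    qed
    have "mean (\<lambda>x. 2 * max 0 (H t x - M) * D t x) \<le> mean (\<lambda>x. (2 * max 0 (H t x - M)) * gen (H t) x)"
      by (intro mean_mono mult_left_mono sub t) auto
    also have "\<dots> = - energy (\<lambda>x. 2 * max 0 (H t x - M)) (H t)"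
      by (rule mean_gen)
    also have "\<dots> \<le> 0"
    proof -
      have "0 \<le> mean (\<lambda>x. c i x * (grad i (\<lambda>x. 2 * max 0 (H t x - M)) x * grad i (H t) x))"
        if "i \<in> {1..n}" for i
      proof (rule mean_nonneg)
        fix x assume x: "x \<in> cube n"
        have "0 \<le> grad i (\<lambda>x. 2 * max 0 (H t x - M)) x * grad i (H t) x"
          by (cases "H t x \<le> H t (flip i x)")
             (auto simp: grad_def max_def intro: mult_nonpos_nonpos)
        then show "0 \<le> c i x * (grad i (\<lambda>x. 2 * max 0 (H t x - M)) x * grad i (H t) x)"
          using rate_pos[OF x that] by simp
      qed
      then have "0 \<le> (\<Sum>i=1..n. mean (\<lambda>x. c i x * (grad i (\<lambda>x. 2 * max 0 (H t x - M)) x * grad i (H t) x)))"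
        by (rule sum_nonneg)
      then show ?thesis unfolding energy_def by simp
    qed
    finally show "mean (\<lambda>x. 2 * max 0 (H t x - M) * D t x) \<le> 0" .
  qed
  then have "Z T \<le> Z 0" by (intro DERIV_nonpos_imp_nonincreasing[OF T])
  also have "Z 0 = mean (\<lambda>_. 0)" unfolding Z_def by (rule mean_cong) (simp add: init max_absorb1)
  finally have "mean (\<lambda>x. (max 0 (H T x - M))\<^sup>2) \<le> 0" by (simp add: Z_def)
  moreover have "m x * (max 0 (H T x - M))\<^sup>2 \<le> mean (\<lambda>x. (max 0 (H T x - M))\<^sup>2)"
    unfolding mean_def using x m_nonneg
    by (intro member_le_sum[of x "cube n" "\<lambda>x. m x * (max 0 (H T x - M))\<^sup>2"]) auto
  ultimately have "m x * (max 0 (H T x - M))\<^sup>2 \<le> 0" by linarith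
  then have "max 0 (H T x - M) = 0"
    using m_pos[OF x] by (simp add: mult_le_0_iff)
  then show ?thesis by (simp add: max_def split: if_splits)
qed

text \<open>The commutator of \<open>grad i\<close> with the generator. Off the diagonal it is small because the rates
  depend weakly on the other coordinates.\<close>
definition commutator :: "nat \<Rightarrow> ((nat \<Rightarrow> real) \<Rightarrow> real) \<Rightarrow> (nat \<Rightarrow> real) \<Rightarrow> real" where
  "commutator i u x = (2 * c i x - 1) * grad i u x
     + (\<Sum>j\<in>{1..n}-{i}. grad i (c j) x * grad j u (flip i x))"

lemma grad_gen:
  assumes x: "x \<in> cube n" and i: "i \<in> {1..n}"
  shows "grad i (gen u) x = gen (grad i u) x + commutator i u x"
proof -
  have "grad i (gen u) x = (\<Sum>j=1..n. c j (flip i x) * grad j u (flip i x) - c j x * grad j u x)"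
    by (simp add: grad_def gen_def sum_subtractf)
  also have "\<dots> = (c i (flip i x) * grad i u (flip i x) - c i x * grad i u x)
     + (\<Sum>j\<in>{1..n}-{i}. c j (flip i x) * grad j u (flip i x) - c j x * grad j u x)"
    using i by (subst sum.remove[of _ i]) auto
  also have "c i (flip i x) * grad i u (flip i x) - c i x * grad i u x
     = c i x * grad i (grad i u) x + (2 * c i x - 1) * grad i u x"
    unfolding grad_flip rate_flip[OF x i] grad_grad_same by algebra
  also have "(\<Sum>j\<in>{1..n}-{i}. c j (flip i x) * grad j u (flip i x) - c j x * grad j u x)
     = (\<Sum>j\<in>{1..n}-{i}. c j x * grad j (grad i u) x + grad i (c j) x * grad j u (flip i x))"
  proof (intro sum.cong refl)
    fix j
    show "c j (flip i x) * grad j u (flip i x) - c j x * grad j u x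
      = c j x * grad j (grad i u) x + grad i (c j) x * grad j u (flip i x)"
      unfolding grad_grad_commute[of j i] unfolding grad_def[of i] by algebra
  qed
  also have "\<dots> = (\<Sum>j\<in>{1..n}-{i}. c j x * grad j (grad i u) x)
     + (\<Sum>j\<in>{1..n}-{i}. grad i (c j) x * grad j u (flip i x))"
    by (rule sum.distrib)
  finally have eq: "grad i (gen u) x = c i x * grad i (grad i u) x + (\<Sum>j\<in>{1..n}-{i}. c j x * grad j (grad i u) x)
     + commutator i u x" by (simp add: commutator_def)
  have "gen (grad i u) x = c i x * grad i (grad i u) x + (\<Sum>j\<in>{1..n}-{i}. c j x * grad j (grad i u) x)"
    unfolding gen_def using i by (subst sum.remove[of _ i]) auto
  then show ?thesis using eq by simp
qed

lemma R_quadratic: "(\<Sum>i=1..n. \<Sum>j=1..n. R j i * (p i * p j)) \<le> (\<Sum>i=1..n. (p i)\<^sup>2)"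
proof -
  have "(\<Sum>i=1..n. \<Sum>j=1..n. R j i * (p i * p j)) = (\<Sum>j=1..n. p j * (\<Sum>i=1..n. R j i * p i))"
    by (subst sum.swap) (simp add: sum_distrib_left mult_ac)
  also have "\<dots> \<le> (\<Sum>j=1..n. ((p j)\<^sup>2 + (\<Sum>i=1..n. R j i * p i)\<^sup>2) / 2)"
  proof (rule sum_mono)
    fix j
    have "0 \<le> (p j - (\<Sum>i=1..n. R j i * p i))\<^sup>2" by simp
    then show "p j * (\<Sum>i=1..n. R j i * p i) \<le> ((p j)\<^sup>2 + (\<Sum>i=1..n. R j i * p i)\<^sup>2) / 2"
      by (simp add: power2_eq_square algebra_simps)
  qed
  also have "\<dots> = ((\<Sum>j=1..n. (p j)\<^sup>2) + (\<Sum>j=1..n. (\<Sum>i=1..n. R j i * p i)\<^sup>2)) / 2"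
    by (simp add: sum.distrib sum_divide_distrib[symmetric])
  also have "\<dots> \<le> ((\<Sum>j=1..n. (p j)\<^sup>2) + 1 * (\<Sum>j=1..n. (p j)\<^sup>2)) / 2"
  proof -
    have "(1 - \<delta>)\<^sup>2 \<le> 1\<^sup>2" using \<delta>_pos \<delta>_less by (intro power_mono) auto
    then have "(1 - \<delta>)\<^sup>2 * (\<Sum>j=1..n. (p j)\<^sup>2) \<le> 1 * (\<Sum>j=1..n. (p j)\<^sup>2)"
      by (intro mult_right_mono) (auto intro: sum_nonneg)
    then show ?thesis using R_norm[of p] by simp
  qed
  finally show ?thesis by simp
qed

text \<open>A column of \<open>R\<close> is the image of a unit vector.\<close>
lemma R_column: "i \<in> {1..n} \<Longrightarrow> (\<Sum>j=1..n. (R j i)\<^sup>2) \<le> 1"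
proof -
  assume i: "i \<in> {1..n}"
  define v where "v j = (if j = i then 1 else 0 :: real)" for j
  have "(\<Sum>k=1..n. R j k * v k) = R j i" for j
    using i by (simp add: v_def if_distrib cong: if_cong)
  moreover have "(\<Sum>k=1..n. (v k)\<^sup>2) = 1"
    using i by (simp add: v_def if_distrib[where f="\<lambda>x. x\<^sup>2"] cong: if_cong)
  moreover have "(1 - \<delta>)\<^sup>2 \<le> 1\<^sup>2" using \<delta>_pos \<delta>_less by (intro power_mono) auto
  ultimately show ?thesis using R_norm[of v] by simp
qed

lemma gen_grad_sq:
  "gen (grad_sq u) x = (\<Sum>i=1..n. 2 * grad i u x * gen (grad i u) x)
     + (\<Sum>i=1..n. \<Sum>j=1..n. c j x * (grad j (grad i u) x)\<^sup>2)"
proof -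
  have "gen (grad_sq u) x = (\<Sum>j=1..n. \<Sum>i=1..n. c j x * ((grad i u (flip j x))\<^sup>2 - (grad i u x)\<^sup>2))"
    by (simp add: gen_def grad_def[of _ "grad_sq u"] grad_sq_def sum_subtractf[symmetric] sum_distrib_left)
  also have "\<dots> = (\<Sum>i=1..n. \<Sum>j=1..n. c j x * ((grad i u (flip j x))\<^sup>2 - (grad i u x)\<^sup>2))"
    by (rule sum.swap)
  also have "\<dots> = (\<Sum>i=1..n. \<Sum>j=1..n. 2 * grad i u x * (c j x * grad j (grad i u) x)
      + c j x * (grad j (grad i u) x)\<^sup>2)"
    by (intro sum.cong refl) (simp add: grad_def[of _ "grad _ u"] power2_eq_square algebra_simps)
  also have "\<dots> = (\<Sum>i=1..n. 2 * grad i u x * gen (grad i u) x)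
     + (\<Sum>i=1..n. \<Sum>j=1..n. c j x * (grad j (grad i u) x)\<^sup>2)"
    by (simp add: sum.distrib gen_def sum_distrib_left)
  finally show ?thesis .
qed

text \<open>A Bochner inequality: the curvature of the dynamics is bounded from below, uniformly in the
  dimension. The commutator contains gradients at the neighbour \<open>flip i x\<close>; they differ from those at
  \<open>x\<close> by second differences, which the terms \<open>(grad j (grad i u))\<^sup>2\<close> in \<open>gen (grad_sq u)\<close> absorb.\<close>
lemma bochner:
  assumes x: "x \<in> cube n"
  shows "(\<Sum>i=1..n. 2 * grad i u x * grad i (gen u) x) \<le> gen (grad_sq u) x + (2 + 1/\<beta>) * grad_sq u x"
proof -
  define p where "p i = \<bar>grad i u x\<bar>" for i
  define h where "h i j = c j x * (grad j (grad i u) x)\<^sup>2" for i j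
  have h0: "0 \<le> h i j" if "j \<in> {1..n}" for i j
    using rate_pos[OF x that] by (simp add: h_def)
  have comm: "2 * grad i u x * commutator i u x
      \<le> (\<Sum>j=1..n. 2 * (R j i * (p i * p j)) + h i j + (1/\<beta>) * ((R j i)\<^sup>2 * (p i)\<^sup>2))"
    (is "_ \<le> sum ?r _") if i: "i \<in> {1..n}" for i
  proof -
    have "2 * grad i u x * commutator i u x = 2 * (2 * c i x - 1) * (grad i u x)\<^sup>2
       + (\<Sum>j\<in>{1..n}-{i}. 2 * grad i u x * (grad i (c j) x * grad j u (flip i x)))"
      by (simp add: commutator_def sum_distrib_left power2_eq_square algebra_simps)
    also have "\<dots> \<le> ?r i + (\<Sum>j\<in>{1..n}-{i}. ?r j)"
    proof (intro add_mono sum_mono)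
      have "2 * (2 * c i x - 1) * (grad i u x)\<^sup>2 \<le> 4 * c i x * (grad i u x)\<^sup>2"
        by (simp add: algebra_simps)
      also have "\<dots> = h i i" by (simp add: h_def grad_grad_same power_mult_distrib)
      also have "\<dots> = ?r i" by (simp add: R_diag)
      finally show "2 * (2 * c i x - 1) * (grad i u x)\<^sup>2 \<le> ?r i" .
    next
      fix j assume j: "j \<in> {1..n} - {i}"
      define q where "q = \<bar>grad j (grad i u) x\<bar>"
      have Rb: "\<bar>grad i (c j) x\<bar> \<le> R j i" using R_rate[of j i x] i j x by auto
      have "grad j u (flip i x) = grad j u x + grad j (grad i u) x"
        unfolding grad_grad_commute[of j i] by (simp add: grad_def[of i])
      then have fl: "\<bar>grad j u (flip i x)\<bar> \<le> p j + q" by (simp add: p_def q_def)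
      have "2 * grad i u x * (grad i (c j) x * grad j u (flip i x))
         \<le> \<bar>2 * grad i u x * (grad i (c j) x * grad j u (flip i x))\<bar>" by simp
      also have "\<dots> = 2 * p i * (\<bar>grad i (c j) x\<bar> * \<bar>grad j u (flip i x)\<bar>)"
        by (simp add: abs_mult p_def)
      also have "\<dots> \<le> 2 * p i * (R j i * (p j + q))"
        using Rb fl R_nonneg[of j i] by (intro mult_left_mono mult_mono) (auto simp: p_def)
      also have "\<dots> = 2 * (R j i * (p i * p j)) + 2 * (R j i * p i) * q"
        by (simp add: algebra_simps)
      finally have b1: "2 * grad i u x * (grad i (c j) x * grad j u (flip i x))
         \<le> 2 * (R j i * (p i * p j)) + 2 * (R j i * p i) * q" .
      have b2: "2 * (R j i * p i) * q \<le> \<beta> * q\<^sup>2 + (1/\<beta>) * (R j i * p i)\<^sup>2"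
      proof -
        have "0 \<le> (1/\<beta>) * (\<beta> * q - R j i * p i)\<^sup>2" using \<beta>_pos by simp
        also have "\<dots> = \<beta> * q\<^sup>2 + (1/\<beta>) * (R j i * p i)\<^sup>2 - 2 * (R j i * p i) * q"
          using \<beta>_pos by (simp add: power2_eq_square field_simps)
        finally show ?thesis by simp
      qed
      have b3: "\<beta> * q\<^sup>2 \<le> h i j"
        unfolding h_def q_def power2_abs using rate_ge[OF x, of j] j by (intro mult_right_mono) auto
      show "2 * grad i u x * (grad i (c j) x * grad j u (flip i x)) \<le> ?r j"
        using b1 b2 b3 by (simp add: power_mult_distrib)
    qed
    also have "\<dots> = sum ?r {1..n}"
      using i by (subst sum.remove[of _ i]) auto
    finally show ?thesis .
  qed
  have split: "(\<Sum>i=1..n. 2 * grad i u x * grad i (gen u) x)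
      = (\<Sum>i=1..n. 2 * grad i u x * gen (grad i u) x) + (\<Sum>i=1..n. 2 * grad i u x * commutator i u x)"
    unfolding sum.distrib[symmetric] by (intro sum.cong refl) (simp add: grad_gen x algebra_simps)
  have "(\<Sum>i=1..n. 2 * grad i u x * commutator i u x)
      \<le> (\<Sum>i=1..n. \<Sum>j=1..n. 2 * (R j i * (p i * p j)) + h i j + (1/\<beta>) * ((R j i)\<^sup>2 * (p i)\<^sup>2))"
    by (intro sum_mono comm)
  also have "\<dots> = 2 * (\<Sum>i=1..n. \<Sum>j=1..n. R j i * (p i * p j)) + (\<Sum>i=1..n. \<Sum>j=1..n. h i j)
      + (1/\<beta>) * (\<Sum>i=1..n. (\<Sum>j=1..n. (R j i)\<^sup>2) * (p i)\<^sup>2)"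
    by (simp add: sum.distrib sum_distrib_left sum_distrib_right)
  also have "\<dots> \<le> 2 * (\<Sum>i=1..n. (p i)\<^sup>2) + (\<Sum>i=1..n. \<Sum>j=1..n. h i j) + (1/\<beta>) * (\<Sum>i=1..n. 1 * (p i)\<^sup>2)"
    using \<beta>_pos by (intro add_mono mult_left_mono R_quadratic sum_mono mult_right_mono R_column) auto
  also have "\<dots> = (2 + 1/\<beta>) * grad_sq u x + (\<Sum>i=1..n. \<Sum>j=1..n. h i j)"
    by (simp add: grad_sq_def p_def algebra_simps)
  finally show ?thesis unfolding split gen_grad_sq h_def by simp
qed

lemma gen_add_mult: "gen (\<lambda>x. g x + a * h x) x = gen g x + a * gen h x"
  by (simp add: gen_def grad_def sum.distrib[symmetric] sum_distrib_left algebra_simps)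

lemma gen_square:
  "x \<in> cube n \<Longrightarrow> 2 * u x * gen u x + \<beta> * grad_sq u x \<le> gen (\<lambda>x. (u x)\<^sup>2) x"
proof -
  assume x: "x \<in> cube n"
  have "2 * u x * gen u x + \<beta> * grad_sq u x = (\<Sum>i=1..n. 2 * u x * (c i x * grad i u x) + \<beta> * (grad i u x)\<^sup>2)"
    by (simp add: gen_def grad_sq_def sum_distrib_left sum.distrib)
  also have "\<dots> \<le> (\<Sum>i=1..n. 2 * u x * (c i x * grad i u x) + c i x * (grad i u x)\<^sup>2)"
    by (intro sum_mono add_left_mono mult_right_mono rate_ge x) auto
  also have "\<dots> = gen (\<lambda>x. (u x)\<^sup>2) x"
    unfolding gen_def by (intro sum.cong refl) (simp add: grad_def power2_eq_square algebra_simps)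
  finally show ?thesis .
qed

abbreviation "reg \<equiv> gradient_const \<beta>"

lemma reg_pos: "reg > 0" using \<beta>_pos by (rule gradient_const_pos)

text \<open>Bakry's argument: \<open>u\<^sup>2 + reg t |grad u|\<^sup>2\<close> is a subsolution for times up to \<open>1\<close>, as the square
  of \<open>u\<close> dissipates \<open>\<beta> |grad u|\<^sup>2\<close>. So the flow makes a bounded function Lipschitz, with constant of
  order \<open>1 / sqrt t\<close>.\<close>
lemma gradient_bound:
  assumes u: "heat u" and A: "\<And>x. x \<in> cube n \<Longrightarrow> (u 0 x)\<^sup>2 \<le> A"
    and s: "0 \<le> s" "s \<le> 1" and x: "x \<in> cube n"
  shows "reg * s * grad_sq (u s) x \<le> A"
proof -
  define H where "H t x = (u t x)\<^sup>2 + (reg * t) * grad_sq (u t) x" for t x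
  define D where "D t x = 2 * u t x * gen (u t) x
     + (reg * grad_sq (u t) x + (reg * t) * (\<Sum>i=1..n. 2 * grad i (u t) x * grad i (gen (u t)) x))" for t x
  have "H s x \<le> A"
  proof (rule max_principle[OF s(1) _ _ _ x])
    fix t x assume x: "x \<in> cube n" and t: "0 \<le> t" "t \<le> s"
    have dG: "((\<lambda>t. grad_sq (u t) x) has_real_derivative (\<Sum>i=1..n. 2 * grad i (u t) x * grad i (gen (u t)) x)) (at t)"
      unfolding grad_sq_def
      by (intro DERIV_sum) (auto intro!: derivative_eq_intros heat_grad[OF u x])
    show "((\<lambda>t. H t x) has_real_derivative D t x) (at t)"
      unfolding H_def D_def
      by (auto intro!: derivative_eq_intros heatD[OF u x] dG simp: algebra_simps)
    have G0: "0 \<le> grad_sq (u t) x" by (simp add: grad_sq_def sum_nonneg)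
    have k: "reg * (3 + 1/\<beta>) = \<beta>" using \<beta>_pos by (simp add: gradient_const_def add_pos_pos less_imp_neq[symmetric])
    have "reg * t * (2 + 1/\<beta>) \<le> reg * 1 * (2 + 1/\<beta>)"
      using reg_pos t s \<beta>_pos by (intro mult_right_mono mult_left_mono) auto
    then have "reg + reg * t * (2 + 1/\<beta>) \<le> \<beta>" using k by (simp add: algebra_simps)
    then have small: "(reg + reg * t * (2 + 1/\<beta>)) * grad_sq (u t) x \<le> \<beta> * grad_sq (u t) x"
      using G0 by (rule mult_right_mono)
    have "D t x \<le> 2 * u t x * gen (u t) x
      + (reg * grad_sq (u t) x + (reg * t) * (gen (grad_sq (u t)) x + (2 + 1/\<beta>) * grad_sq (u t) x))"
      unfolding D_def using bochner[OF x, of "u t"] reg_pos t by (intro add_left_mono mult_left_mono) auto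
    also have "\<dots> \<le> 2 * u t x * gen (u t) x + \<beta> * grad_sq (u t) x + (reg * t) * gen (grad_sq (u t)) x"
      using small by (simp add: algebra_simps)
    also have "\<dots> \<le> gen (\<lambda>x. (u t x)\<^sup>2) x + (reg * t) * gen (grad_sq (u t)) x"
      using gen_square[OF x, of "u t"] by simp
    also have "\<dots> = gen (H t) x" unfolding H_def gen_add_mult ..
    finally show "D t x \<le> gen (H t) x" .
  next
    fix x assume "x \<in> cube n" then show "H 0 x \<le> A" using A by (simp add: H_def)
  qed
  then show ?thesis unfolding H_def using zero_le_power2[of "u s x"] by linarith
qed

end

section \<open>Hypercontractivity\<close>

lemma holder_weighted:
  fixes p a b :: "'a \<Rightarrow> real"
  assumes fin: "finite A" and p: "\<And>x. x \<in> A \<Longrightarrow> 0 \<le> p x"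
    and a: "\<And>x. x \<in> A \<Longrightarrow> 0 \<le> a x" and b: "\<And>x. x \<in> A \<Longrightarrow> 0 \<le> b x"
    and \<theta>: "0 \<le> \<theta>" "\<theta> \<le> 1"
  shows "(\<Sum>x\<in>A. p x * (a x powr \<theta> * b x powr (1 - \<theta>)))
    \<le> (\<Sum>x\<in>A. p x * a x) powr \<theta> * (\<Sum>x\<in>A. p x * b x) powr (1 - \<theta>)"
proof -
  let ?A = "\<Sum>x\<in>A. p x * a x" and ?B = "\<Sum>x\<in>A. p x * b x"
  have A0: "?A \<ge> 0" "?B \<ge> 0" by (auto intro!: sum_nonneg mult_nonneg_nonneg p a b)
  consider "?A = 0" | "?B = 0" | "?A > 0" "?B > 0" using A0 by linarith
  then show ?thesis
  proof cases
    case 1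
    then have "p x * a x = 0" if "x \<in> A" for x
      using that fin sum_nonneg_eq_0_iff[of A "\<lambda>x. p x * a x"] p a by auto
    then have "(\<Sum>x\<in>A. p x * (a x powr \<theta> * b x powr (1 - \<theta>))) = 0"
      by (intro sum.neutral ballI) (metis mult_eq_0_iff powr_0)
    then show ?thesis using 1 by simp
  next
    case 2
    then have "p x * b x = 0" if "x \<in> A" for x
      using that fin sum_nonneg_eq_0_iff[of A "\<lambda>x. p x * b x"] p b by auto
    then have "(\<Sum>x\<in>A. p x * (a x powr \<theta> * b x powr (1 - \<theta>))) = 0"
      by (intro sum.neutral ballI) (metis mult_eq_0_iff powr_0)
    then show ?thesis using 2 by simp
  next
    case 3
    let ?C = "?A powr \<theta> * ?B powr (1 - \<theta>)"
    have C: "?C > 0" using 3 by simp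
    have "p x * (a x powr \<theta> * b x powr (1 - \<theta>)) \<le> ?C * (\<theta> * (p x * a x) / ?A + (1 - \<theta>) * (p x * b x) / ?B)"
      if x: "x \<in> A" for x
    proof (cases "a x = 0 \<or> b x = 0")
      case True
      then show ?thesis using C 3 p[OF x] a[OF x] b[OF x] \<theta> by (auto intro!: mult_nonneg_nonneg divide_nonneg_pos)
    next
      case False
      then have ab: "a x > 0" "b x > 0" using a[OF x] b[OF x] by auto
      have "(a x / ?A) powr \<theta> * (b x / ?B) powr (1 - \<theta>) \<le> \<theta> * (a x / ?A) + (1 - \<theta>) * (b x / ?B)"
        using \<theta> ab 3 by (intro Youngs_inequality_0) auto
      then have "?C * ((a x / ?A) powr \<theta> * (b x / ?B) powr (1 - \<theta>)) \<le> ?C * (\<theta> * (a x / ?A) + (1 - \<theta>) * (b x / ?B))"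
        using C by (intro mult_left_mono) auto
      moreover have "?C * ((a x / ?A) powr \<theta> * (b x / ?B) powr (1 - \<theta>)) = a x powr \<theta> * b x powr (1 - \<theta>)"
        using ab 3 by (simp add: powr_divide)
      ultimately have "p x * (a x powr \<theta> * b x powr (1 - \<theta>)) \<le> p x * (?C * (\<theta> * (a x / ?A) + (1 - \<theta>) * (b x / ?B)))"
        using p[OF x] by (intro mult_left_mono) auto
      then show ?thesis by (simp add: algebra_simps)
    qed
    then have "(\<Sum>x\<in>A. p x * (a x powr \<theta> * b x powr (1 - \<theta>)))
       \<le> (\<Sum>x\<in>A. ?C * (\<theta> * (p x * a x) / ?A + (1 - \<theta>) * (p x * b x) / ?B))"
      by (rule sum_mono)
    also have "\<dots> = ?C * (\<theta> * ?A / ?A + (1 - \<theta>) * ?B / ?B)"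
      unfolding sum_distrib_left[symmetric] sum.distrib sum_divide_distrib[symmetric] ..
    also have "\<dots> = ?C" using 3 by simp
    finally show ?thesis .
  qed
qed

text \<open>The Stroock-Varopoulos inequality, for a regularization of the power \<open>|r|\<^sup>q\<close> that is smooth at
  the origin. It follows from the pointwise inequality \<open>\<rho> g'\<^sup>2 \<le> \<psi>'\<close> between the derivatives of
  \<open>g = W powr (q/4)\<close> and \<open>\<psi> = r W powr (q/2 - 1)\<close>, where \<open>\<rho> = 4 (q - 1) / q\<^sup>2\<close>.\<close>
lemma stroock_varopoulos:
  fixes a b q \<epsilon> :: real
  assumes "\<epsilon> > 0" "q \<ge> 1"
  defines "W r \<equiv> r\<^sup>2 + \<epsilon>"
  shows "4 * (q - 1) / q\<^sup>2 * (W b powr (q/4) - W a powr (q/4))\<^sup>2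
    \<le> (b * W b powr (q/2 - 1) - a * W a powr (q/2 - 1)) * (b - a)"
proof -
  define \<rho> where "\<rho> = 4 * (q - 1) / q\<^sup>2"
  have \<rho>: "\<rho> \<ge> 0" "\<rho> * q\<^sup>2 = 4 * (q - 1)" using assms by (auto simp: \<rho>_def)
  have W: "W r > 0" for r using assms by (simp add: W_def add_nonneg_pos)
  have main: "\<rho> * (W b powr (q/4) - W a powr (q/4))\<^sup>2
    \<le> (b * W b powr (q/2 - 1) - a * W a powr (q/2 - 1)) * (b - a)" if ab: "a < b" for a b
  proof -
    \<comment> \<open>with the mean slope \<open>l\<close> of \<open>g\<close>, the function \<open>Q\<close> has a derivative of at least \<open>\<rho> (l - g')\<^sup>2\<close>\<close>
    define l where "l = (W b powr (q/4) - W a powr (q/4)) / (b - a)"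
    define Q where "Q r = r * W r powr (q/2 - 1) - 2 * l * \<rho> * W r powr (q/4) + \<rho> * l\<^sup>2 * r" for r
    have "Q a \<le> Q b"
    proof (rule DERIV_nonneg_imp_nondecreasing[where f=Q])
      show "a \<le> b" using ab by simp
      fix r :: real
      have dW: "(W has_real_derivative 2 * r) (at r)"
        unfolding W_def by (auto intro!: derivative_eq_intros)
      define P where "P = W r powr (q/4 - 1)"
      have P2: "W r powr (q/2 - 2) = P\<^sup>2" "W r powr (q/2 - 1) = P\<^sup>2 * W r"
      proof -
        show eq: "W r powr (q/2 - 2) = P\<^sup>2"
          by (simp add: P_def power2_eq_square powr_add[symmetric])
        show "W r powr (q/2 - 1) = P\<^sup>2 * W r"
          unfolding eq[symmetric] using W[of r] powr_mult_base[of "W r" "q/2 - 2"] by (simp add: mult.commute)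
      qed
      have "(Q has_real_derivative (W r powr (q/2 - 1) + r * ((q/2 - 1) * W r powr (q/2 - 2) * (2 * r))
          - 2 * l * \<rho> * ((q/4) * W r powr (q/4 - 1) * (2 * r)) + \<rho> * l\<^sup>2)) (at r)"
      proof -
        define A B where "A r = W r powr (q/2 - 1)" and "B r = W r powr (q/4)" for r
        have dA: "(A has_real_derivative (q/2 - 1) * W r powr (q/2 - 2) * (2 * r)) (at r)"
          unfolding A_def using DERIV_fun_powr[OF dW W, of "q/2 - 1"] by simp
        have dB: "(B has_real_derivative (q/4) * W r powr (q/4 - 1) * (2 * r)) (at r)"
          unfolding B_def using DERIV_fun_powr[OF dW W, of "q/4"] by simp
        have "((\<lambda>r. r * A r - 2 * l * \<rho> * B r + \<rho> * l\<^sup>2 * r) has_real_derivative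
          (A r + r * ((q/2 - 1) * W r powr (q/2 - 2) * (2 * r))
          - 2 * l * \<rho> * ((q/4) * W r powr (q/4 - 1) * (2 * r)) + \<rho> * l\<^sup>2)) (at r)"
          by (auto intro!: derivative_eq_intros dA dB)
        then show ?thesis by (simp add: Q_def[abs_def] A_def B_def)
      qed
      moreover have "W r powr (q/2 - 1) + r * ((q/2 - 1) * W r powr (q/2 - 2) * (2 * r))
          - 2 * l * \<rho> * ((q/4) * W r powr (q/4 - 1) * (2 * r)) + \<rho> * l\<^sup>2
        = P\<^sup>2 * \<epsilon> + \<rho> * (l - (q/2) * r * P)\<^sup>2"
      proof -
        have "\<rho> * (l - (q/2) * r * P)\<^sup>2 = \<rho> * l\<^sup>2 - \<rho> * l * q * r * P + (\<rho> * q\<^sup>2) * r\<^sup>2 * P\<^sup>2 / 4"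
          by (simp add: power2_eq_square algebra_simps)
        then show ?thesis
          unfolding P2 P_def[symmetric] \<rho>(2) by (simp add: W_def power2_eq_square algebra_simps)
      qed
      ultimately have "(Q has_real_derivative P\<^sup>2 * \<epsilon> + \<rho> * (l - (q/2) * r * P)\<^sup>2) (at r)" by simp
      moreover have "0 \<le> P\<^sup>2 * \<epsilon> + \<rho> * (l - (q/2) * r * P)\<^sup>2"
        using assms(1) \<rho>(1) by (intro add_nonneg_nonneg mult_nonneg_nonneg) auto
      ultimately show "\<exists>y. (Q has_real_derivative y) (at r) \<and> 0 \<le> y" by blast
    qed
    then have "\<rho> * (2 * l * (W b powr (q/4) - W a powr (q/4)) - l\<^sup>2 * (b - a))
        \<le> b * W b powr (q/2 - 1) - a * W a powr (q/2 - 1)"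
      by (simp add: Q_def algebra_simps)
    then have "\<rho> * (2 * l * (W b powr (q/4) - W a powr (q/4)) - l\<^sup>2 * (b - a)) * (b - a)
        \<le> (b * W b powr (q/2 - 1) - a * W a powr (q/2 - 1)) * (b - a)"
      using ab by (intro mult_right_mono) auto
    moreover have "(2 * l * (W b powr (q/4) - W a powr (q/4)) - l\<^sup>2 * (b - a)) * (b - a)
        = (W b powr (q/4) - W a powr (q/4))\<^sup>2"
    proof -
      have "l * (b - a) = W b powr (q/4) - W a powr (q/4)" using ab by (simp add: l_def)
      moreover have "(2 * l * G - l\<^sup>2 * (b - a)) * (b - a) = 2 * (l * (b - a)) * G - (l * (b - a))\<^sup>2" for G
        by (simp add: power2_eq_square algebra_simps)
      ultimately show ?thesis by (simp add: power2_eq_square)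
    qed
    ultimately show ?thesis by (simp add: mult.assoc)
  qed
  show ?thesis
  proof (cases a b rule: linorder_cases)
    case less then show ?thesis using main[of a b] by (simp add: \<rho>_def)
  next
    case greater
    have "(W a powr (q/4) - W b powr (q/4))\<^sup>2 = (W b powr (q/4) - W a powr (q/4))\<^sup>2"
      by (rule power2_commute)
    moreover have "(a * W a powr (q/2 - 1) - b * W b powr (q/2 - 1)) * (a - b)
      = (b * W b powr (q/2 - 1) - a * W a powr (q/2 - 1)) * (b - a)" by (simp add: algebra_simps)
    ultimately show ?thesis using main[of b a] greater by (simp add: \<rho>_def)
  qed simp
qed

context weakly_dependent
begin

text \<open>The squared \<open>L\<^sup>q\<close> norm, regularized at the zeros of \<open>h\<close> when \<open>\<epsilon> > 0\<close>.\<close>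
definition qnorm2 :: "real \<Rightarrow> real \<Rightarrow> ((nat \<Rightarrow> real) \<Rightarrow> real) \<Rightarrow> real" where
  "qnorm2 \<epsilon> q h = (mean (\<lambda>x. ((h x)\<^sup>2 + \<epsilon>) powr (q/2))) powr (2/q)"

text \<open>The flow dissipates the \<open>q\<close>-th power of the norm at least at the rate of the energy of the half
  power, to which the logarithmic Sobolev inequality applies.\<close>
lemma mean_gen_power_le:
  assumes "\<epsilon> > 0" "q \<ge> 1"
  shows "mean (\<lambda>x. v x * ((v x)\<^sup>2 + \<epsilon>) powr (q/2 - 1) * gen v x)
    \<le> - (2 * \<beta> * (q - 1) / q\<^sup>2) * (\<Sum>i=1..n. mean (\<lambda>x. (grad i (\<lambda>x. ((v x)\<^sup>2 + \<epsilon>) powr (q/4)) x)\<^sup>2))"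
proof -
  let ?\<psi> = "\<lambda>x. v x * ((v x)\<^sup>2 + \<epsilon>) powr (q/2 - 1)" and ?g = "\<lambda>x. ((v x)\<^sup>2 + \<epsilon>) powr (q/4)"
  let ?\<rho> = "4 * (q - 1) / q\<^sup>2"
  have \<rho>: "?\<rho> \<ge> 0" using assms by simp
  have "(\<Sum>i=1..n. (\<beta> * ?\<rho>) * mean (\<lambda>x. (grad i ?g x)\<^sup>2)) \<le> (\<Sum>i=1..n. mean (\<lambda>x. c i x * (grad i ?\<psi> x * grad i v x)))"
    unfolding mean_mult[symmetric]
  proof (intro sum_mono mean_mono)
    fix i x assume i: "i \<in> {1..n}" and x: "x \<in> cube n"
    have sv: "?\<rho> * (grad i ?g x)\<^sup>2 \<le> grad i ?\<psi> x * grad i v x"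
      unfolding grad_def by (rule stroock_varopoulos[OF assms])
    have "\<beta> * (?\<rho> * (grad i ?g x)\<^sup>2) \<le> c i x * (?\<rho> * (grad i ?g x)\<^sup>2)"
      by (intro mult_right_mono rate_ge x i mult_nonneg_nonneg[OF \<rho>]) auto
    also have "\<dots> \<le> c i x * (grad i ?\<psi> x * grad i v x)"
      using sv rate_pos[OF x i] by (intro mult_left_mono) auto
    finally show "\<beta> * ?\<rho> * (grad i ?g x)\<^sup>2 \<le> c i x * (grad i ?\<psi> x * grad i v x)" by (simp add: mult.assoc)
  qed
  then have "(1/2) * ((\<beta> * ?\<rho>) * (\<Sum>i=1..n. mean (\<lambda>x. (grad i ?g x)\<^sup>2))) \<le> energy ?\<psi> v"
    unfolding energy_def sum_distrib_left[symmetric] by simp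
  then show ?thesis unfolding mean_gen by (simp add: algebra_simps)
qed

text \<open>Gross's argument: along the heat flow, with a source \<open>e\<close>, the norm with the moving exponent
  \<open>q0 + \<sigma> t\<close> is driven by the source alone. The motion of the exponent produces an entropy, which
  the logarithmic Sobolev inequality bounds by the energy that the flow dissipates; the condition on
  \<open>\<sigma>\<close> is the balance of the two. For \<open>q = 1\<close> it forces a constant exponent.\<close>
lemma qnorm2_deriv:
  fixes v e :: "real \<Rightarrow> (nat \<Rightarrow> real) \<Rightarrow> real" and q0 \<sigma> t \<epsilon> :: real
  defines "q \<equiv> q0 + \<sigma> * t"
  assumes \<epsilon>: "\<epsilon> > 0" and \<sigma>: "0 \<le> \<sigma>" "\<sigma> * \<kappa> \<le> 2 * \<beta> * (q - 1)" and q: "1 \<le> q"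
    and v: "\<And>x. x \<in> cube n \<Longrightarrow> ((\<lambda>t. v t x) has_real_derivative gen (v t) x + e t x) (at t)"
  shows "\<exists>D. ((\<lambda>s. qnorm2 \<epsilon> (q0 + \<sigma> * s) (v s)) has_real_derivative D) (at t) \<and>
    D \<le> 2 * (mean (\<lambda>x. ((v t x)\<^sup>2 + \<epsilon>) powr (q/2))) powr (2/q - 1)
          * mean (\<lambda>x. ((v t x)\<^sup>2 + \<epsilon>) powr ((q-1)/2) * \<bar>e t x\<bar>)"
proof -
  define W where "W s x = (v s x)\<^sup>2 + \<epsilon>" for s x
  define N where "N s = mean (\<lambda>x. W s x powr ((q0 + \<sigma> * s)/2))" for s
  have Wpos: "W s x > 0" for s x using \<epsilon> by (simp add: W_def add_nonneg_pos)
  have Npos: "N s > 0" for s unfolding N_def by (rule mean_pos) (use Wpos in \<open>simp add: less_imp_neq[symmetric]\<close>)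
  define N' where "N' = mean (\<lambda>x. W t x powr (q/2) * (\<sigma>/2 * ln (W t x)
      + 2 * v t x * (gen (v t) x + e t x) * (q/2) / W t x))"
  have dN: "(N has_real_derivative N') (at t)"
    unfolding N_def N'_def
  proof (rule mean_deriv)
    fix x assume x: "x \<in> cube n"
    have dW: "((\<lambda>s. W s x) has_real_derivative 2 * v t x * (gen (v t) x + e t x)) (at t)"
      unfolding W_def by (auto intro!: derivative_eq_intros v[OF x])
    have dq: "((\<lambda>s. (q0 + \<sigma> * s)/2) has_real_derivative \<sigma>/2) (at t)"
      by (auto intro!: derivative_eq_intros)
    show "((\<lambda>s. W s x powr ((q0 + \<sigma> * s)/2)) has_real_derivative
       W t x powr (q/2) * (\<sigma>/2 * ln (W t x) + 2 * v t x * (gen (v t) x + e t x) * (q/2) / W t x)) (at t)"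
      using DERIV_powr[OF dW Wpos dq] by (simp add: q_def)
  qed
  have dq: "((\<lambda>s. 2 / (q0 + \<sigma> * s)) has_real_derivative - 2 * \<sigma> / q\<^sup>2) (at t)"
    using q by (auto intro!: derivative_eq_intros simp: q_def power2_eq_square)
  have dl: "((\<lambda>s. qnorm2 \<epsilon> (q0 + \<sigma> * s) (v s)) has_real_derivative
      N t powr (2/q) * (- 2 * \<sigma> / q\<^sup>2 * ln (N t) + N' * (2/q) / N t)) (at t)"
    using DERIV_powr[OF dN Npos dq] by (simp add: qnorm2_def N_def W_def q_def)
  have Npw: "N t powr (2/q) = N t powr (2/q - 1) * N t"
    using Npos[of t] by (simp add: powr_mult_base mult.commute)
  define g where "g x = W t x powr (q/4)" for x
  define E where "E = (\<Sum>i=1..n. mean (\<lambda>x. (grad i g x)\<^sup>2))"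
  have g2: "(g x)\<^sup>2 = W t x powr (q/2)" for x
    using Wpos[of t x] by (simp add: g_def power2_eq_square powr_add[symmetric])
  define X where "X = mean (\<lambda>x. v t x * W t x powr (q/2 - 1) * gen (v t) x)"
  define Y where "Y = mean (\<lambda>x. v t x * W t x powr (q/2 - 1) * e t x)"
  define L where "L = mean (\<lambda>x. (g x)\<^sup>2 * ln ((g x)\<^sup>2))"
  have N'_eq: "N' = (\<sigma>/q) * L + q * (X + Y)"
    unfolding N'_def L_def X_def Y_def mean_add[symmetric] mean_mult[symmetric]
  proof (rule mean_cong)
    fix x assume "x \<in> cube n"
    have p: "W t x powr (q/2) / W t x = W t x powr (q/2 - 1)"
      using Wpos[of t x] by (simp add: powr_diff)
    have "W t x powr (q/2) * (\<sigma>/2 * ln (W t x) + 2 * v t x * (gen (v t) x + e t x) * (q/2) / W t x)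
      = W t x powr (q/2) * (\<sigma>/2 * ln (W t x)) + (W t x powr (q/2) / W t x) * (v t x * (gen (v t) x + e t x) * q)"
      using Wpos[of t x] by (simp add: field_simps)
    also have "\<dots> = (\<sigma>/q) * ((g x)\<^sup>2 * ln ((g x)\<^sup>2)) + q * (v t x * W t x powr (q/2 - 1) * gen (v t) x + v t x * W t x powr (q/2 - 1) * e t x)"
      unfolding p g2 using Wpos[of t x] q by (simp add: ln_powr algebra_simps)
    finally show "W t x powr (q/2) * (\<sigma>/2 * ln (W t x) + 2 * v t x * (gen (v t) x + e t x) * (q/2) / W t x)
      = (\<sigma>/q) * ((g x)\<^sup>2 * ln ((g x)\<^sup>2)) + q * (v t x * W t x powr (q/2 - 1) * gen (v t) x + v t x * W t x powr (q/2 - 1) * e t x)" .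
  qed
  have Ng: "N t = mean (\<lambda>x. (g x)\<^sup>2)" unfolding N_def g2 by (simp add: q_def)
  have lsi: "L - N t * ln (N t) \<le> \<kappa> * E"
    unfolding Ng L_def E_def by (rule log_sobolev) (use Wpos in \<open>simp add: g_def less_imp_neq[symmetric]\<close>)
  have E0: "0 \<le> E" unfolding E_def by (intro sum_nonneg mean_nonneg) auto
  have X: "X \<le> - (2 * \<beta> * (q - 1) / q\<^sup>2) * E"
    unfolding X_def W_def E_def g_def by (rule mean_gen_power_le[OF \<epsilon> q])
  have Y: "Y \<le> mean (\<lambda>x. W t x powr ((q-1)/2) * \<bar>e t x\<bar>)"
    unfolding Y_def
  proof (rule mean_mono)
    fix x assume "x \<in> cube n"
    have "\<bar>v t x\<bar> \<le> W t x powr (1/2)"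
      unfolding powr_half_sqrt[OF less_imp_le[OF Wpos]]
      by (rule real_le_rsqrt) (use \<epsilon> in \<open>simp add: W_def\<close>)
    then have "\<bar>v t x\<bar> * W t x powr (q/2 - 1) \<le> W t x powr (1/2) * W t x powr (q/2 - 1)"
      by (intro mult_right_mono) auto
    also have "\<dots> = W t x powr ((q-1)/2)"
      unfolding powr_add[symmetric] by (simp add: field_simps)
    finally have "\<bar>v t x\<bar> * W t x powr (q/2 - 1) * \<bar>e t x\<bar> \<le> W t x powr ((q-1)/2) * \<bar>e t x\<bar>"
      by (intro mult_right_mono) auto
    moreover have "v t x * W t x powr (q/2 - 1) * e t x \<le> \<bar>v t x\<bar> * W t x powr (q/2 - 1) * \<bar>e t x\<bar>"
      using abs_ge_self[of "v t x * W t x powr (q/2 - 1) * e t x"] by (simp add: abs_mult)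
    ultimately show "v t x * W t x powr (q/2 - 1) * e t x \<le> W t x powr ((q-1)/2) * \<bar>e t x\<bar>" by linarith
  qed
  have "N t powr (2/q) * (- 2 * \<sigma> / q\<^sup>2 * ln (N t) + N' * (2/q) / N t)
     = 2 * N t powr (2/q - 1) * ((\<sigma> / q\<^sup>2) * (L - N t * ln (N t)) + X + Y)"
    unfolding Npw N'_eq using Npos[of t] q by (simp add: power2_eq_square field_simps)
  also have "\<dots> \<le> 2 * N t powr (2/q - 1) * mean (\<lambda>x. W t x powr ((q-1)/2) * \<bar>e t x\<bar>)"
  proof (rule mult_left_mono)
    have "(\<sigma> / q\<^sup>2) * (L - N t * ln (N t)) \<le> (\<sigma> / q\<^sup>2) * (\<kappa> * E)"
      using \<sigma> by (intro mult_left_mono lsi) auto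
    also have "\<dots> = (\<sigma> * \<kappa>) * (E / q\<^sup>2)" by simp
    also have "\<dots> \<le> (2 * \<beta> * (q - 1)) * (E / q\<^sup>2)"
      using \<sigma> E0 by (intro mult_right_mono) auto
    finally show "(\<sigma> / q\<^sup>2) * (L - N t * ln (N t)) + X + Y \<le> mean (\<lambda>x. W t x powr ((q-1)/2) * \<bar>e t x\<bar>)"
      using X Y by simp
  qed simp
  finally have "N t powr (2/q) * (- 2 * \<sigma> / q\<^sup>2 * ln (N t) + N' * (2/q) / N t)
     \<le> 2 * N t powr (2/q - 1) * mean (\<lambda>x. W t x powr ((q-1)/2) * \<bar>e t x\<bar>)" .
  then show ?thesis using dl unfolding N_def W_def q_def by blast
qed

lemma qnorm2_mono_eps:
  assumes "q > 0" "0 \<le> \<epsilon>" shows "qnorm2 0 q h \<le> qnorm2 \<epsilon> q h"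
  unfolding qnorm2_def using assms
  by (intro powr_mono2 mean_mono mean_nonneg) auto

lemma qnorm2_tendsto:
  assumes "q > 0" shows "((\<lambda>\<epsilon>. qnorm2 \<epsilon> q h) \<longlongrightarrow> qnorm2 0 q h) (at_right 0)"
proof -
  have ev: "\<forall>\<^sub>F \<epsilon> in at_right (0::real). 0 < \<epsilon>" by (simp add: eventually_at_right_less)
  have "((\<lambda>\<epsilon>. (\<Sum>x\<in>cube n. m x * ((h x)\<^sup>2 + \<epsilon>) powr (q/2)) powr (2/q))
     \<longlongrightarrow> (\<Sum>x\<in>cube n. m x * ((h x)\<^sup>2 + 0) powr (q/2)) powr (2/q)) (at_right 0)"
  proof (intro tendsto_powr' tendsto_sum tendsto_mult tendsto_add tendsto_const tendsto_ident_at disjI2 conjI)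
    show "\<forall>\<^sub>F \<epsilon> in at_right 0. 0 \<le> (\<Sum>x\<in>cube n. m x * ((h x)\<^sup>2 + \<epsilon>) powr (q/2))"
      by (intro always_eventually allI sum_nonneg mult_nonneg_nonneg m_nonneg) auto
    show "\<forall>\<^sub>F \<epsilon> in at_right 0. 0 \<le> (h x)\<^sup>2 + \<epsilon>" for x
      using ev by eventually_elim simp
  qed (use assms in auto)
  then show ?thesis unfolding qnorm2_def mean_def .
qed

lemma qnorm2_2: "qnorm2 0 2 h = mean (\<lambda>x. (h x)\<^sup>2)"
  by (simp add: qnorm2_def mean_nonneg)

lemma qnorm2_1: "qnorm2 0 1 h = (mean (\<lambda>x. \<bar>h x\<bar>))\<^sup>2"
proof -
  have "((h x)\<^sup>2 + 0) powr (1/2) = \<bar>h x\<bar>" for x by (simp add: powr_half_sqrt)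
  then show ?thesis by (simp add: qnorm2_def mean_nonneg)
qed

lemma qnorm2_nonneg: "0 \<le> qnorm2 \<epsilon> q h" by (simp add: qnorm2_def)

lemma mean_flip_le:
  assumes i: "i \<in> {1..n}" and h: "\<And>x. x \<in> cube n \<Longrightarrow> 0 \<le> h x"
  shows "mean (\<lambda>x. h (flip i x)) \<le> (1/\<beta>) * mean h"
proof -
  have "mean (\<lambda>x. h (flip i x)) = (\<Sum>x\<in>cube n. m (flip i (flip i x)) * h (flip i x))" by (simp add: mean_def)
  also have "\<dots> = (\<Sum>x\<in>cube n. m (flip i x) * h x)"
    by (rule sum_flip[of "cube n" i "\<lambda>x. m (flip i x) * h x"]) (use i in simp)
  also have "\<dots> \<le> (\<Sum>x\<in>cube n. (1/\<beta> * m x) * h x)"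
    by (intro sum_mono mult_right_mono m_flip_le i h)
  finally show ?thesis by (simp add: mean_def sum_distrib_left mult.assoc)
qed

text \<open>Growth of a family of regularized norms, with the regularization removed at the end.\<close>
lemma qnorm2_family:
  fixes v e :: "'i \<Rightarrow> real \<Rightarrow> (nat \<Rightarrow> real) \<Rightarrow> real"
  assumes J: "finite J" and T: "0 \<le> T" and \<sigma>: "0 \<le> \<sigma>" "\<sigma> * \<kappa> \<le> 2 * \<beta> * (q0 - 1)" and q0: "1 \<le> q0"
    and v: "\<And>i t x. i \<in> J \<Longrightarrow> x \<in> cube n \<Longrightarrow> ((\<lambda>t. v i t x) has_real_derivative gen (v i t) x + e i t x) (at t)"
    and growth: "\<And>\<epsilon> t q. 0 < \<epsilon> \<Longrightarrow> 1 \<le> q \<Longrightarrow>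
      (\<Sum>i\<in>J. 2 * (mean (\<lambda>x. ((v i t x)\<^sup>2 + \<epsilon>) powr (q/2))) powr (2/q - 1)
          * mean (\<lambda>x. ((v i t x)\<^sup>2 + \<epsilon>) powr ((q-1)/2) * \<bar>e i t x\<bar>)) \<le> K * (\<Sum>i\<in>J. qnorm2 \<epsilon> q (v i t))"
  shows "(\<Sum>i\<in>J. qnorm2 0 (q0 + \<sigma> * T) (v i T)) \<le> exp (K * T) * (\<Sum>i\<in>J. qnorm2 0 q0 (v i 0))"
proof -
  have eps: "(\<Sum>i\<in>J. qnorm2 0 (q0 + \<sigma> * T) (v i T)) \<le> exp (K * T) * (\<Sum>i\<in>J. qnorm2 \<epsilon> q0 (v i 0))"
    if \<epsilon>: "\<epsilon> > 0" for \<epsilon>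
  proof -
    define Z where "Z t = (\<Sum>i\<in>J. qnorm2 \<epsilon> (q0 + \<sigma> * t) (v i t))" for t
    have "exp (- K * T) * Z T \<le> exp (- K * 0) * Z 0"
    proof (rule DERIV_nonpos_imp_nonincreasing[OF T, where f="\<lambda>t. exp (- K * t) * Z t"])
      fix t assume t: "0 \<le> t" "t \<le> T"
      let ?q = "q0 + \<sigma> * t"
      have q: "1 \<le> ?q" "q0 \<le> ?q" using q0 \<sigma> t by (auto intro: add_increasing2)
      have "2 * \<beta> * (q0 - 1) \<le> 2 * \<beta> * (?q - 1)" using q \<beta>_pos by (intro mult_left_mono) auto
      then have \<sigma>q: "\<sigma> * \<kappa> \<le> 2 * \<beta> * (?q - 1)" using \<sigma> by linarith
      define B where "B i = 2 * (mean (\<lambda>x. ((v i t x)\<^sup>2 + \<epsilon>) powr (?q/2))) powr (2/?q - 1)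
          * mean (\<lambda>x. ((v i t x)\<^sup>2 + \<epsilon>) powr ((?q-1)/2) * \<bar>e i t x\<bar>)" for i
      have "\<forall>i\<in>J. \<exists>D. ((\<lambda>s. qnorm2 \<epsilon> (q0 + \<sigma> * s) (v i s)) has_real_derivative D) (at t) \<and> D \<le> B i"
        unfolding B_def using qnorm2_deriv[OF \<epsilon> \<sigma>(1) \<sigma>q q(1)] v by blast
      then obtain D where D: "\<And>i. i \<in> J \<Longrightarrow> ((\<lambda>s. qnorm2 \<epsilon> (q0 + \<sigma> * s) (v i s)) has_real_derivative D i) (at t)"
        "\<And>i. i \<in> J \<Longrightarrow> D i \<le> B i" by metis
      have "(Z has_real_derivative (\<Sum>i\<in>J. D i)) (at t)"
        unfolding Z_def by (intro DERIV_sum D)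
      then have "((\<lambda>t. exp (- K * t) * Z t) has_real_derivative exp (- K * t) * ((\<Sum>i\<in>J. D i) - K * Z t)) (at t)"
        by (auto intro!: derivative_eq_intros simp: algebra_simps)
      moreover have "(\<Sum>i\<in>J. D i) \<le> K * Z t"
      proof -
        have "(\<Sum>i\<in>J. D i) \<le> (\<Sum>i\<in>J. B i)" by (intro sum_mono D)
        also have "\<dots> \<le> K * Z t" unfolding B_def Z_def by (rule growth[OF \<epsilon> q(1)])
        finally show ?thesis .
      qed
      ultimately show "\<exists>y. ((\<lambda>t. exp (- K * t) * Z t) has_real_derivative y) (at t) \<and> y \<le> 0"
        by (intro exI conjI) (auto simp: mult_le_0_iff)
    qed
    then have "exp (K * T) * (exp (- K * T) * Z T) \<le> exp (K * T) * Z 0" by (intro mult_left_mono) auto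
    then have "Z T \<le> exp (K * T) * Z 0" by (simp add: mult.assoc[symmetric] exp_add[symmetric])
    moreover have "(\<Sum>i\<in>J. qnorm2 0 (q0 + \<sigma> * T) (v i T)) \<le> Z T"
      unfolding Z_def using \<epsilon> q0 \<sigma> T by (intro sum_mono qnorm2_mono_eps) (auto intro: add_pos_nonneg)
    ultimately show ?thesis by (simp add: Z_def)
  qed
  have "((\<lambda>\<epsilon>. exp (K * T) * (\<Sum>i\<in>J. qnorm2 \<epsilon> q0 (v i 0))) \<longlongrightarrow> exp (K * T) * (\<Sum>i\<in>J. qnorm2 0 q0 (v i 0))) (at_right 0)"
    using q0 by (intro tendsto_intros qnorm2_tendsto) auto
  then show ?thesis
  proof (rule tendsto_lowerbound)
    have "\<forall>\<^sub>F \<epsilon> in at_right (0::real). 0 < \<epsilon>" by (simp add: eventually_at_right_less)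
    then show "\<forall>\<^sub>F \<epsilon> in at_right 0. (\<Sum>i\<in>J. qnorm2 0 (q0 + \<sigma> * T) (v i T)) \<le> exp (K * T) * (\<Sum>i\<in>J. qnorm2 \<epsilon> q0 (v i 0))"
      by eventually_elim (rule eps)
  qed simp
qed

lemma hypercontractivity:
  assumes u: "heat u" and T: "0 \<le> T" and \<sigma>: "0 \<le> \<sigma>" "\<sigma> * \<kappa> \<le> 2 * \<beta> * (q0 - 1)" and q0: "1 \<le> q0"
  shows "qnorm2 0 (q0 + \<sigma> * T) (u T) \<le> qnorm2 0 q0 (u 0)"
  using qnorm2_family[of "{()}" T \<sigma> q0 "\<lambda>_. u" "\<lambda>_ _ _. 0" 0] T \<sigma> q0 heatD[OF u] by simp

lemma commutator_abs_le:
  assumes x: "x \<in> cube n" and i: "i \<in> {1..n}"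
    and w: "\<And>j y. \<bar>grad j u y\<bar> \<le> w j y"
  shows "\<bar>commutator i u x\<bar> \<le> w i x + (\<Sum>j=1..n. R j i * w j (flip i x))"
proof -
  have "\<bar>commutator i u x\<bar> \<le> \<bar>(2 * c i x - 1) * grad i u x\<bar>
      + (\<Sum>j\<in>{1..n}-{i}. \<bar>grad i (c j) x * grad j u (flip i x)\<bar>)"
    unfolding commutator_def by (intro order_trans[OF abs_triangle_ineq] add_left_mono sum_abs)
  also have "\<dots> \<le> w i x + (\<Sum>j\<in>{1..n}-{i}. R j i * w j (flip i x))"
  proof (intro add_mono sum_mono)
    have "\<bar>2 * c i x - 1\<bar> \<le> 1" using rate_pos[OF x i] rate_less_1[OF x i] by (intro abs_leI) auto
    then have "\<bar>2 * c i x - 1\<bar> * \<bar>grad i u x\<bar> \<le> 1 * w i x" using w by (intro mult_mono) auto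
    then show "\<bar>(2 * c i x - 1) * grad i u x\<bar> \<le> w i x" by (simp add: abs_mult)
    fix j assume j: "j \<in> {1..n} - {i}"
    have "\<bar>grad i (c j) x\<bar> * \<bar>grad j u (flip i x)\<bar> \<le> R j i * w j (flip i x)"
      using R_rate[of j i x] j i x w R_nonneg by (intro mult_mono) auto
    then show "\<bar>grad i (c j) x * grad j u (flip i x)\<bar> \<le> R j i * w j (flip i x)" by (simp add: abs_mult)
  qed
  also have "(\<Sum>j\<in>{1..n}-{i}. R j i * w j (flip i x)) = (\<Sum>j=1..n. R j i * w j (flip i x))"
    using i by (subst sum.remove[of "{1..n}" i]) (auto simp: R_diag)
  finally show ?thesis .
qed

text \<open>By Hoelder, each entry of the commutator contributes a product of two norms; the flip costs a
  factor \<open>1/\<beta>\<close>. What remains is a quadratic form with the matrix \<open>R\<close>, so the constant is free of the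
  dimension.\<close>
lemma commutator_growth:
  assumes \<epsilon>: "0 < \<epsilon>" and q: "1 \<le> q"
  shows "(\<Sum>i=1..n. 2 * (mean (\<lambda>x. ((grad i u x)\<^sup>2 + \<epsilon>) powr (q/2))) powr (2/q - 1)
          * mean (\<lambda>x. ((grad i u x)\<^sup>2 + \<epsilon>) powr ((q-1)/2) * \<bar>commutator i u x\<bar>))
    \<le> (2 + 2/\<beta>) * (\<Sum>i=1..n. qnorm2 \<epsilon> q (grad i u))"
proof -
  define W where "W i x = (grad i u x)\<^sup>2 + \<epsilon>" for i x
  define N where "N i = mean (\<lambda>x. W i x powr (q/2))" for i
  define y where "y i = N i powr (1/q)" for i
  have Wpos: "W i x > 0" for i x using \<epsilon> by (simp add: W_def add_nonneg_pos)
  have Npos: "N i > 0" for i unfolding N_def by (rule mean_pos) (use Wpos in \<open>simp add: less_imp_neq[symmetric]\<close>)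
  have y2: "qnorm2 \<epsilon> q (grad i u) = (y i)\<^sup>2" for i
    by (simp add: qnorm2_def y_def N_def W_def power2_eq_square powr_add[symmetric])
  have trm: "2 * N i powr (2/q - 1) * mean (\<lambda>x. W i x powr ((q-1)/2) * \<bar>commutator i u x\<bar>)
     \<le> 2 * (y i)\<^sup>2 + (2/\<beta>) * (\<Sum>j=1..n. R j i * (y i * y j))" if i: "i \<in> {1..n}" for i
  proof -
    have cross: "mean (\<lambda>x. W i x powr ((q-1)/2) * W j (flip i x) powr (1/2)) \<le> (1/\<beta>) * (N i powr (1 - 1/q) * y j)" for j
    proof -
      have "mean (\<lambda>x. W i x powr ((q-1)/2) * W j (flip i x) powr (1/2))
          = mean (\<lambda>x. (W i x powr (q/2)) powr (1 - 1/q) * (W j (flip i x) powr (q/2)) powr (1 - (1 - 1/q)))"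
      proof (rule mean_cong)
        fix x
        have ee: "q/2 * (1 - 1/q) = (q-1)/2" "q/2 * (1 - (1 - 1/q)) = 1/2" using q by (auto simp: field_simps)
        show "W i x powr ((q-1)/2) * W j (flip i x) powr (1/2)
          = (W i x powr (q/2)) powr (1 - 1/q) * (W j (flip i x) powr (q/2)) powr (1 - (1 - 1/q))"
          unfolding powr_powr ee ..
      qed
      also have "\<dots> \<le> mean (\<lambda>x. W i x powr (q/2)) powr (1 - 1/q) * mean (\<lambda>x. W j (flip i x) powr (q/2)) powr (1 - (1 - 1/q))"
        unfolding mean_def using q by (intro holder_weighted m_nonneg) auto
      also have "\<dots> = N i powr (1 - 1/q) * mean (\<lambda>x. W j (flip i x) powr (q/2)) powr (1/q)"
        by (simp add: N_def)
      also have "\<dots> \<le> N i powr (1 - 1/q) * ((1/\<beta>) * y j)"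
      proof (rule mult_left_mono)
        have "mean (\<lambda>x. W j (flip i x) powr (q/2)) powr (1/q) \<le> ((1/\<beta>) * N j) powr (1/q)"
          unfolding N_def using q mean_flip_le[OF i, of "\<lambda>x. W j x powr (q/2)"]
          by (intro powr_mono2 mean_nonneg) auto
        also have "\<dots> = (1/\<beta>) powr (1/q) * y j" unfolding y_def by (rule powr_mult)
        also have "\<dots> \<le> (1/\<beta>) powr 1 * y j"
          using \<beta>_pos \<beta>_le_half q by (intro mult_right_mono powr_mono) (auto simp: y_def)
        finally show "mean (\<lambda>x. W j (flip i x) powr (q/2)) powr (1/q) \<le> (1/\<beta>) * y j"
          using \<beta>_pos by simp
      qed simp
      finally show ?thesis by (simp add: mult_ac)
    qed
    have own: "mean (\<lambda>x. W i x powr ((q-1)/2) * W i x powr (1/2)) = N i"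
      unfolding N_def powr_add[symmetric] by (simp add: field_simps)
    have "mean (\<lambda>x. W i x powr ((q-1)/2) * \<bar>commutator i u x\<bar>)
       \<le> mean (\<lambda>x. W i x powr ((q-1)/2) * W i x powr (1/2)
           + (\<Sum>j=1..n. R j i * (W i x powr ((q-1)/2) * W j (flip i x) powr (1/2))))"
    proof (rule mean_mono)
      fix x assume x: "x \<in> cube n"
      have "\<bar>grad j u y\<bar> \<le> W j y powr (1/2)" for j y
        unfolding powr_half_sqrt[OF less_imp_le[OF Wpos]]
        by (rule real_le_rsqrt) (use \<epsilon> in \<open>simp add: W_def\<close>)
      then have "W i x powr ((q-1)/2) * \<bar>commutator i u x\<bar>
         \<le> W i x powr ((q-1)/2) * (W i x powr (1/2) + (\<Sum>j=1..n. R j i * W j (flip i x) powr (1/2)))"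
        by (intro mult_left_mono commutator_abs_le[OF x i, of u "\<lambda>j y. W j y powr (1/2)"]) auto
      then show "W i x powr ((q-1)/2) * \<bar>commutator i u x\<bar> \<le> W i x powr ((q-1)/2) * W i x powr (1/2)
           + (\<Sum>j=1..n. R j i * (W i x powr ((q-1)/2) * W j (flip i x) powr (1/2)))"
        by (simp add: distrib_left sum_distrib_left mult_ac)
    qed
    also have "\<dots> = N i + (\<Sum>j=1..n. R j i * mean (\<lambda>x. W i x powr ((q-1)/2) * W j (flip i x) powr (1/2)))"
      unfolding mean_add mean_sum own mean_mult ..
    also have "\<dots> \<le> N i + (\<Sum>j=1..n. R j i * ((1/\<beta>) * (N i powr (1 - 1/q) * y j)))"
      by (intro add_left_mono sum_mono mult_left_mono cross R_nonneg)
    finally have "2 * N i powr (2/q - 1) * mean (\<lambda>x. W i x powr ((q-1)/2) * \<bar>commutator i u x\<bar>)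
      \<le> 2 * N i powr (2/q - 1) * (N i + (\<Sum>j=1..n. R j i * ((1/\<beta>) * (N i powr (1 - 1/q) * y j))))"
      by (intro mult_left_mono) auto
    also have "\<dots> = 2 * (N i powr (2/q - 1) * N i) + (2/\<beta>) * (\<Sum>j=1..n. R j i * ((N i powr (2/q - 1) * N i powr (1 - 1/q)) * y j))"
      by (simp add: distrib_left sum_distrib_left mult_ac)
    also have "N i powr (2/q - 1) * N i = (y i)\<^sup>2"
    proof -
      have "N i powr (2/q - 1) * N i powr 1 = N i powr (1/q) * N i powr (1/q)"
        unfolding powr_add[symmetric] by simp
      then show ?thesis using Npos[of i] by (simp add: y_def power2_eq_square)
    qed
    also have "N i powr (2/q - 1) * N i powr (1 - 1/q) = y i"
      unfolding powr_add[symmetric] y_def by (simp add: diff_divide_distrib[symmetric])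
    finally show ?thesis .
  qed
  have "(\<Sum>i=1..n. 2 * N i powr (2/q - 1) * mean (\<lambda>x. W i x powr ((q-1)/2) * \<bar>commutator i u x\<bar>))
    \<le> (\<Sum>i=1..n. 2 * (y i)\<^sup>2 + (2/\<beta>) * (\<Sum>j=1..n. R j i * (y i * y j)))"
    by (intro sum_mono trm)
  also have "\<dots> = 2 * (\<Sum>i=1..n. (y i)\<^sup>2) + (2/\<beta>) * (\<Sum>i=1..n. \<Sum>j=1..n. R j i * (y i * y j))"
    by (simp add: sum.distrib sum_distrib_left)
  also have "\<dots> \<le> 2 * (\<Sum>i=1..n. (y i)\<^sup>2) + (2/\<beta>) * (\<Sum>i=1..n. (y i)\<^sup>2)"
    using \<beta>_pos by (intro add_left_mono mult_left_mono R_quadratic) auto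
  also have "\<dots> = (2 + 2/\<beta>) * (\<Sum>i=1..n. (y i)\<^sup>2)" by (simp add: distrib_right)
  finally show ?thesis unfolding y2 unfolding N_def W_def .
qed

text \<open>Hypercontractivity for the gradient, whose components satisfy the heat equation with the
  commutators as sources.\<close>
lemma gradient_hypercontractivity:
  assumes u: "heat u" and T: "0 \<le> T" and \<sigma>: "0 \<le> \<sigma>" "\<sigma> * \<kappa> \<le> 2 * \<beta> * (q0 - 1)" and q0: "1 \<le> q0"
  shows "(\<Sum>i=1..n. qnorm2 0 (q0 + \<sigma> * T) (grad i (u T)))
    \<le> exp ((2 + 2/\<beta>) * T) * (\<Sum>i=1..n. qnorm2 0 q0 (grad i (u 0)))"
proof (rule qnorm2_family[OF _ T \<sigma> q0])
  fix i t x assume i: "i \<in> {1..n}" and x: "x \<in> cube n"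
  show "((\<lambda>t. grad i (u t) x) has_real_derivative gen (grad i (u t)) x + commutator i (u t) x) (at t)"
    using heat_grad[OF u x i] unfolding grad_gen[OF x i] .
next
  fix \<epsilon> t q :: real assume "0 < \<epsilon>" "1 \<le> q"
  then show "(\<Sum>i=1..n. 2 * (mean (\<lambda>x. ((grad i (u t) x)\<^sup>2 + \<epsilon>) powr (q/2))) powr (2/q - 1)
          * mean (\<lambda>x. ((grad i (u t) x)\<^sup>2 + \<epsilon>) powr ((q-1)/2) * \<bar>commutator i (u t) x\<bar>))
    \<le> (2 + 2/\<beta>) * (\<Sum>i=1..n. qnorm2 \<epsilon> q (grad i (u t)))"
    by (rule commutator_growth)
qed simp

end

section \<open>Boolean functions\<close>

definition decay_rate :: "real \<Rightarrow> real \<Rightarrow> real" where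
  "decay_rate \<beta> \<delta> = \<beta> / log_sobolev_const \<beta> \<delta>"

text \<open>The speed at which the exponent of a norm may grow. The cap \<open>1/2\<close> keeps an exponent that reaches
  \<open>2\<close> after at most a unit of time in the interval \<open>[3/2, 2]\<close>.\<close>
definition exponent_slope :: "real \<Rightarrow> real \<Rightarrow> real" where
  "exponent_slope \<beta> \<delta> = min (\<beta> / log_sobolev_const \<beta> \<delta>) (1/2)"

definition surface_const :: "real \<Rightarrow> real \<Rightarrow> real" where
  "surface_const \<beta> \<delta> = sqrt (gradient_const \<beta>) / 4
     * min (1 - exp (- decay_rate \<beta> \<delta> / 2)) ((1 - exp (- 1)) / sqrt 2)"

definition talagrand_surface_const :: "real \<Rightarrow> real \<Rightarrow> real" where
  "talagrand_surface_const \<beta> \<delta> = surface_const \<beta> \<delta> / sqrt (1 + 12 / exponent_slope \<beta> \<delta>)"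

definition keller_kindler_exponent :: "real \<Rightarrow> real \<Rightarrow> real" where
  "keller_kindler_exponent \<beta> \<delta> = exponent_slope \<beta> \<delta> / (8 - exponent_slope \<beta> \<delta>)"

definition keller_kindler_const :: "real \<Rightarrow> real \<Rightarrow> real" where
  "keller_kindler_const \<beta> \<delta> = log_sobolev_const \<beta> \<delta> * exp (2 + 2/\<beta>)
     * (4 * exp (2 + 2/\<beta>) * (16 / gradient_const \<beta>))"

definition eldan_gross_const :: "real \<Rightarrow> real \<Rightarrow> real" where
  "eldan_gross_const \<beta> \<delta> = min (surface_const \<beta> \<delta>) (talagrand_surface_const \<beta> \<delta>)
     / sqrt (2 + 2 / keller_kindler_exponent \<beta> \<delta> * (1 + \<bar>ln (keller_kindler_const \<beta> \<delta>)\<bar>))"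

definition L1_L2_const :: "real \<Rightarrow> real \<Rightarrow> real" where
  "L1_L2_const \<beta> \<delta> = (1 - exp (- decay_rate \<beta> \<delta>)) * (exponent_slope \<beta> \<delta> / 2) / (4 * exp (3 + 2/\<beta>))"

context
  fixes \<beta> \<delta> :: real assumes pos: "0 < \<beta>" "0 < \<delta>"
begin

lemma decay_rate_pos: "0 < decay_rate \<beta> \<delta>"
  using pos log_sobolev_const_pos[OF pos] by (simp add: decay_rate_def)

lemma exponent_slope_pos: "0 < exponent_slope \<beta> \<delta>"
  using pos log_sobolev_const_pos[OF pos] by (simp add: exponent_slope_def)

lemma exponent_slope_le: "exponent_slope \<beta> \<delta> \<le> 1/2"
  unfolding exponent_slope_def by (rule min.cobounded2)

lemma surface_const_pos: "0 < surface_const \<beta> \<delta>"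
  using gradient_const_pos[OF pos(1)] decay_rate_pos by (simp add: surface_const_def)

lemma talagrand_surface_const_pos: "0 < talagrand_surface_const \<beta> \<delta>"
  using surface_const_pos exponent_slope_pos by (simp add: talagrand_surface_const_def add_pos_pos)

lemma keller_kindler_exponent_pos: "0 < keller_kindler_exponent \<beta> \<delta>"
  using exponent_slope_pos exponent_slope_le by (simp add: keller_kindler_exponent_def)

lemma keller_kindler_const_pos: "0 < keller_kindler_const \<beta> \<delta>"
  using gradient_const_pos[OF pos(1)] log_sobolev_const_pos[OF pos] by (simp add: keller_kindler_const_def)

lemma eldan_gross_const_pos: "0 < eldan_gross_const \<beta> \<delta>"
  using surface_const_pos talagrand_surface_const_pos keller_kindler_exponent_pos
  by (auto simp: eldan_gross_const_def intro!: divide_pos_pos add_pos_nonneg)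

lemma L1_L2_const_pos: "0 < L1_L2_const \<beta> \<delta>"
  using decay_rate_pos exponent_slope_pos by (simp add: L1_L2_const_def)

end

locale boolean_function = weakly_dependent +
  fixes f :: "(nat \<Rightarrow> real) \<Rightarrow> real"
  assumes f_values: "x \<in> cube n \<Longrightarrow> f x = 1 \<or> f x = -1"
begin

definition infl :: "nat \<Rightarrow> real" where
  "infl i = mean (\<lambda>x. if f (flip i x) \<noteq> f x then 1 else 0)"

definition sens :: "(nat \<Rightarrow> real) \<Rightarrow> real" where
  "sens x = real (card {i \<in> {1..n}. f (flip i x) \<noteq> f x})"

definition surface :: real where "surface = mean (\<lambda>x. sqrt (sens x))"

definition var :: real where "var = 1 - (mean f)\<^sup>2"

text \<open>The flow starts from the centred function, so that its mean stays \<open>0\<close> and its squared norm is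
  its variance.\<close>
definition g :: "(nat \<Rightarrow> real) \<Rightarrow> real" where "g x = f x - mean f"

definition u :: "real \<Rightarrow> (nat \<Rightarrow> real) \<Rightarrow> real" where "u = flow g"

definition corr :: "real \<Rightarrow> real" where "corr t = mean (\<lambda>x. g x * u t x)"

abbreviation "\<sigma> \<equiv> exponent_slope \<beta> \<delta>"

lemmas consts_pos = log_sobolev_const_pos[OF \<beta>_pos \<delta>_pos] decay_rate_pos[OF \<beta>_pos \<delta>_pos]
  exponent_slope_pos[OF \<beta>_pos \<delta>_pos] surface_const_pos[OF \<beta>_pos \<delta>_pos]
  talagrand_surface_const_pos[OF \<beta>_pos \<delta>_pos] keller_kindler_exponent_pos[OF \<beta>_pos \<delta>_pos]
  keller_kindler_const_pos[OF \<beta>_pos \<delta>_pos]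

lemma slope_le: "\<sigma> \<le> 1/2" by (rule exponent_slope_le[OF \<beta>_pos \<delta>_pos])

lemma slope_admissible:
  assumes "3/2 \<le> q0" shows "\<sigma> * \<kappa> \<le> 2 * \<beta> * (q0 - 1)"
proof -
  have "\<sigma> * \<kappa> \<le> \<beta> / \<kappa> * \<kappa>"
    using consts_pos(1) by (intro mult_right_mono) (auto simp: exponent_slope_def)
  also have "\<dots> = 2 * \<beta> * (3/2 - 1)" using consts_pos(1) by simp
  also have "\<dots> \<le> 2 * \<beta> * (q0 - 1)" using assms \<beta>_pos by (intro mult_left_mono) auto
  finally show ?thesis .
qed

lemma heat_u: "heat u" unfolding u_def by (rule heat_flow)

lemma u_0: "u 0 = g" by (rule ext) (simp add: u_def flow_0)

lemma abs_f: "x \<in> cube n \<Longrightarrow> \<bar>f x\<bar> = 1" using f_values by fastforce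

lemma f_sq: "x \<in> cube n \<Longrightarrow> (f x)\<^sup>2 = 1" using f_values by fastforce

lemma abs_mean: "\<bar>mean f\<bar> \<le> 1"
proof -
  have "\<bar>mean f\<bar> \<le> mean (\<lambda>x. \<bar>f x\<bar>)" by (rule mean_abs)
  also have "\<dots> = mean (\<lambda>_. 1)" by (rule mean_cong) (rule abs_f)
  finally show ?thesis by simp
qed

lemma var_bounds: "0 \<le> var" "var \<le> 1"
  using abs_mean abs_square_le_1[of "mean f"] by (auto simp: var_def)

lemma mean_g: "mean g = 0"
  unfolding g_def[abs_def] by (simp add: mean_diff)

lemma mean_g_sq: "mean (\<lambda>x. (g x)\<^sup>2) = var"
proof -
  have "mean (\<lambda>x. (g x)\<^sup>2) = mean (\<lambda>x. (1 + (mean f)\<^sup>2) - (2 * mean f) * f x)"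
    by (rule mean_cong) (use f_sq in \<open>simp add: g_def power2_eq_square algebra_simps\<close>)
  also have "\<dots> = var" unfolding mean_diff mean_mult by (simp add: var_def power2_eq_square)
  finally show ?thesis .
qed

lemma abs_g: "x \<in> cube n \<Longrightarrow> \<bar>g x\<bar> = 1 - mean f * f x"
  using f_values[of x] abs_mean by (auto simp: g_def)

lemma mean_abs_g: "mean (\<lambda>x. \<bar>g x\<bar>) = var"
proof -
  have "mean (\<lambda>x. \<bar>g x\<bar>) = mean (\<lambda>x. 1 - mean f * f x)" by (rule mean_cong) (rule abs_g)
  also have "\<dots> = var" unfolding mean_diff mean_mult by (simp add: var_def power2_eq_square)
  finally show ?thesis .
qed

lemma abs_g_le: "x \<in> cube n \<Longrightarrow> \<bar>g x\<bar> \<le> 2"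
  using abs_f[of x] abs_mean abs_triangle_ineq4[of "f x" "mean f"] by (simp add: g_def)

lemma g_sq_le: "x \<in> cube n \<Longrightarrow> (g x)\<^sup>2 \<le> 4"
  using abs_g_le[of x] abs_le_square_iff[of "g x" 2] by simp

lemma grad_g: "grad i g x = grad i f x" by (simp add: grad_def g_def)

lemma grad_g_sq:
  assumes "x \<in> cube n" "i \<in> {1..n}"
  shows "(grad i g x)\<^sup>2 = (if f (flip i x) \<noteq> f x then 4 else 0)"
  unfolding grad_g unfolding grad_def
  using f_values[OF assms(1)] f_values[OF flip_in_cube[OF assms]] by auto

lemma grad_sq_g: "x \<in> cube n \<Longrightarrow> grad_sq g x = 4 * sens x"
proof -
  assume x: "x \<in> cube n"
  have "grad_sq g x = (\<Sum>i=1..n. if f (flip i x) \<noteq> f x then 4 else 0)"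
    unfolding grad_sq_def by (intro sum.cong refl grad_g_sq x)
  also have "\<dots> = (\<Sum>i\<in>{i \<in> {1..n}. f (flip i x) \<noteq> f x}. 4)"
    by (rule sum.inter_filter[symmetric]) simp
  finally show ?thesis by (simp add: sens_def)
qed

lemma infl_bounds: "0 \<le> infl i" "infl i \<le> 1"
proof -
  show "0 \<le> infl i" unfolding infl_def by (rule mean_nonneg) simp
  have "infl i \<le> mean (\<lambda>_. 1)" unfolding infl_def by (rule mean_mono) simp
  then show "infl i \<le> 1" by simp
qed

lemma qnorm2_grad_g:
  assumes i: "i \<in> {1..n}" and p: "p > 0"
  shows "qnorm2 0 p (grad i g) = 4 * infl i powr (2/p)"
proof -
  have "mean (\<lambda>x. ((grad i g x)\<^sup>2 + 0) powr (p/2)) = mean (\<lambda>x. 4 powr (p/2) * (if f (flip i x) \<noteq> f x then 1 else 0))"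
    by (rule mean_cong) (subst grad_g_sq[OF _ i], auto)
  also have "\<dots> = 4 powr (p/2) * infl i" unfolding mean_mult infl_def ..
  finally show ?thesis using p by (simp add: qnorm2_def powr_mult powr_powr)
qed

lemma surface_nonneg: "0 \<le> surface"
  unfolding surface_def by (rule mean_nonneg) (simp add: sens_def)

lemma mean_u: "mean (u t) = 0"
proof -
  have "((\<lambda>t. mean (u t)) has_real_derivative 0) (at t)" for t
  proof -
    have "((\<lambda>t. mean (u t)) has_real_derivative mean (gen (u t))) (at t)"
      by (rule mean_deriv) (rule heatD[OF heat_u])
    moreover have "mean (gen (u t)) = 0"
      using mean_gen[of "\<lambda>_. 1" "u t"] by (simp add: energy_def grad_def)
    ultimately show ?thesis by simp
  qed
  then have "mean (u t) = mean (u 0)" by (rule DERIV_isconst_all[rule_format])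
  then show ?thesis by (simp add: u_0 mean_g)
qed

text \<open>Reversibility: \<open>corr\<close> at time \<open>2 s\<close> is the squared norm at time \<open>s\<close>.\<close>
lemma mean_u_sq: "mean (\<lambda>x. (u s x)\<^sup>2) = corr (2 * s)"
proof -
  define Z where "Z r = mean (\<lambda>x. u (s + r) x * u (s - r) x)" for r
  have "(Z has_real_derivative 0) (at r)" for r
  proof -
    have "(Z has_real_derivative mean (\<lambda>x. u (s - r) x * gen (u (s + r)) x - u (s + r) x * gen (u (s - r)) x)) (at r)"
      unfolding Z_def
    proof (rule mean_deriv)
      fix x assume x: "x \<in> cube n"
      have a: "((\<lambda>r. u (s + r) x) has_real_derivative gen (u (s + r)) x) (at r)"
        by (rule heatD[OF heat_shift[OF heat_u] x])
      have b: "((\<lambda>r. u (s - r) x) has_real_derivative gen (u (s - r)) x * (-1)) (at r)"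
        by (rule DERIV_chain2[where g="\<lambda>r. s - r" and f="\<lambda>t. u t x", OF heatD[OF heat_u x]])
           (auto intro!: derivative_eq_intros)
      show "((\<lambda>r. u (s + r) x * u (s - r) x) has_real_derivative
         u (s - r) x * gen (u (s + r)) x - u (s + r) x * gen (u (s - r)) x) (at r)"
        using DERIV_mult[OF a b] by (simp add: algebra_simps)
    qed
    moreover have "mean (\<lambda>x. u (s - r) x * gen (u (s + r)) x - u (s + r) x * gen (u (s - r)) x) = 0"
      unfolding mean_diff mean_gen using energy_commute[of "u (s - r)" "u (s + r)"] by simp
    ultimately show ?thesis by simp
  qed
  then have "Z 0 = Z s" by (rule DERIV_isconst_all[rule_format])
  then show ?thesis
    by (simp add: Z_def corr_def u_0 power2_eq_square mult.commute)
qed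

lemma corr_0: "corr 0 = var"
  using mean_u_sq[of 0] by (simp add: u_0 mean_g_sq)

text \<open>Log-convexity of \<open>corr\<close> at a midpoint: Cauchy-Schwarz and reversibility.\<close>
lemma corr_half: "(corr (t/2))\<^sup>2 \<le> var * corr t"
proof -
  have "(corr (t/2))\<^sup>2 \<le> mean (\<lambda>x. (g x)\<^sup>2) * mean (\<lambda>x. (u (t/2) x)\<^sup>2)"
    unfolding corr_def mean_def by (rule weighted_Cauchy_Schwarz) (rule m_nonneg)
  then show ?thesis using mean_u_sq[of "t/2"] by (simp add: mean_g_sq)
qed

lemma mean_u_sq_deriv:
  "((\<lambda>t. mean (\<lambda>x. (u t x)\<^sup>2)) has_real_derivative - 2 * energy (u t) (u t)) (at t)"
proof -
  have "((\<lambda>t. mean (\<lambda>x. (u t x)\<^sup>2)) has_real_derivative mean (\<lambda>x. 2 * (u t x * gen (u t) x))) (at t)"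
  proof (rule mean_deriv)
    fix x assume x: "x \<in> cube n"
    show "((\<lambda>t. (u t x)\<^sup>2) has_real_derivative 2 * (u t x * gen (u t) x)) (at t)"
      using DERIV_power[OF heatD[OF heat_u x], of 2 t] by (simp add: mult_ac)
  qed
  then show ?thesis unfolding mean_mult mean_gen by simp
qed

lemma energy_ge: "(\<beta>/2) * (\<Sum>i=1..n. mean (\<lambda>x. (grad i h x)\<^sup>2)) \<le> energy h h"
proof -
  have "(\<Sum>i=1..n. \<beta> * mean (\<lambda>x. (grad i h x)\<^sup>2)) \<le> (\<Sum>i=1..n. mean (\<lambda>x. c i x * (grad i h x * grad i h x)))"
    unfolding mean_mult[symmetric] power2_eq_square
    by (intro sum_mono mean_mono mult_right_mono rate_ge) auto
  then show ?thesis unfolding energy_def sum_distrib_left[symmetric] by simp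
qed

lemma energy_le: "2 * energy h h \<le> (\<Sum>i=1..n. mean (\<lambda>x. (grad i h x)\<^sup>2))"
proof -
  have "(\<Sum>i=1..n. mean (\<lambda>x. c i x * (grad i h x * grad i h x))) \<le> (\<Sum>i=1..n. mean (\<lambda>x. (grad i h x)\<^sup>2))"
  proof (intro sum_mono mean_mono)
    fix i x assume "i \<in> {1..n}" "x \<in> cube n"
    then have "c i x * (grad i h x)\<^sup>2 \<le> 1 * (grad i h x)\<^sup>2"
      using rate_less_1[of x i] by (intro mult_right_mono) auto
    then show "c i x * (grad i h x * grad i h x) \<le> (grad i h x)\<^sup>2" by (simp add: power2_eq_square)
  qed
  then show ?thesis unfolding energy_def by simp
qed

lemma mean_u_sq_decay:
  assumes "0 \<le> t" shows "mean (\<lambda>x. (u t x)\<^sup>2) \<le> exp (- decay_rate \<beta> \<delta> * t) * var"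
proof -
  let ?l = "decay_rate \<beta> \<delta>"
  define Z where "Z t = exp (?l * t) * mean (\<lambda>x. (u t x)\<^sup>2)" for t
  have "Z t \<le> Z 0"
  proof (rule DERIV_nonpos_imp_nonincreasing[OF assms, where f=Z])
    fix t
    have "(Z has_real_derivative exp (?l * t) * (?l * mean (\<lambda>x. (u t x)\<^sup>2) - 2 * energy (u t) (u t))) (at t)"
      unfolding Z_def by (auto intro!: derivative_eq_intros mean_u_sq_deriv simp: algebra_simps)
    moreover have "?l * mean (\<lambda>x. (u t x)\<^sup>2) \<le> 2 * energy (u t) (u t)"
    proof -
      have "?l * mean (\<lambda>x. (u t x)\<^sup>2) \<le> ?l * (\<kappa> * (\<Sum>i=1..n. mean (\<lambda>x. (grad i (u t) x)\<^sup>2)))"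
        using poincare[of "u t"] consts_pos by (intro mult_left_mono) (auto simp: mean_u)
      also have "\<dots> = 2 * ((\<beta>/2) * (\<Sum>i=1..n. mean (\<lambda>x. (grad i (u t) x)\<^sup>2)))"
        using consts_pos(1) by (simp add: decay_rate_def)
      also have "\<dots> \<le> 2 * energy (u t) (u t)" using energy_ge[of "u t"] by linarith
      finally show ?thesis .
    qed
    ultimately show "\<exists>y. (Z has_real_derivative y) (at t) \<and> y \<le> 0"
      by (intro exI conjI) (auto simp: mult_le_0_iff)
  qed
  then have "exp (- ?l * t) * Z t \<le> exp (- ?l * t) * var"
    by (intro mult_left_mono) (auto simp: Z_def u_0 mean_g_sq)
  then show ?thesis by (simp add: Z_def mult.assoc[symmetric] exp_add[symmetric])
qed

text \<open>The surface area enters as the \<open>L\<^sup>1\<close> norm of the gradient of \<open>f\<close>; it is paired with the sup norm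
  of the gradient of the flow.\<close>
lemma energy_g_u_le:
  assumes s: "0 < s" "s \<le> 1"
  shows "energy g (u s) \<le> 2 * surface / sqrt (reg * s)"
proof -
  have rs: "reg * s > 0" using reg_pos s by simp
  have "energy g (u s) = mean (\<lambda>x. (1/2) * (\<Sum>i=1..n. c i x * (grad i g x * grad i (u s) x)))"
    unfolding energy_def mean_mult mean_sum ..
  also have "\<dots> \<le> mean (\<lambda>x. 2 / sqrt (reg * s) * sqrt (sens x))"
  proof (rule mean_mono)
    fix x assume x: "x \<in> cube n"
    have "(\<Sum>i=1..n. c i x * (grad i g x * grad i (u s) x)) \<le> (\<Sum>i=1..n. \<bar>grad i g x\<bar> * \<bar>grad i (u s) x\<bar>)"
    proof (rule sum_mono)
      fix i assume i: "i \<in> {1..n}"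
      have "c i x * (grad i g x * grad i (u s) x) \<le> c i x * (\<bar>grad i g x\<bar> * \<bar>grad i (u s) x\<bar>)"
        using rate_pos[OF x i] abs_ge_self[of "grad i g x * grad i (u s) x"]
        by (intro mult_left_mono) (auto simp: abs_mult)
      also have "\<dots> \<le> 1 * (\<bar>grad i g x\<bar> * \<bar>grad i (u s) x\<bar>)"
        using rate_less_1[OF x i] by (intro mult_right_mono) auto
      finally show "c i x * (grad i g x * grad i (u s) x) \<le> \<bar>grad i g x\<bar> * \<bar>grad i (u s) x\<bar>" by simp
    qed
    also have "\<dots> \<le> sqrt (grad_sq g x) * sqrt (grad_sq (u s) x)"
      using L2_set_mult_ineq[of "\<lambda>i. grad i g x" "\<lambda>i. grad i (u s) x" "{1..n}"]
      by (simp add: L2_set_def grad_sq_def)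
    also have "\<dots> \<le> sqrt (4 * sens x) * sqrt (4 / (reg * s))"
    proof (intro mult_mono real_sqrt_le_mono)
      show "grad_sq g x \<le> 4 * sens x" by (simp add: grad_sq_g x)
      have "reg * s * grad_sq (u s) x \<le> 4"
        using s x by (intro gradient_bound[OF heat_u]) (auto simp: u_0 g_sq_le)
      then show "grad_sq (u s) x \<le> 4 / (reg * s)" using rs by (simp add: field_simps)
    qed (auto simp: grad_sq_def sens_def sum_nonneg)
    also have "\<dots> = 4 / sqrt (reg * s) * sqrt (sens x)"
      by (simp add: real_sqrt_mult real_sqrt_divide)
    finally show "(1/2) * (\<Sum>i=1..n. c i x * (grad i g x * grad i (u s) x)) \<le> 2 / sqrt (reg * s) * sqrt (sens x)"
      by simp
  qed
  also have "\<dots> = 2 * surface / sqrt (reg * s)" unfolding mean_mult surface_def by simp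
  finally show ?thesis .
qed

lemma corr_deriv: "(corr has_real_derivative - energy g (u t)) (at t)"
proof -
  have "((\<lambda>t. mean (\<lambda>x. g x * u t x)) has_real_derivative mean (\<lambda>x. g x * gen (u t) x)) (at t)"
    by (intro mean_deriv DERIV_cmult heatD[OF heat_u])
  then show ?thesis unfolding mean_gen corr_def[abs_def] .
qed

text \<open>Integrated over time, the singularity \<open>1 / sqrt t\<close> of the gradient bound gives \<open>sqrt t\<close>: in a short
  time only little variance is lost unless the surface area is large.\<close>
lemma corr_drop:
  assumes t: "0 < t" "t \<le> 1"
  shows "var - corr t \<le> 4 / sqrt reg * sqrt t * surface"
proof -
  define Z where "Z s = corr s + 4 / sqrt reg * surface * sqrt s" for s
  have "Z 0 \<le> Z t"
  proof (rule DERIV_nonneg_imp_increasing_open[OF less_imp_le[OF t(1)], where f=Z])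
    fix s assume s: "0 < s" "s < t"
    have "(Z has_real_derivative - energy g (u s) + 4 / sqrt reg * surface * (inverse (sqrt s) / 2)) (at s)"
      unfolding Z_def by (intro DERIV_add corr_deriv DERIV_cmult DERIV_real_sqrt s)
    moreover have "0 \<le> - energy g (u s) + 4 / sqrt reg * surface * (inverse (sqrt s) / 2)"
    proof -
      have "4 / sqrt reg * surface * (inverse (sqrt s) / 2) = 2 * surface / sqrt (reg * s)"
        unfolding real_sqrt_mult inverse_eq_divide by simp
      then show ?thesis using energy_g_u_le[of s] s t by linarith
    qed
    ultimately show "\<exists>y. (Z has_real_derivative y) (at s) \<and> 0 \<le> y" by blast
  next
    have "continuous_on {0..t} corr"
      by (intro continuous_at_imp_continuous_on ballI DERIV_isCont[OF corr_deriv])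
    then show "continuous_on {0..t} Z" unfolding Z_def by (intro continuous_intros)
  qed
  then show ?thesis by (simp add: Z_def corr_0 mult_ac)
qed

lemma corr_dyadic:
  assumes "corr 1 \<le> var * exp (- l)"
  shows "corr (1 / 2 ^ k) \<le> var * exp (- l / 2 ^ k)"
proof (induction k)
  case 0 then show ?case using assms by simp
next
  case (Suc k)
  have "(corr (1 / 2 ^ k / 2))\<^sup>2 \<le> var * corr (1 / 2 ^ k)" by (rule corr_half)
  also have "\<dots> \<le> var * (var * exp (- l / 2 ^ k))" by (intro mult_left_mono Suc var_bounds)
  also have "\<dots> = (var * exp (- l / 2 ^ Suc k))\<^sup>2"
    by (simp add: power2_eq_square exp_add[symmetric] mult_ac)
  finally have "corr (1 / 2 ^ k / 2) \<le> var * exp (- l / 2 ^ Suc k)"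
    by (rule power2_le_imp_le) (simp add: var_bounds)
  then show ?case by (simp add: mult.commute)
qed

text \<open>Smoothing at time 1 gives a lower bound on the surface area: by log-convexity of \<open>corr\<close> a
  definite fraction of the variance is already lost at a time of order \<open>1 / max 1 l\<close>.\<close>
lemma surface_from_smoothing:
  assumes "corr 1 \<le> var * exp (- l)"
  shows "surface_const \<beta> \<delta> * var * sqrt (max 1 l) \<le> surface"
proof -
  have sr: "sqrt reg > 0" using reg_pos by simp
  have key: "a * sqrt reg / 4 * var * s \<le> surface"
    if "corr t \<le> (1 - a) * var" "0 < t" "t \<le> 1" "s * sqrt t \<le> 1" "0 \<le> s" for a s t
  proof -
    have "a * var \<le> var - corr t" using that by (simp add: algebra_simps)
    also have "\<dots> \<le> 4 / sqrt reg * sqrt t * surface" by (rule corr_drop[OF that(2,3)])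
    finally have "a * var * (sqrt reg / 4) \<le> sqrt t * surface" using sr by (simp add: field_simps)
    then have "s * (a * var * (sqrt reg / 4)) \<le> s * (sqrt t * surface)" using that by (intro mult_left_mono)
    also have "\<dots> \<le> 1 * surface"
      unfolding mult.assoc[symmetric] using that surface_nonneg by (intro mult_right_mono) auto
    finally show ?thesis by (simp add: mult_ac)
  qed
  have le: "surface_const \<beta> \<delta> * var * s \<le> a * sqrt reg / 4 * var * s"
    if "surface_const \<beta> \<delta> \<le> a * sqrt reg / 4" "0 \<le> s" for a s
    using that var_bounds by (intro mult_right_mono) auto
  show ?thesis
  proof (cases "l \<le> 1")
    case True
    have "corr 1 \<le> (1 - (1 - exp (- decay_rate \<beta> \<delta> / 2))) * var"
      using mean_u_sq_decay[of "1/2"] mean_u_sq[of "1/2"] by simp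
    then have "(1 - exp (- decay_rate \<beta> \<delta> / 2)) * sqrt reg / 4 * var * 1 \<le> surface"
      by (rule key) auto
    moreover have "surface_const \<beta> \<delta> * var * 1 \<le> (1 - exp (- decay_rate \<beta> \<delta> / 2)) * sqrt reg / 4 * var * 1"
    proof (rule le)
      have "surface_const \<beta> \<delta> \<le> sqrt reg / 4 * (1 - exp (- decay_rate \<beta> \<delta> / 2))"
        unfolding surface_const_def using sr by (intro mult_left_mono) auto
      then show "surface_const \<beta> \<delta> \<le> (1 - exp (- decay_rate \<beta> \<delta> / 2)) * sqrt reg / 4" by (simp add: mult.commute)
    qed simp
    ultimately show ?thesis using True by (simp add: max_absorb1)
  next
    case False
    \<comment> \<open>dyadic times suffice: \<open>t = 1 / 2 ^ k\<close> with \<open>1 \<le> l t \<le> 2\<close>\<close>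
    define k where "k = (LEAST k. l < 2 ^ Suc k)"
    have "\<exists>k. l < 2 ^ Suc k"
    proof -
      obtain k where "l < 2 ^ k" using real_arch_pow[of 2 l] by auto
      moreover have "(2::real) ^ k \<le> 2 ^ Suc k" by simp
      ultimately have "l < 2 ^ Suc k" by linarith
      then show ?thesis by blast
    qed
    then have k: "l < 2 ^ Suc k" unfolding k_def by (rule LeastI_ex)
    have k': "2 ^ k \<le> l"
    proof (cases k)
      case 0 then show ?thesis using False by simp
    next
      case (Suc j)
      then have "\<not> l < 2 ^ Suc j" using not_less_Least[of j "\<lambda>k. l < 2 ^ Suc k"] by (simp add: k_def)
      then show ?thesis using Suc by simp
    qed
    define t where "t = 1 / (2::real) ^ k"
    have t: "0 < t" "t \<le> 1" by (auto simp: t_def)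
    have lt: "1 \<le> l * t" "l * t \<le> 2" using k k' by (auto simp: t_def field_simps)
    have "corr t \<le> var * exp (- (l * t))" using corr_dyadic[OF assms, of k] by (simp add: t_def)
    also have "\<dots> \<le> var * exp (- 1)" using lt var_bounds by (intro mult_left_mono) auto
    finally have "corr t \<le> (1 - (1 - exp (- 1))) * var" by (simp add: mult.commute)
    moreover have "sqrt (l / 2) * sqrt t \<le> 1"
      unfolding real_sqrt_mult[symmetric] using lt by (simp add: real_sqrt_le_1_iff)
    ultimately have "(1 - exp (- 1)) * sqrt reg / 4 * var * sqrt (l / 2) \<le> surface"
      using t False by (intro key[of t "1 - exp (- 1)" "sqrt (l / 2)"]) auto
    moreover have "surface_const \<beta> \<delta> * var * sqrt l \<le> ((1 - exp (- 1)) / sqrt 2) * sqrt reg / 4 * var * sqrt l"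
    proof (rule le)
      have "surface_const \<beta> \<delta> \<le> sqrt reg / 4 * ((1 - exp (- 1)) / sqrt 2)"
        unfolding surface_const_def using sr by (intro mult_left_mono) auto
      then show "surface_const \<beta> \<delta> \<le> ((1 - exp (- 1)) / sqrt 2) * sqrt reg / 4" by (simp add: mult.commute)
    qed (use False in simp)
    ultimately show ?thesis using False by (simp add: real_sqrt_divide max_absorb2 mult_ac)
  qed
qed

lemma two_div_two_minus: "0 \<le> a \<Longrightarrow> a < 2 \<Longrightarrow> 1 + a / 2 \<le> 2 / (2 - a)" for a :: real
proof -
  assume a: "0 \<le> a" "a < 2"
  have "(1 + a / 2) * (2 - a) \<le> 2" by (simp add: algebra_simps)
  then show ?thesis using a by (simp add: le_divide_eq)
qed

text \<open>Hypercontractivity applied to \<open>g\<close>: as \<open>g\<close> is bounded with \<open>L\<^sup>1\<close> norm \<open>var\<close>, its \<open>L\<^sup>q\<close> norm with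
  \<open>q < 2\<close> is much smaller than its \<open>L\<^sup>2\<close> norm when the variance is small.\<close>
lemma corr_1_le: "corr 1 \<le> 4 * (var * var powr (\<sigma>/4))"
proof -
  define q where "q = 2 - \<sigma>/2"
  have q: "3/2 \<le> q" "1 \<le> q" "q \<le> 2" using slope_le consts_pos by (auto simp: q_def)
  have "corr 1 = qnorm2 0 2 (u (1/2))" using mean_u_sq[of "1/2"] by (simp add: qnorm2_2)
  also have "\<dots> \<le> qnorm2 0 q g"
    using hypercontractivity[OF heat_u, of "1/2" \<sigma> q] slope_admissible[OF q(1)] q consts_pos
    by (simp add: q_def u_0)
  also have "\<dots> \<le> (2 * var) powr (2/q)"
    unfolding qnorm2_def
  proof (rule powr_mono2)
    have "mean (\<lambda>x. ((g x)\<^sup>2 + 0) powr (q/2)) \<le> mean (\<lambda>x. 2 * \<bar>g x\<bar>)"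
    proof (rule mean_mono)
      fix x assume x: "x \<in> cube n"
      have "((g x)\<^sup>2 + 0) powr (q/2) = 4 powr (q/2) * ((g x)\<^sup>2/4) powr (q/2)"
        unfolding powr_mult[symmetric] by simp
      also have "\<dots> \<le> 4 powr 1 * ((g x)\<^sup>2/4) powr (1/2)"
        using q g_sq_le[OF x] by (intro mult_mono powr_mono powr_mono') auto
      also have "((g x)\<^sup>2/4) powr (1/2) = \<bar>g x\<bar> / 2"
        by (simp add: powr_half_sqrt real_sqrt_divide)
      finally show "((g x)\<^sup>2 + 0) powr (q/2) \<le> 2 * \<bar>g x\<bar>" by simp
    qed
    then show "mean (\<lambda>x. ((g x)\<^sup>2 + 0) powr (q/2)) \<le> 2 * var" unfolding mean_mult mean_abs_g .
  qed (use q in \<open>auto intro: mean_nonneg\<close>)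
  also have "\<dots> = 2 powr (2/q) * var powr (2/q)" by (rule powr_mult)
  also have "\<dots> \<le> 2 powr 2 * var powr (1 + \<sigma>/4)"
    using q var_bounds two_div_two_minus[of "\<sigma>/2"] slope_le consts_pos
    by (intro mult_mono powr_mono powr_mono') (auto simp: q_def field_simps)
  also have "\<dots> = 4 * (var * var powr (\<sigma>/4))"
    using var_bounds by (simp add: powr_mult_base[symmetric] powr_numeral)
  finally show ?thesis .
qed

lemma ln4_le: "ln (4::real) \<le> 2"
proof -
  have "ln (4::real) = 2 * ln 2" using ln_realpow[of 2 2] by simp
  then show ?thesis using ln_2_less_1 by linarith
qed

text \<open>By hypercontractivity the smoothing at time 1 is of the order of \<open>ln (1 / var)\<close>.\<close>
theorem talagrand_surface:
  assumes "var \<noteq> 0"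
  shows "talagrand_surface_const \<beta> \<delta> * var * sqrt (ln (exp 1 / var)) \<le> surface"
proof -
  have v: "var > 0" using var_bounds assms by simp
  define \<gamma> where "\<gamma> = \<sigma>/4"
  have \<gamma>: "\<gamma> > 0" using consts_pos by (simp add: \<gamma>_def)
  define L where "L = ln (1 / var)"
  have L: "ln (exp 1 / var) = 1 + L" "ln var = - L" using v by (auto simp: L_def ln_div)
  define l where "l = \<gamma> * L - ln 4"
  have e: "var powr \<gamma> * 4 = exp (- l)"
    using v by (simp add: powr_def l_def L exp_diff exp_minus field_simps)
  have "corr 1 \<le> var * (var powr \<gamma> * 4)"
    using corr_1_le by (simp add: \<gamma>_def mult_ac)
  then have "corr 1 \<le> var * exp (- l)" unfolding e .
  then have s: "surface_const \<beta> \<delta> * var * sqrt (max 1 l) \<le> surface" by (rule surface_from_smoothing)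
  have "1 + L \<le> (1 + 12 / \<sigma>) * max 1 l"
  proof -
    have "L = (l + ln 4) / \<gamma>" using \<gamma> by (simp add: l_def)
    also have "\<dots> \<le> (3 * max 1 l) / \<gamma>" using \<gamma> ln4_le by (intro divide_right_mono) auto
    also have "\<dots> = 12 / \<sigma> * max 1 l" by (simp add: \<gamma>_def)
    finally show ?thesis by (simp add: distrib_right)
  qed
  then have "sqrt (ln (exp 1 / var)) \<le> sqrt (1 + 12 / \<sigma>) * sqrt (max 1 l)"
    unfolding L real_sqrt_mult[symmetric] by (rule real_sqrt_le_mono)
  then have "talagrand_surface_const \<beta> \<delta> * var * sqrt (ln (exp 1 / var))
     \<le> talagrand_surface_const \<beta> \<delta> * var * (sqrt (1 + 12 / \<sigma>) * sqrt (max 1 l))"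
    using v consts_pos by (intro mult_left_mono) auto
  also have "\<dots> = surface_const \<beta> \<delta> * var * sqrt (max 1 l)"
    using consts_pos by (simp add: talagrand_surface_const_def add_pos_pos less_imp_neq[symmetric])
  finally show ?thesis using s by linarith
qed

definition sq_infl :: real where "sq_infl = (\<Sum>i=1..n. (infl i)\<^sup>2)"

lemma sq_infl_nonneg: "0 \<le> sq_infl" by (simp add: sq_infl_def sum_nonneg)

lemma qnorm2_interpolation:
  assumes p: "1 < p" "p < 2"
  shows "qnorm2 0 p h \<le> (qnorm2 0 1 h) powr ((2-p)/p) * (qnorm2 0 2 h) powr (1 - (2-p)/p)"
proof -
  let ?a = "mean (\<lambda>x. \<bar>h x\<bar>)" and ?b = "mean (\<lambda>x. (h x)\<^sup>2)"
  have "mean (\<lambda>x. ((h x)\<^sup>2 + 0) powr (p/2)) = mean (\<lambda>x. \<bar>h x\<bar> powr (2 - p) * ((h x)\<^sup>2) powr (1 - (2 - p)))"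
  proof (rule mean_cong)
    fix x
    have sq: "((h x)\<^sup>2) powr e = \<bar>h x\<bar> powr (2 * e)" for e
      using powr_powr[of "\<bar>h x\<bar>" 2 e] by (cases "h x = 0") (auto simp: powr_numeral)
    show "((h x)\<^sup>2 + 0) powr (p/2) = \<bar>h x\<bar> powr (2 - p) * ((h x)\<^sup>2) powr (1 - (2 - p))"
      unfolding add_0_right sq powr_add[symmetric] by (simp add: algebra_simps)
  qed
  also have "\<dots> \<le> ?a powr (2 - p) * ?b powr (1 - (2 - p))"
    unfolding mean_def using p by (intro holder_weighted m_nonneg) auto
  finally have "qnorm2 0 p h \<le> (?a powr (2 - p) * ?b powr (1 - (2 - p))) powr (2/p)"
    unfolding qnorm2_def using p by (intro powr_mono2) (auto intro: mean_nonneg)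
  also have "\<dots> = ?a powr ((2 - p) * (2/p)) * ?b powr ((1 - (2 - p)) * (2/p))"
    by (simp add: powr_mult powr_powr)
  also have "?a powr ((2 - p) * (2/p)) = (?a\<^sup>2) powr ((2-p)/p)"
  proof -
    have a0: "?a \<ge> 0" by (rule mean_nonneg) simp
    have "(?a\<^sup>2) powr ((2-p)/p) = ?a powr (2 * ((2-p)/p))"
      using powr_powr[of ?a 2 "(2-p)/p"] a0 by (cases "?a = 0") (auto simp: powr_numeral)
    then show ?thesis by (simp add: mult.commute)
  qed
  also have "(1 - (2 - p)) * (2/p) = 1 - (2-p)/p" using p by (simp add: field_simps)
  finally show ?thesis unfolding qnorm2_1 qnorm2_2 .
qed

text \<open>A Keller-Kindler bound: noise stability is at most a power of the sum of the squared influences.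
  Up to the time \<open>1/4\<close> the exponent \<open>1\<close> is kept, which compares the \<open>L\<^sup>1\<close> norms of the gradient
  with the influences, while the gradient bound makes the \<open>L\<^sup>2\<close> norms bounded. Interpolation between
  the two and hypercontractivity up to the time \<open>1/2\<close> give the \<open>L\<^sup>2\<close> norm of the gradient.\<close>
lemma corr_1_le_sq_infl: "corr 1 \<le> keller_kindler_const \<beta> \<delta> * sq_infl powr keller_kindler_exponent \<beta> \<delta>"
proof -
  let ?K = "2 + 2/\<beta>" and ?\<theta> = "keller_kindler_exponent \<beta> \<delta>"
  define p where "p = 2 - \<sigma>/4"
  have p: "3/2 \<le> p" "1 < p" "p < 2" using slope_le consts_pos by (auto simp: p_def)
  have \<theta>: "(2 - p)/p = ?\<theta>" using p by (simp add: p_def keller_kindler_exponent_def field_simps)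
  have \<theta>01: "0 < ?\<theta>" "?\<theta> \<le> 1" using consts_pos p unfolding \<theta>[symmetric] by (auto simp: field_simps)
  have K: "?K \<ge> 0" using \<beta>_pos by simp
  define v where "v i = grad i (u (1/4))" for i
  have a: "(\<Sum>i=1..n. qnorm2 0 1 (v i)) \<le> 4 * exp ?K * sq_infl"
  proof -
    have "(\<Sum>i=1..n. qnorm2 0 1 (v i)) \<le> exp (?K * (1/4)) * (\<Sum>i=1..n. qnorm2 0 1 (grad i g))"
      using gradient_hypercontractivity[OF heat_u, of "1/4" 0 1] unfolding v_def u_0 by simp
    also have "(\<Sum>i=1..n. qnorm2 0 1 (grad i g)) = 4 * sq_infl"
      unfolding sq_infl_def sum_distrib_left
      by (intro sum.cong refl) (simp add: qnorm2_grad_g powr_numeral infl_bounds)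
    also have "exp (?K * (1/4)) * (4 * sq_infl) \<le> exp ?K * (4 * sq_infl)"
      using K sq_infl_nonneg by (intro mult_right_mono) auto
    finally show ?thesis by simp
  qed
  have b: "(\<Sum>i=1..n. qnorm2 0 2 (v i)) \<le> 16 / reg"
  proof -
    have "(\<Sum>i=1..n. qnorm2 0 2 (v i)) = mean (grad_sq (u (1/4)))"
      unfolding qnorm2_2 v_def grad_sq_def[abs_def] mean_sum ..
    also have "\<dots> \<le> mean (\<lambda>_. 16 / reg)"
    proof (rule mean_mono)
      fix x assume "x \<in> cube n"
      then have "reg * (1/4) * grad_sq (u (1/4)) x \<le> 4"
        by (intro gradient_bound[OF heat_u]) (auto simp: u_0 g_sq_le)
      then show "grad_sq (u (1/4)) x \<le> 16 / reg" using reg_pos by (simp add: field_simps)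
    qed
    finally show ?thesis by simp
  qed
  have reg1: "reg \<le> 16"
  proof -
    have "\<beta> \<le> 16 * (3 + 1/\<beta>)" using \<beta>_le_half \<beta>_pos by (simp add: add_increasing2)
    then show ?thesis using \<beta>_pos by (simp add: gradient_const_def add_pos_pos divide_le_eq)
  qed
  have pow_le: "a powr e \<le> a" if "1 \<le> a" "e \<le> 1" for a e :: real
    using powr_mono[of e 1 a] that by simp
  have "(\<Sum>i=1..n. qnorm2 0 p (v i)) \<le> (\<Sum>i=1..n. 1 * (qnorm2 0 1 (v i) powr ?\<theta> * qnorm2 0 2 (v i) powr (1 - ?\<theta>)))"
    using qnorm2_interpolation[OF p(2,3)] unfolding \<theta> by (intro sum_mono) simp
  also have "\<dots> \<le> (\<Sum>i=1..n. 1 * qnorm2 0 1 (v i)) powr ?\<theta> * (\<Sum>i=1..n. 1 * qnorm2 0 2 (v i)) powr (1 - ?\<theta>)"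
    using \<theta>01 by (intro holder_weighted) (auto simp: qnorm2_nonneg)
  also have "\<dots> \<le> (4 * exp ?K * sq_infl) powr ?\<theta> * (16 / reg) powr (1 - ?\<theta>)"
    using a b \<theta>01 by (intro mult_mono powr_mono2) (auto intro!: sum_nonneg qnorm2_nonneg)
  also have "(4 * exp ?K * sq_infl) powr ?\<theta> = (4 * exp ?K) powr ?\<theta> * sq_infl powr ?\<theta>" by (rule powr_mult)
  also have "\<dots> * (16 / reg) powr (1 - ?\<theta>) \<le> ((4 * exp ?K) * sq_infl powr ?\<theta>) * (16 / reg)"
  proof (intro mult_mono pow_le)
    have "1 \<le> exp ?K" using K by simp
    then show "1 \<le> 4 * exp ?K" by linarith
    show "1 \<le> 16 / reg" using reg1 reg_pos by simp
  qed (use \<theta>01 reg_pos in auto)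
  finally have Lp: "(\<Sum>i=1..n. qnorm2 0 p (v i)) \<le> (4 * exp ?K * (16 / reg)) * sq_infl powr ?\<theta>" by (simp add: mult_ac)
  have "(\<Sum>i=1..n. qnorm2 0 (p + \<sigma> * (1/4)) (grad i (u (1/4 + 1/4)))) \<le> exp (?K * (1/4)) * (\<Sum>i=1..n. qnorm2 0 p (grad i (u (1/4 + 0))))"
    using p consts_pos slope_admissible[OF p(1)]
    by (intro gradient_hypercontractivity[OF heat_shift[OF heat_u, of "1/4"]]) auto
  then have "(\<Sum>i=1..n. qnorm2 0 2 (grad i (u (1/2)))) \<le> exp (?K * (1/4)) * (\<Sum>i=1..n. qnorm2 0 p (v i))"
    by (simp add: p_def v_def)
  also have "\<dots> \<le> exp ?K * (\<Sum>i=1..n. qnorm2 0 p (v i))"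
    using K by (intro mult_right_mono sum_nonneg qnorm2_nonneg) auto
  also have "\<dots> \<le> exp ?K * ((4 * exp ?K * (16 / reg)) * sq_infl powr ?\<theta>)"
    by (intro mult_left_mono Lp) auto
  finally have "\<kappa> * (\<Sum>i=1..n. mean (\<lambda>x. (grad i (u (1/2)) x)\<^sup>2)) \<le> \<kappa> * (exp ?K * ((4 * exp ?K * (16 / reg)) * sq_infl powr ?\<theta>))"
    unfolding qnorm2_2 using consts_pos(1) by (intro mult_left_mono) auto
  then have "mean (\<lambda>x. (u (1/2) x)\<^sup>2) \<le> \<kappa> * (exp ?K * ((4 * exp ?K * (16 / reg)) * sq_infl powr ?\<theta>))"
    using poincare[of "u (1/2)"] by (simp add: mean_u)
  then show ?thesis using mean_u_sq[of "1/2"] by (simp add: keller_kindler_const_def mult_ac)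
qed

lemma ln_1_plus_e_le: "ln (1 + exp 1) \<le> (2::real)"
proof -
  have "exp 1 * (exp 1 - 1) \<ge> (2 * 1 :: real)" using exp_ge_add_one_self[of 1]
    by (intro mult_mono) auto
  then have "1 + exp 1 \<le> exp (2::real)" 
    using exp_add[of 1 "1::real"] by (simp add: algebra_simps)
  then have "ln (1 + exp 1) \<le> ln (exp (2::real))" by (subst ln_le_cancel_iff) (auto intro: add_pos_pos)
  then show ?thesis by simp
qed

text \<open>If the variance is at least \<open>sq_infl powr (\<theta>/2)\<close>, half of the exponent in the Keller-Kindler bound is
  left to compare noise stability with the variance; otherwise the bound in terms of the variance is
  the stronger one.\<close>
theorem eldan_gross:
  assumes "var \<noteq> 0"
  shows "eldan_gross_const \<beta> \<delta> * var * sqrt (ln (1 + exp 1 / sq_infl)) \<le> surface"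
proof (cases "sq_infl = 0")
  case True then show ?thesis using surface_nonneg by simp
next
  case False
  then have sq_infl: "sq_infl > 0" using sq_infl_nonneg by simp
  have v: "var > 0" using var_bounds assms by simp
  let ?\<theta> = "keller_kindler_exponent \<beta> \<delta>" and ?Q = "keller_kindler_const \<beta> \<delta>"
  let ?M = "2 + 2 / ?\<theta> * (1 + \<bar>ln ?Q\<bar>)"
  let ?c = "min (surface_const \<beta> \<delta>) (talagrand_surface_const \<beta> \<delta>)"
  define X where "X = ln (1 + exp 1 / sq_infl)"
  have \<theta>: "?\<theta> > 0" and Q: "?Q > 0" using consts_pos by auto
  have M: "?M > 0" using \<theta> by (intro add_pos_nonneg) auto
  have fin: "eldan_gross_const \<beta> \<delta> * var * sqrt X \<le> surface"
    if "X \<le> ?M * y" "?c * var * sqrt y \<le> surface" for y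
  proof -
    have "sqrt X \<le> sqrt ?M * sqrt y" unfolding real_sqrt_mult[symmetric] using that by (intro real_sqrt_le_mono)
    then have "(?c / sqrt ?M) * var * sqrt X \<le> (?c / sqrt ?M) * var * (sqrt ?M * sqrt y)"
      using v consts_pos M by (intro mult_left_mono) auto
    also have "\<dots> = ?c * var * sqrt y" using M by simp
    finally show ?thesis using that unfolding eldan_gross_const_def by linarith
  qed
  have fin1: "eldan_gross_const \<beta> \<delta> * var * sqrt X \<le> surface"
    if "X \<le> ?M * max 1 l" "corr 1 \<le> var * exp (- l)" for l
  proof (rule fin[OF that(1)])
    have "?c * var * sqrt (max 1 l) \<le> surface_const \<beta> \<delta> * var * sqrt (max 1 l)"
      using v by (intro mult_right_mono) auto
    then show "?c * var * sqrt (max 1 l) \<le> surface"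
      using surface_from_smoothing[OF that(2)] by linarith
  qed
  have X_le: "X \<le> 2 + max 0 (ln (1 / sq_infl))"
  proof -
    have "1 + exp 1 / sq_infl \<le> (1 + exp 1) * max 1 (1 / sq_infl)"
    proof -
      have "1 * 1 + exp 1 * (1 / sq_infl) \<le> 1 * max 1 (1 / sq_infl) + exp 1 * max 1 (1 / sq_infl)"
        by (intro add_mono mult_left_mono) auto
      then show ?thesis by (simp add: distrib_right)
    qed
    then have "X \<le> ln ((1 + exp 1) * max 1 (1 / sq_infl))"
      unfolding X_def using sq_infl by (subst ln_le_cancel_iff) (auto intro!: add_pos_pos mult_pos_pos)
    also have "\<dots> = ln (1 + exp 1) + ln (max 1 (1 / sq_infl))"
      using sq_infl by (intro ln_mult_pos) (auto intro: add_pos_pos)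
    also have "ln (max 1 (1 / sq_infl)) = max 0 (ln (1 / sq_infl))"
      using sq_infl by (auto simp: max_def ln_div)
    finally show ?thesis using ln_1_plus_e_le by linarith
  qed
  show ?thesis
  proof (cases "sq_infl \<ge> 1")
    case True
    then have "ln (1 / sq_infl) \<le> 0" using sq_infl by (simp add: ln_div)
    then have "X \<le> 2" using X_le by simp
    also have "2 \<le> ?M" using \<theta> by simp
    finally have "X \<le> ?M * max 1 0" by simp
    moreover have "corr 1 \<le> var * exp (- 0)"
    proof -
      have "corr 1 \<le> exp (- decay_rate \<beta> \<delta> * (1/2)) * var" using mean_u_sq_decay[of "1/2"] mean_u_sq[of "1/2"] by simp
      also have "\<dots> \<le> 1 * var" using consts_pos v by (intro mult_right_mono) auto
      finally show ?thesis by simp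
    qed
    ultimately show ?thesis using fin1 unfolding X_def by blast
  next
    case False
    define L where "L = ln (1 / sq_infl)"
    have L: "L \<ge> 0" "ln sq_infl = - L" using False sq_infl by (auto simp: L_def ln_div)
    have XL: "X \<le> 2 + L" using X_le L by (simp add: L_def[symmetric] max_absorb2)
    show ?thesis
    proof (cases "sq_infl powr (?\<theta>/2) \<le> var")
      case True
      define l where "l = ?\<theta> * L / 2 - ln ?Q"
      have "corr 1 \<le> ?Q * (sq_infl powr (?\<theta>/2) * sq_infl powr (?\<theta>/2))"
        using corr_1_le_sq_infl by (simp add: powr_add[symmetric])
      also have "\<dots> \<le> ?Q * (sq_infl powr (?\<theta>/2) * var)"
        using True Q by (intro mult_left_mono) auto
      also have "\<dots> = var * exp (- l)"
      proof -
        have "exp (- l) = exp (ln ?Q) * exp (?\<theta>/2 * ln sq_infl)"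
          unfolding exp_add[symmetric] by (simp add: l_def L)
        then show ?thesis using sq_infl Q by (simp add: powr_def)
      qed
      finally have c: "corr 1 \<le> var * exp (- l)" .
      have "X \<le> 2 + 2 / ?\<theta> * (l + ln ?Q)" using XL \<theta> by (simp add: l_def field_simps)
      also have "\<dots> \<le> 2 * max 1 l + 2 / ?\<theta> * ((1 + \<bar>ln ?Q\<bar>) * max 1 l)"
      proof (intro add_mono mult_left_mono)
        have "\<bar>ln ?Q\<bar> * 1 \<le> \<bar>ln ?Q\<bar> * max 1 l" by (intro mult_left_mono) auto
        then show "l + ln ?Q \<le> (1 + \<bar>ln ?Q\<bar>) * max 1 l" unfolding distrib_right by linarith
      qed (use \<theta> in auto)
      also have "\<dots> = ?M * max 1 l" by (simp add: distrib_right)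
      finally show ?thesis using fin1[OF _ c] unfolding X_def by blast
    next
      case False
      have "ln var \<le> ln (sq_infl powr (?\<theta>/2))" using False v sq_infl by (subst ln_le_cancel_iff) auto
      then have "ln var \<le> - (?\<theta> / 2 * L)" using sq_infl L by (simp add: ln_powr)
      then have lv: "1 + ?\<theta> / 2 * L \<le> ln (exp 1 / var)" using v by (simp add: ln_div)
      define y where "y = ln (exp 1 / var)"
      have y: "1 \<le> y" "?\<theta> / 2 * L \<le> y"
        using lv L \<theta> mult_nonneg_nonneg[of "?\<theta> / 2" L] unfolding y_def by linarith+
      have "L = 2 / ?\<theta> * (?\<theta> / 2 * L)" using \<theta> by simp
      also have "\<dots> \<le> 2 / ?\<theta> * ((1 + \<bar>ln ?Q\<bar>) * y)"
      proof (rule mult_left_mono)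
        have "1 * y \<le> (1 + \<bar>ln ?Q\<bar>) * y" using y by (intro mult_right_mono) auto
        then show "?\<theta> / 2 * L \<le> (1 + \<bar>ln ?Q\<bar>) * y" using y by linarith
      qed (use \<theta> in simp)
      finally have "X \<le> 2 * y + 2 / ?\<theta> * ((1 + \<bar>ln ?Q\<bar>) * y)" using XL y by linarith
      then have "X \<le> ?M * y" by (simp add: algebra_simps add_divide_distrib)
      moreover have "?c * var * sqrt y \<le> surface"
      proof -
        have "?c * var * sqrt y \<le> talagrand_surface_const \<beta> \<delta> * var * sqrt y"
          using v y by (intro mult_right_mono) auto
        then show ?thesis using talagrand_surface[OF assms] unfolding y_def by linarith
      qed
      ultimately show ?thesis using fin unfolding X_def by blast
    qed
  qed
qed

text \<open>By the spectral gap a fixed fraction of the variance is lost up to time 1, and the loss is at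
  most the integral of the squared \<open>L\<^sup>2\<close> norms of the gradient. Running the exponent from \<open>2 - \<sigma> t\<close> to \<open>2\<close>
  bounds these at time \<open>t\<close> by \<open>infl i powr (1 + a t)\<close>, up to a factor, with \<open>a = \<sigma>/2\<close>; the integral
  over \<open>t\<close> produces the logarithm.\<close>
theorem talagrand_L1_L2:
  "L1_L2_const \<beta> \<delta> * var \<le> (\<Sum>i=1..n. if infl i = 0 then 0 else infl i / (1 + ln (1 / infl i)))"
proof -
  let ?K = "2 + 2/\<beta>"
  define a where "a = \<sigma> / 2"
  define B where "B = 4 * exp (?K + 1)"
  define l where "l i = 1 + ln (1 / infl i)" for i
  have a: "0 < a" "a \<le> 1" using consts_pos slope_le by (auto simp: a_def)
  have K: "?K \<ge> 0" using \<beta>_pos by simp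
  have l: "1 \<le> l i" if "infl i \<noteq> 0" for i
    using that infl_bounds[of i] by (simp add: l_def)
  \<comment> \<open>\<open>q i\<close> is the integral from \<open>0\<close> of \<open>q' i\<close>, the bound for the direction \<open>i\<close>; the extra \<open>exp 1\<close>
    in \<open>B\<close> replaces \<open>ln (1 / infl i)\<close> by \<open>l i \<ge> 1\<close>\<close>
  define q where "q i t = (if infl i = 0 then 0 else B * infl i * (1 - exp (- (a * l i) * t)) / (a * l i))" for i t
  define q' where "q' i t = (if infl i = 0 then 0 else B * infl i * exp (- (a * l i) * t))" for i t
  have dq: "((q i) has_real_derivative q' i t) (at t)" for i t
  proof (cases "infl i = 0")
    case True then show ?thesis by (simp add: q_def[abs_def] q'_def)
  next
    case False
    have "a * l i \<noteq> 0" using a l[OF False] by simp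
    then show ?thesis unfolding q_def q'_def using False
      by (auto intro!: derivative_eq_intros)
  qed
  define Z where "Z t = mean (\<lambda>x. (u t x)\<^sup>2) + (\<Sum>i=1..n. q i t)" for t
  have "Z 0 \<le> Z 1"
  proof (rule DERIV_nonneg_imp_nondecreasing[where f=Z])
    fix t :: real assume t: "0 \<le> t" "t \<le> 1"
    have dZ: "(Z has_real_derivative - 2 * energy (u t) (u t) + (\<Sum>i=1..n. q' i t)) (at t)"
      unfolding Z_def by (intro DERIV_add mean_u_sq_deriv DERIV_sum dq)
    have \<sigma>t: "0 \<le> \<sigma> * t" "\<sigma> * t \<le> 1/2"
      using t consts_pos slope_le mult_mono[of \<sigma> "1/2" t 1] by auto
    define p where "p = 2 - \<sigma> * t"
    have p: "3/2 \<le> p" "1 \<le> p" using \<sigma>t by (auto simp: p_def)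
    have "2 * energy (u t) (u t) \<le> (\<Sum>i=1..n. qnorm2 0 (p + \<sigma> * t) (grad i (u t)))"
      using energy_le[of "u t"] by (simp add: p_def qnorm2_2)
    also have "\<dots> \<le> exp (?K * t) * (\<Sum>i=1..n. qnorm2 0 p (grad i (u 0)))"
      using t p consts_pos slope_admissible[OF p(1)] by (intro gradient_hypercontractivity heat_u) auto
    also have "\<dots> \<le> exp ?K * (\<Sum>i=1..n. qnorm2 0 p (grad i (u 0)))"
      using t K mult_left_mono[of t 1 ?K] by (intro mult_right_mono sum_nonneg qnorm2_nonneg) auto
    also have "\<dots> \<le> (\<Sum>i=1..n. q' i t)"
      unfolding sum_distrib_left
    proof (rule sum_mono)
      fix i assume i: "i \<in> {1..n}"
      show "exp ?K * qnorm2 0 p (grad i (u 0)) \<le> q' i t"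
      proof (cases "infl i = 0")
        case True
        then show ?thesis using i p by (simp add: u_0 qnorm2_grad_g q'_def)
      next
        case False
        then have f0: "infl i > 0" using infl_bounds[of i] by simp
        have "infl i powr (2/p) \<le> infl i powr (1 + a * t)"
          using two_div_two_minus[of "\<sigma> * t"] \<sigma>t infl_bounds[of i] f0
          by (intro powr_mono') (auto simp: p_def a_def)
        also have "\<dots> = infl i * exp (- (a * t) * (l i - 1))"
        proof -
          have "infl i powr (a * t) = exp (- (a * t) * (l i - 1))"
            using f0 by (simp add: powr_def l_def ln_div)
          then show ?thesis using f0 powr_mult_base[of "infl i" "a * t"] by simp
        qed
        also have "\<dots> = infl i * (exp (a * t) * exp (- (a * l i) * t))"
          unfolding exp_add[symmetric] by (simp add: algebra_simps)
        also have "\<dots> \<le> infl i * (exp 1 * exp (- (a * l i) * t))"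
          using a t f0 mult_mono[of a 1 t 1] by (intro mult_left_mono mult_right_mono) auto
        finally have "exp ?K * (4 * infl i powr (2/p)) \<le> exp ?K * (4 * (infl i * (exp 1 * exp (- (a * l i) * t))))"
          by (intro mult_left_mono) auto
        also have "\<dots> = q' i t"
          using False unfolding q'_def B_def exp_add by simp
        finally show ?thesis using i p by (simp add: u_0 qnorm2_grad_g)
      qed
    qed
    finally have "0 \<le> - 2 * energy (u t) (u t) + (\<Sum>i=1..n. q' i t)" by simp
    with dZ show "\<exists>y. (Z has_real_derivative y) (at t) \<and> 0 \<le> y" by blast
  qed simp
  moreover have "Z 0 = var"
  proof -
    have "q i 0 = 0" for i by (simp add: q_def)
    then show ?thesis by (simp add: Z_def u_0 mean_g_sq)
  qed
  moreover have "Z 1 \<le> exp (- decay_rate \<beta> \<delta>) * var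
     + (B / a) * (\<Sum>i=1..n. if infl i = 0 then 0 else infl i / l i)"
  proof -
    have "q i 1 \<le> (B / a) * (if infl i = 0 then 0 else infl i / l i)" for i
    proof (cases "infl i = 0")
      case False
      have "B * infl i * (1 - exp (- (a * l i) * 1)) \<le> B * infl i * 1"
        using infl_bounds[of i] by (intro mult_left_mono) (auto simp: B_def)
      then have "q i 1 \<le> B * infl i * 1 / (a * l i)"
        unfolding q_def using False a l[OF False] by (simp add: divide_right_mono)
      then show ?thesis using False by simp
    qed (simp add: q_def)
    then have "(\<Sum>i=1..n. q i 1) \<le> (B / a) * (\<Sum>i=1..n. if infl i = 0 then 0 else infl i / l i)"
      unfolding sum_distrib_left by (rule sum_mono)
    then show ?thesis using mean_u_sq_decay[of 1] by (simp add: Z_def)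
  qed
  ultimately have "(1 - exp (- decay_rate \<beta> \<delta>)) * var
     \<le> (B / a) * (\<Sum>i=1..n. if infl i = 0 then 0 else infl i / l i)"
    by (simp add: algebra_simps)
  then have "(a / B) * ((1 - exp (- decay_rate \<beta> \<delta>)) * var)
     \<le> (a / B) * ((B / a) * (\<Sum>i=1..n. if infl i = 0 then 0 else infl i / l i))"
    using a by (intro mult_left_mono) (auto simp: B_def)
  moreover have "(a / B) * ((1 - exp (- decay_rate \<beta> \<delta>)) * var) = L1_L2_const \<beta> \<delta> * var"
    by (simp add: L1_L2_const_def a_def B_def add_ac mult_ac)
  ultimately have "L1_L2_const \<beta> \<delta> * var \<le> (\<Sum>i=1..n. if infl i = 0 then 0 else infl i / l i)"
    using a by (simp add: B_def)
  then show ?thesis unfolding l_def .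
qed

text \<open>If the largest influence is at least \<open>1 / sqrt n\<close>, it exceeds \<open>ln n / (2 n)\<close>; otherwise every
  logarithm in the \<open>L\<^sup>1\<close>-\<open>L\<^sup>2\<close> inequality is at least \<open>ln n / 2\<close>.\<close>
theorem kkl:
  assumes C: "C \<le> 1/2" "C \<le> L1_L2_const \<beta> \<delta> / 2" "0 \<le> C"
  shows "C * (ln n / n) * var \<le> (MAX i\<in>{1..n}. infl i)"
proof -
  define M where "M = (MAX i\<in>{1..n}. infl i)"
  have M: "infl i \<le> M" if "i \<in> {1..n}" for i
    unfolding M_def using that by (intro Max_ge) auto
  have n: "real n \<ge> 1" "ln n \<ge> 0" using n_pos by auto
  have M0: "0 \<le> M" using M[of 1] infl_bounds[of 1] n_pos by simp
  have "C * (ln n / n) * var \<le> M"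
  proof (cases "1 / sqrt n \<le> M")
    case True
    have "ln n = 2 * ln (sqrt n)" using n by (simp add: ln_sqrt)
    also have "\<dots> \<le> 2 * sqrt n" using ln_le_minus_one[of "sqrt n"] n by simp
    finally have "ln n / n \<le> 2 * sqrt n / (sqrt n * sqrt n)" using n by (simp add: divide_right_mono)
    also have "\<dots> = 2 * (1 / sqrt n)" using n by (simp add: field_simps)
    finally have "ln n / n \<le> 2 * M" using True by simp
    then have "C * (ln n / n) * var \<le> 1/2 * (2 * M) * 1"
      using C n var_bounds M0 by (intro mult_mono) auto
    then show ?thesis by simp
  next
    case False
    define L where "L = 1 + ln n / 2"
    have L: "1 \<le> L" using n by (simp add: L_def)
    have "(if infl i = 0 then 0 else infl i / (1 + ln (1 / infl i))) \<le> M / L" if i: "i \<in> {1..n}" for i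
    proof (cases "infl i = 0")
      case True then show ?thesis using M0 L by simp
    next
      case nz: False
      then have pos: "infl i > 0" using infl_bounds[of i] by simp
      have "infl i \<le> 1 / sqrt n" using M[OF i] False by simp
      then have "ln (infl i) \<le> ln (1 / sqrt n)" using pos n by (subst ln_le_cancel_iff) auto
      also have "\<dots> = - (ln n / 2)" using n by (simp add: ln_div ln_sqrt)
      finally have "L \<le> 1 + ln (1 / infl i)" using pos by (simp add: L_def ln_div)
      then show ?thesis using nz pos L M[OF i] M0 by (simp add: frac_le)
    qed
    then have "(\<Sum>i=1..n. if infl i = 0 then 0 else infl i / (1 + ln (1 / infl i))) \<le> (\<Sum>i=1..n. M / L)"
      by (rule sum_mono)
    also have "\<dots> = n * M / L" by simp
    finally have "L1_L2_const \<beta> \<delta> * var \<le> n * M / L" using talagrand_L1_L2 by linarith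
    then have a: "L1_L2_const \<beta> \<delta> * var * L \<le> n * M" using L by (simp add: field_simps)
    have "C * ln n * var \<le> (L1_L2_const \<beta> \<delta> / 2) * ln n * var"
      using C n var_bounds by (intro mult_right_mono) auto
    also have "\<dots> = L1_L2_const \<beta> \<delta> * var * (ln n / 2)" by simp
    also have "\<dots> \<le> L1_L2_const \<beta> \<delta> * var * L"
      using L1_L2_const_pos[OF \<beta>_pos \<delta>_pos] var_bounds by (intro mult_left_mono) (auto simp: L_def)
    finally have "C * ln n * var \<le> n * M" using a by linarith
    then show ?thesis using n by (simp add: field_simps)
  qed
  then show ?thesis by (simp add: M_def)
qed

end

section \<open>From Dobrushin's matrix to the flip rates\<close>

lemma d_TV_ge:
  "\<bar>measure_pmf.prob p A - measure_pmf.prob q A\<bar> \<le> d_TV p q"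
  unfolding d_TV_def
proof (rule cSUP_upper)
  show "bdd_above (range (\<lambda>A. \<bar>measure_pmf.prob p A - measure_pmf.prob q A\<bar>))"
  proof (rule bdd_aboveI2)
    fix A
    show "\<bar>measure_pmf.prob p A - measure_pmf.prob q A\<bar> \<le> 1"
      using measure_pmf.prob_le_1[of p A] measure_pmf.prob_le_1[of q A]
        measure_nonneg[of p A] measure_nonneg[of q A] by (intro abs_leI) linarith+
  qed
qed simp

lemma d_TV_nonneg: "0 \<le> d_TV p q"
  using d_TV_ge[of p "{}" q] by simp

lemma drop_coord_eq_iff:
  assumes "x \<in> cube n" "z \<in> cube n" "i \<in> {1..n}"
  shows "drop_coord n i z = drop_coord n i x \<longleftrightarrow> z = x \<or> z = flip i x"
proof
  assume eq: "drop_coord n i z = drop_coord n i x"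
  have off: "z j = x j" if "j \<in> {1..n}" "j \<noteq> i" for j
    using fun_cong[OF eq, of j] that by (simp add: drop_coord_def)
  show "z = x \<or> z = flip i x"
  proof (cases "z i = x i")
    case True
    have "z = x" by (rule cube_eqI[OF assms(2,1)]) (use True off in metis)
    then show ?thesis ..
  next
    case False
    then have "z i = - x i" using cube_value[OF assms(1,3)] cube_value[OF assms(2,3)] by auto
    have "z = flip i x"
    proof (rule cube_eqI[OF assms(2) flip_in_cube[OF assms(1,3)]])
      fix j assume "j \<in> {1..n}"
      then show "z j = flip i x j" using off \<open>z i = - x i\<close> by (cases "j = i") (auto simp: flip_apply)
    qed
    then show ?thesis ..
  qed
next
  assume "z = x \<or> z = flip i x"
  then show "drop_coord n i z = drop_coord n i x"
    by (auto simp: drop_coord_def flip_apply restrict_def)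
qed

lemma flip_neq: "x \<in> cube n \<Longrightarrow> i \<in> {1..n} \<Longrightarrow> flip i x \<noteq> x"
  using cube_value[of x n i] by (auto simp: flip_def fun_eq_iff)

lemma cond_law_flip:
  assumes supp: "set_pmf \<mu> = cube n" and x: "x \<in> cube n" and i: "i \<in> {1..n}"
  shows "measure_pmf.prob (cond_law n \<mu> i (drop_coord n i x)) {- x i} = flip_rate (pmf \<mu>) i x"
proof -
  let ?E = "{z. drop_coord n i z = drop_coord n i x}"
  have E: "set_pmf \<mu> \<inter> ?E = {x, flip i x}"
    using drop_coord_eq_iff[OF x _ i] x i by (auto simp: supp)
  then have ne: "set_pmf \<mu> \<inter> ?E \<noteq> {}" by blast
  have mE: "measure_pmf.prob \<mu> ?E = pmf \<mu> x + pmf \<mu> (flip i x)"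
  proof -
    have "measure_pmf.prob \<mu> ?E = measure_pmf.prob \<mu> (?E \<inter> set_pmf \<mu>)" by (simp add: measure_Int_set_pmf)
    also have "?E \<inter> set_pmf \<mu> = {x, flip i x}" using E by blast
    finally show ?thesis using flip_neq[OF x i] by (simp add: measure_measure_pmf_finite)
  qed
  have "measure_pmf.prob (cond_law n \<mu> i (drop_coord n i x)) {- x i}
      = measure_pmf.prob (cond_pmf \<mu> ?E) {z. z i = - x i}"
    unfolding cond_law_def measure_map_pmf by (rule arg_cong[where f="measure_pmf.prob _"]) auto
  also have "\<dots> = measure_pmf.prob (cond_pmf \<mu> ?E) ({z. z i = - x i} \<inter> set_pmf (cond_pmf \<mu> ?E))"
    by (simp add: measure_Int_set_pmf)
  also have "{z. z i = - x i} \<inter> set_pmf (cond_pmf \<mu> ?E) = {flip i x}"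
    unfolding set_cond_pmf[OF ne] E using cube_value[OF x i] by (auto simp: flip_apply)
  also have "measure_pmf.prob (cond_pmf \<mu> ?E) {flip i x} = pmf (cond_pmf \<mu> ?E) (flip i x)"
    by (simp add: measure_pmf_single)
  also have "\<dots> = pmf \<mu> (flip i x) / (pmf \<mu> x + pmf \<mu> (flip i x))"
    using E unfolding pmf_cond[OF ne] mE by auto
  finally show ?thesis by (simp add: flip_rate_def)
qed

lemma dobrushin_ge:
  assumes "i \<noteq> j" "x \<in> cube n"
  shows "d_TV (cond_law n \<mu> i (drop_coord n i x)) (cond_law n \<mu> i (drop_coord n i (flip j x)))
    \<le> dobrushin n \<mu> i j"
  using assms unfolding dobrushin_def by (auto intro!: Max_ge)

lemma dobrushin_nonneg: "0 \<le> dobrushin n \<mu> i j"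
proof (cases "i = j")
  case False
  obtain x where "x \<in> cube n" using cube_nonempty by blast
  from dobrushin_ge[OF False this, of \<mu>] show ?thesis using d_TV_nonneg order_trans by blast
qed (simp add: dobrushin_def)

text \<open>The flip rate at \<open>i\<close> is the probability of one event, the value \<open>- x i\<close>, under the conditional law;
  the flip of \<open>j\<close> does not change the event.\<close>
lemma dobrushin_rate:
  assumes supp: "set_pmf \<mu> = cube n" and x: "x \<in> cube n"
    and ij: "i \<in> {1..n}" "j \<in> {1..n}" "i \<noteq> j"
  shows "\<bar>grad j (flip_rate (pmf \<mu>) i) x\<bar> \<le> dobrushin n \<mu> i j"
proof -
  have same: "flip j x i = x i" using ij by (simp add: flip_apply)
  have "\<bar>grad j (flip_rate (pmf \<mu>) i) x\<bar>
    = \<bar>measure_pmf.prob (cond_law n \<mu> i (drop_coord n i x)) {- x i}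
       - measure_pmf.prob (cond_law n \<mu> i (drop_coord n i (flip j x))) {- x i}\<bar>"
    using cond_law_flip[OF supp x ij(1)] cond_law_flip[OF supp flip_in_cube[OF x ij(2)] ij(1)]
    by (simp add: grad_def same abs_minus_commute)
  also have "\<dots> \<le> dobrushin n \<mu> i j"
    using d_TV_ge dobrushin_ge[OF ij(3) x] order_trans by blast
  finally show ?thesis .
qed

text \<open>A supremum of reals says something only for a bounded set, which in finite dimension it is; by
  homogeneity the bound extends from the unit ball to all vectors.\<close>
lemma op_norm_2_bound:
  assumes "op_norm_2 n A \<le> r" "0 \<le> r"
  shows "(\<Sum>i=1..n. (mat_vec n A v i)\<^sup>2) \<le> r\<^sup>2 * (\<Sum>j=1..n. (v j)\<^sup>2)"
proof -
  let ?N = "L2_set v {1..n}" and ?V = "{v. L2_set v {1..n} \<le> 1}"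
  have bdd: "bdd_above ((\<lambda>v. L2_set (mat_vec n A v) {1..n}) ` ?V)"
  proof (rule bdd_aboveI2)
    fix w assume w: "w \<in> ?V"
    have wj: "\<bar>w j\<bar> \<le> 1" if "j \<in> {1..n}" for j
    proof -
      have "\<bar>w j\<bar> \<le> L2_set (\<lambda>j. \<bar>w j\<bar>) {1..n}" using that by (intro member_le_L2_set) auto
      also have "\<dots> = L2_set w {1..n}" by (simp add: L2_set_def)
      finally show ?thesis using w by simp
    qed
    have "\<bar>mat_vec n A w i\<bar> \<le> (\<Sum>j=1..n. \<bar>A i j\<bar>)" for i
      unfolding mat_vec_def
    proof (intro order_trans[OF sum_abs] sum_mono)
      fix j assume "j \<in> {1..n}"
      then show "\<bar>A i j * w j\<bar> \<le> \<bar>A i j\<bar>"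
        using mult_left_mono[OF wj, of j "\<bar>A i j\<bar>"] by (simp add: abs_mult)
    qed
    then show "L2_set (mat_vec n A w) {1..n} \<le> (\<Sum>i=1..n. \<Sum>j=1..n. \<bar>A i j\<bar>)"
      using L2_set_le_sum_abs[of "mat_vec n A w" "{1..n}"] sum_mono[of "{1..n}" "\<lambda>i. \<bar>mat_vec n A w i\<bar>"]
      by (meson order_trans)
  qed
  have "L2_set (mat_vec n A v) {1..n} \<le> r * ?N"
  proof (cases "?N = 0")
    case True
    then have "mat_vec n A v i = 0" for i by (simp add: mat_vec_def L2_set_eq_0_iff)
    then show ?thesis using True by (simp add: L2_set_def)
  next
    case False
    then have N: "?N > 0" using L2_set_nonneg[of v "{1..n}"] by linarith
    define w where "w j = (1 / ?N) * v j" for j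
    have "L2_set w {1..n} = (1 / ?N) * ?N"
      unfolding w_def using N by (subst L2_set_right_distrib) auto
    then have "w \<in> ?V" using N by simp
    then have "L2_set (mat_vec n A w) {1..n} \<le> op_norm_2 n A"
      unfolding op_norm_2_def by (rule cSUP_upper[OF _ bdd])
    then have "L2_set (mat_vec n A w) {1..n} \<le> r" using assms(1) by linarith
    moreover have "mat_vec n A w = (\<lambda>i. (1 / ?N) * mat_vec n A v i)"
      by (intro ext) (simp add: mat_vec_def w_def sum_distrib_left mult_ac)
    then have "L2_set (mat_vec n A w) {1..n} = (1 / ?N) * L2_set (mat_vec n A v) {1..n}"
    proof (simp only:)
      show "L2_set (\<lambda>i. (1 / ?N) * mat_vec n A v i) {1..n} = (1 / ?N) * L2_set (mat_vec n A v) {1..n}"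
        using N by (subst L2_set_right_distrib) auto
    qed
    ultimately show ?thesis using N by (simp add: field_simps)
  qed
  then have "(L2_set (mat_vec n A v) {1..n})\<^sup>2 \<le> (r * ?N)\<^sup>2" by (intro power_mono) auto
  then show ?thesis by (simp add: L2_set_def power_mult_distrib sum_nonneg)
qed

text \<open>Marginal boundedness bounds the flip rates below by \<open>b\<^sup>2 / (1 + b\<^sup>2)\<close>, which is at least
  \<open>b\<^sup>2 / 2\<close>.\<close>
lemma weakly_dependent_dobrushin:
  fixes \<mu> :: "(nat \<Rightarrow> real) pmf"
  assumes n: "1 \<le> n" and b: "0 < b" "b \<le> 1" and d: "0 < \<delta>" "\<delta> < 1"
    and supp: "set_pmf \<mu> = cube n"
    and marg: "\<And>i x. i \<in> {1..n} \<Longrightarrow> x \<in> cube n \<Longrightarrow> b \<le> sqrt (pmf \<mu> (flip i x) / pmf \<mu> x)"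
    and norm: "op_norm_2 n (dobrushin n \<mu>) \<le> 1 - \<delta>"
  shows "weakly_dependent n (pmf \<mu>) (dobrushin n \<mu>) (b\<^sup>2 / 2) \<delta>"
proof
  show pos: "0 < pmf \<mu> x" if "x \<in> cube n" for x
    using that supp by (simp add: pmf_positive)
  show "(\<Sum>x\<in>cube n. pmf \<mu> x) = 1" using supp by (intro sum_pmf_eq_1) auto
  show "(b\<^sup>2 / 2) * (pmf \<mu> x + pmf \<mu> (flip i x)) \<le> pmf \<mu> x" if i: "i \<in> {1..n}" and x: "x \<in> cube n" for i x
  proof -
    have y: "flip i x \<in> cube n" using i x by simp
    have "b\<^sup>2 \<le> (sqrt (pmf \<mu> x / pmf \<mu> (flip i x)))\<^sup>2"
      using marg[OF i y] b by (intro power_mono) auto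
    then have "b\<^sup>2 * pmf \<mu> (flip i x) \<le> pmf \<mu> x" using pos[OF y] by (simp add: field_simps)
    moreover have "b\<^sup>2 * pmf \<mu> x \<le> 1 * pmf \<mu> x"
      using b by (intro mult_right_mono) (auto simp: power_le_one)
    ultimately show ?thesis by (simp add: field_simps)
  qed
  show "(\<Sum>i=1..n. (\<Sum>j=1..n. dobrushin n \<mu> i j * v j)\<^sup>2) \<le> (1 - \<delta>)\<^sup>2 * (\<Sum>j=1..n. (v j)\<^sup>2)" for v
    using op_norm_2_bound[OF norm, of v] d by (simp add: mat_vec_def)
  show "dobrushin n \<mu> i i = 0" for i by (simp add: dobrushin_def)
qed (use n b d dobrushin_nonneg dobrushin_rate[OF supp] in auto)

theorem theorem1p1:
  fixes b \<delta> C\<^sub>0 :: real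
  assumes "0 < b" and "b \<le> 1" and "0 < \<delta>" and "\<delta> < 1" and "0 < C\<^sub>0"
  shows "\<exists>C>0. \<forall>n\<ge>1. \<forall>\<mu> :: (nat \<Rightarrow> real) pmf.
    set_pmf \<mu> = cube n \<longrightarrow>
    (\<forall>i\<in>{1..n}. \<forall>x\<in>cube n.
       b \<le> sqrt (pmf \<mu> (flip i x) / pmf \<mu> x) \<and> sqrt (pmf \<mu> (flip i x) / pmf \<mu> x) \<le> 1 / b) \<longrightarrow>
    op_norm_1 n (dobrushin n \<mu>) \<le> C\<^sub>0 \<longrightarrow>
    op_norm_2 n (dobrushin n \<mu>) \<le> 1 - \<delta> \<longrightarrow>
    (\<forall>f \<in> cube n \<rightarrow> {-1, 1}.
       (MAX i\<in>{1..n}. Infl \<mu> i f) \<ge> C * (ln (real n) / real n) * Vari \<mu> f \<and>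
       C * Vari \<mu> f \<le> (\<Sum>i=1..n. if Infl \<mu> i f = 0 then 0
                                 else Infl \<mu> i f / (1 + ln (1 / Infl \<mu> i f))) \<and>
       SA n \<mu> f \<ge> (if Vari \<mu> f = 0 then 0
                     else C * Vari \<mu> f * sqrt (ln (exp 1 / Vari \<mu> f))) \<and>
       SA n \<mu> f \<ge> (if Vari \<mu> f = 0 then 0
                     else C * Vari \<mu> f * sqrt (ln (1 + exp 1 / SqInf n \<mu> f))))"
proof -
  define \<beta> where "\<beta> = b\<^sup>2 / 2"
  have \<beta>: "0 < \<beta>" using assms by (simp add: \<beta>_def)
  note pos = \<beta> assms(3)
  define C where "C = Min {1/2, L1_L2_const \<beta> \<delta> / 2, talagrand_surface_const \<beta> \<delta>, eldan_gross_const \<beta> \<delta>}"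
  have C: "0 < C" "C \<le> 1/2" "C \<le> L1_L2_const \<beta> \<delta> / 2" "C \<le> talagrand_surface_const \<beta> \<delta>" "C \<le> eldan_gross_const \<beta> \<delta>"
    using L1_L2_const_pos[OF pos] talagrand_surface_const_pos[OF pos] eldan_gross_const_pos[OF pos]
    by (auto simp: C_def)
  show ?thesis
  proof (intro exI[of _ C] conjI C(1) allI impI ballI)
    fix n :: nat and \<mu> :: "(nat \<Rightarrow> real) pmf" and f :: "(nat \<Rightarrow> real) \<Rightarrow> real"
    assume n: "1 \<le> n" and supp: "set_pmf \<mu> = cube n"
      and marg: "\<forall>i\<in>{1..n}. \<forall>x\<in>cube n.
       b \<le> sqrt (pmf \<mu> (flip i x) / pmf \<mu> x) \<and> sqrt (pmf \<mu> (flip i x) / pmf \<mu> x) \<le> 1 / b"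
      and norm: "op_norm_2 n (dobrushin n \<mu>) \<le> 1 - \<delta>"
      and f: "f \<in> cube n \<rightarrow> {-1, 1}"
    interpret weakly_dependent n "pmf \<mu>" "dobrushin n \<mu>" \<beta> \<delta>
      unfolding \<beta>_def using marg by (intro weakly_dependent_dobrushin n assms supp norm) auto
    interpret boolean_function n "pmf \<mu>" "dobrushin n \<mu>" \<beta> \<delta> f
      by unfold_locales (use f in auto)
    have E: "measure_pmf.expectation \<mu> h = mean h" for h
      unfolding mean_def using supp by (subst integral_measure_pmf_real[of "cube n"]) (auto simp: mult.commute)
    have I: "Infl \<mu> i f = infl i" for i
    proof -
      have "Infl \<mu> i f = measure_pmf.prob \<mu> ({x. f (flip i x) \<noteq> f x} \<inter> set_pmf \<mu>)"
        by (simp add: Infl_def measure_Int_set_pmf)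
      also have "{x. f (flip i x) \<noteq> f x} \<inter> set_pmf \<mu> = {x \<in> cube n. f (flip i x) \<noteq> f x}"
        using supp by auto
      also have "measure_pmf.prob \<mu> \<dots> = (\<Sum>x\<in>cube n. if f (flip i x) \<noteq> f x then pmf \<mu> x else 0)"
        by (simp add: measure_measure_pmf_finite sum.inter_filter)
      also have "\<dots> = infl i" unfolding infl_def mean_def by (intro sum.cong) auto
      finally show ?thesis .
    qed
    have V: "Vari \<mu> f = var"
    proof -
      have "mean (\<lambda>x. (f x)\<^sup>2) = mean (\<lambda>_. 1)" by (rule mean_cong) (rule f_sq)
      then show ?thesis by (simp add: Vari_def E var_def)
    qed
    have S: "SA n \<mu> f = surface" by (simp add: SA_def E surface_def sens_def sensitivity_def)
    have Q: "SqInf n \<mu> f = sq_infl" by (simp add: SqInf_def I sq_infl_def)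
    have scale: "C * var * y \<le> D * var * y" if "C \<le> D" "0 \<le> y" for D y
      using that var_bounds by (intro mult_right_mono) auto
    show "C * (ln (real n) / real n) * Vari \<mu> f \<le> (MAX i\<in>{1..n}. Infl \<mu> i f)"
      unfolding I V using C by (intro kkl) auto
    have "C * var \<le> L1_L2_const \<beta> \<delta> * var"
      using C L1_L2_const_pos[OF pos] var_bounds by (intro mult_right_mono) auto
    then show "C * Vari \<mu> f \<le> (\<Sum>i=1..n. if Infl \<mu> i f = 0 then 0
        else Infl \<mu> i f / (1 + ln (1 / Infl \<mu> i f)))"
      unfolding I V using talagrand_L1_L2 by linarith
    have e: "1 \<le> exp 1 / var" if "var \<noteq> 0"
    proof -
      have "var \<le> exp 1" using var_bounds exp_ge_add_one_self[of 1] by linarith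
      then show ?thesis using var_bounds that by (simp add: field_simps)
    qed
    show "(if Vari \<mu> f = 0 then 0 else C * Vari \<mu> f * sqrt (ln (exp 1 / Vari \<mu> f))) \<le> SA n \<mu> f"
      unfolding V S using surface_nonneg talagrand_surface scale[OF C(4)] e
      by (auto intro!: order_trans[OF scale[OF C(4)]])
    show "(if Vari \<mu> f = 0 then 0 else C * Vari \<mu> f * sqrt (ln (1 + exp 1 / SqInf n \<mu> f))) \<le> SA n \<mu> f"
      unfolding V S Q using surface_nonneg eldan_gross sq_infl_nonneg
      by (auto intro!: order_trans[OF scale[OF C(5)]] ln_ge_zero)
  qed
qed

end
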